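(* Let $\{S_n\}_{n\ge 0}$ and $\{S'_n\}_{n\ge 0}$ be two independent one-dimensional elephant random walks on $\mathbb{Z}$ with memory parameters $p$ and $p'$ respectively. If $0<p<3/4$ and $0<p'<3/4$, then \[ \limsup_{n\to\infty}\pm\frac{S_n-S'_n}{\sqrt{2n\log\log n}}=\sqrt{\frac{1}{3-4p}+\frac{1}{3-4p'}}\quad\text{almost surely} \] (for both choices of sign).
   Context: An elephant random walk (ERW) on $\mathbb{Z}$ with memory parameter $p\in[0,1]$ (and first-step parameter $q\in[0,1]$) is defined as follows. The first step $X_1$ equals $+1$ with probability $q$ and $-1$ with probability $1-q$. For each $n\ge 1$, given $X_1,\dots,X_n$, let $U_n$ be uniformly distributed on $\{1,\dots,n\}$ independent of $X_1,\dots,X_n$, and set $X_{n+1}=X_{U_n}$ with probability $p$ and $X_{n+1}=-X_{U_n}$ with probability $1-p$. The walk is $S_0=0$, $S_n=\sum_{i=1}^n X_i$ for $n\ge 1$. *)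

theory Defs
  imports "HOL-Probability.Probability"
begin

text \<open>Elephant random walk. Steps are indexed from 0: the list xs = [x_1,...,x_n]
  of the first n steps; X i is the (i+1)-th step.\<close>

definition erw_first_prob :: "real \<Rightarrow> int \<Rightarrow> real" where
  "erw_first_prob q x = (if x = 1 then q else if x = -1 then 1 - q else 0)"

text \<open>Probability that the next step equals x given the history hist (length k \<ge> 1):
  a uniformly chosen past step is repeated with probability p, reversed with 1-p.\<close>
definition erw_step_prob :: "real \<Rightarrow> int list \<Rightarrow> int \<Rightarrow> real" where
  "erw_step_prob p hist x =
     (\<Sum>j<length hist. if hist ! j = x then p else 1 - p) / real (length hist)"

definition erw_path_prob :: "real \<Rightarrow> real \<Rightarrow> int list \<Rightarrow> real" where
  "erw_path_prob p q xs =
     (if xs = [] then 1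
      else erw_first_prob q (hd xs) *
           (\<Prod>k\<in>{1..<length xs}. erw_step_prob p (take k xs) (xs ! k)))"

definition indep_erw_pair ::
  "'a measure \<Rightarrow> real \<Rightarrow> real \<Rightarrow> real \<Rightarrow> real \<Rightarrow> (nat \<Rightarrow> 'a \<Rightarrow> int) \<Rightarrow> (nat \<Rightarrow> 'a \<Rightarrow> int) \<Rightarrow> bool" where
  "indep_erw_pair M p q p' q' X Y \<longleftrightarrow>
     (\<forall>i. X i \<in> measurable M (count_space UNIV)) \<and>
     (\<forall>i. Y i \<in> measurable M (count_space UNIV)) \<and>
     (\<forall>xs ys. set xs \<subseteq> {-1, 1} \<longrightarrow> set ys \<subseteq> {-1, 1} \<longrightarrow>
        measure M {\<omega> \<in> space M. (\<forall>i<length xs. X i \<omega> = xs ! i) \<and> (\<forall>i<length ys. Y i \<omega> = ys ! i)}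
        = erw_path_prob p q xs * erw_path_prob p' q' ys)"

definition walk :: "(nat \<Rightarrow> 'a \<Rightarrow> int) \<Rightarrow> nat \<Rightarrow> 'a \<Rightarrow> int" where
  "walk X n \<omega> = (\<Sum>i<n. X i \<omega>)"

end

theory Submission
  imports Defs "HOL-Real_Asymp.Real_Asymp"
begin

text \<open>Put \<open>a = 2 p - 1\<close>. Given the past, the next step of the walk has mean \<open>a S\<^sub>n / n\<close>, so
  \<open>B k N S\<^sub>k\<close> with \<open>B k N = (\<Prod>i=k..<N. 1 + a / i)\<close> is a martingale in \<open>k \<le> N\<close>, and the centred
  steps are sub-Gaussian with the sharp constant \<open>1\<close>. Hence \<open>S\<^sub>N\<close> is sub-Gaussian with variance proxy
  \<open>(\<Sum>k\<le>N. (B k N)\<^sup>2) \<sim> N / (1 - 2 a) = N / (3 - 4 p)\<close>. For two independent walks the bounds multiply.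
  A maximal inequality for each fixed \<open>N\<close> along a geometric sequence, with Borel--Cantelli, gives the upper
  bound. For the lower bound, the empirical mean \<open>S\<^sub>n / n\<close> stays small even under exponentially tilted laws,
  so the moment generating function is asymptotically Gaussian from below, conditionally on any
  history; tilting turns this into a lower tail bound, and a conditional Borel--Cantelli argument along
  factorials concludes.\<close>

subsection \<open>Two-point moment generating functions and variance asymptotics\<close>

text \<open>Separate laws of the iterated logarithm for S and S' do not give one for the difference,
  since limsups do not add; the tail bounds are therefore joint. They are proved for all
  combinations u S + w S': the pairs (1,-1) and (-1,1) give the theorem, while (1,0), (-1,0), (0,1),
  (0,-1) supply single-walk bounds that control error terms. The hypothesis p < 3/4 means a < 1/2.
  As \<open>B m N\<close> is at most of order (N/m)^a, what the past contributes to the walk at time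
  N is o(sqrt N) for fixed m, and the variance recursion V(n+1) = 1 + (1 + a/n)^2 V(n) has the
  approximate solution n / (1 - 2a). The lower bound must hold given every history, even one with
  endpoint m or -m. Its influence \<open>B m N * m\<close> is at most of order sqrt(m N), hence
  small against N once N exceeds a fixed multiple K m; the variance produced before K m is given up,
  at no cost when m is negligible against N. Conditioning is on finite lists of steps throughout, so
  conditional expectations are finite recursions, and independence of the walks appears as nesting
  two of them.\<close>

lemma exp_ge_cubic: "1 + x + x^2/2 + x^3/6 \<le> exp (x::real)"
proof -
  \<comment> \<open>The Lagrange remainder has even order 4, so it is nonnegative for negative
    \<open>x\<close> as well; both signs occur below.\<close>
  obtain t where "exp x = (\<Sum>m<4. x ^ m / fact m) + exp t / fact 4 * x ^ 4"
    using Maclaurin_exp_le[of x 4] by blast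
  moreover have "exp t / fact 4 * x ^ 4 \<ge> 0" by simp
  ultimately show ?thesis by (simp add: eval_nat_numeral field_simps)
qed

text \<open>Hoeffding's lemma for a variable on {-1, 1} with mean \<open>t\<close>: the range has
  length 2, so the constant is 2^2/8 = 1/2. The factor \<open>exp (-l)\<close> shifts the variable
  to {0, 2}, taken with probability \<open>r\<close> at 2. Negative \<open>l\<close> is treated
  afterwards by reflecting \<open>l\<close> and \<open>t\<close> together.\<close>

lemma two_point_mgf_le_nonneg:
  fixes l t :: real
  assumes "\<bar>t\<bar> \<le> 1" "l \<ge> 0"
  shows "(1 + t) / 2 * exp l + (1 - t) / 2 * exp (- l) \<le> exp (l * t + l^2 / 2)"
proof -
  define r where "r = (1 + t) / 2"
  have r: "r \<ge> 0" "r \<le> 1" using assms by (auto simp: r_def)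
  have pos: "1 + r * (exp (2*l) - 1) > 0"
    using r assms(2) by (smt (verit) mult_nonneg_nonneg one_le_exp_iff)
  have "- (2*l) * r + ln (1 + r * (exp (2*l) - 1)) \<le> (2*l)^2 / 8"
    using Hoeffdings_lemma_aux[of "2*l" r] r assms by (simp add: algebra_simps)
  then have "ln (1 + r * (exp (2*l) - 1)) \<le> 2*l*r + l^2/2" by (simp add: field_simps power2_eq_square)
  then have "1 + r * (exp (2*l) - 1) \<le> exp (2*l*r + l^2/2)"
    using pos by (metis exp_le_cancel_iff exp_ln)
  then have "exp (-l) * (1 + r * (exp (2*l) - 1)) \<le> exp (-l) * exp (2*l*r + l^2/2)" by simp
  also have "exp (-l) * exp (2*l*r + l^2/2) = exp (l*t + l^2/2)"
    by (simp add: r_def flip: exp_add) (simp add: field_simps)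
  also have "exp (-l) * (1 + r * (exp (2*l) - 1)) = (1 + t) / 2 * exp l + (1 - t) / 2 * exp (- l)"
  proof -
    have "exp (-l) * exp (2*l) = exp l" by (simp flip: exp_add)
    then have "exp (-l) * (1 + r * (exp (2*l) - 1)) = exp (-l) * (1 - r) + r * exp l"
      by (simp add: algebra_simps)
    then show ?thesis by (simp add: r_def field_simps)
  qed
  finally show ?thesis .
qed

lemma two_point_mgf_le:
  fixes l t :: real
  assumes "\<bar>t\<bar> \<le> 1"
  shows "(1 + t) / 2 * exp l + (1 - t) / 2 * exp (- l) \<le> exp (l * t + l^2 / 2)"
proof (cases "l \<ge> 0")
  case False
  then show ?thesis using two_point_mgf_le_nonneg[of "-t" "-l"] assms by (simp add: add.commute)
qed (use two_point_mgf_le_nonneg assms in auto)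

text \<open>The deviations 1 - t and -(1 + t) from the mean have first moment 0, second moment 1 -
  t^2 and third moment -2t(1 - t^2). The cubic minorant of \<open>exp\<close> thus leaves l^2/2 (1 -
  t^2) and an error of at most |l|^3/3. For small \<open>t\<close> this matches the upper bound to
  second order.\<close>

lemma two_point_mgf_ge:
  fixes l t :: real
  assumes "\<bar>t\<bar> \<le> 1"
  shows "exp (l * t) * (1 + l^2/2 * (1 - t^2) - \<bar>l\<bar>^3/3)
    \<le> (1 + t) / 2 * exp l + (1 - t) / 2 * exp (- l)"
proof -
  let ?x = "l * (1 - t)" and ?y = "- l * (1 + t)"
  let ?e = "\<lambda>x::real. 1 + x + x^2/2 + x^3/6"
  have t: "t \<le> 1" "-1 \<le> t" using assms by auto
  have t2: "0 \<le> 1 - t^2" "1 - t^2 \<le> 1" using assms by (auto simp: abs_square_le_1)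
  have cub: "l^3 * ((1 - t^2) * t) \<le> \<bar>l\<bar>^3"
  proof -
    have "\<bar>(1 - t^2) * t\<bar> \<le> 1 * 1" unfolding abs_mult by (intro mult_mono) (use t2 assms in auto)
    then have "\<bar>l^3 * ((1 - t^2) * t)\<bar> \<le> \<bar>l\<bar>^3 * 1"
      unfolding abs_mult power_abs by (intro mult_mono) auto
    then show ?thesis by linarith
  qed
  have "1 + l^2/2 * (1 - t^2) - l^3/3 * ((1 - t^2) * t) = (1 + t)/2 * ?e ?x + (1 - t)/2 * ?e ?y"
    by (simp add: field_simps eval_nat_numeral)
  also have "\<dots> \<le> (1 + t)/2 * exp ?x + (1 - t)/2 * exp ?y"
    using t by (intro add_mono mult_left_mono exp_ge_cubic) auto
  finally have "1 + l^2/2 * (1 - t^2) - \<bar>l\<bar>^3/3 \<le> (1 + t)/2 * exp ?x + (1 - t)/2 * exp ?y"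
    using cub by simp
  then have "exp (l * t) * (1 + l^2/2 * (1 - t^2) - \<bar>l\<bar>^3/3)
     \<le> exp (l * t) * ((1 + t)/2 * exp ?x + (1 - t)/2 * exp ?y)" by simp
  also have "\<dots> = (1 + t)/2 * (exp (l * t) * exp ?x) + (1 - t)/2 * (exp (l * t) * exp ?y)"
    by (simp add: distrib_left mult.left_commute)
  also have "exp (l * t) * exp ?x = exp l" by (simp flip: exp_add) (simp add: algebra_simps)
  also have "exp (l * t) * exp ?y = exp (- l)" by (simp flip: exp_add) (simp add: algebra_simps)
  finally show ?thesis .
qed

text \<open>Jensen's inequality. It keeps only the mean but is positive for every \<open>l\<close>;
  it serves for the early steps, whose variance is given up.\<close>

lemma two_point_mgf_ge_exp:
  fixes l t :: real
  assumes "\<bar>t\<bar> \<le> 1"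
  shows "exp (l * t) \<le> (1 + t) / 2 * exp l + (1 - t) / 2 * exp (- l)"
proof -
  have "exp (((1+t)/2) *\<^sub>R l + ((1-t)/2) *\<^sub>R (-l)) \<le> (1+t)/2 * exp l + (1-t)/2 * exp (-l)"
    using convex_onD[OF exp_convex, of "(1-t)/2" l "-l"] assms 
    by (simp add: field_simps)
  then show ?thesis by (simp add: field_simps)
qed

section \<open>Growth of the drift products and of the variance sums\<close>

definition drift_prod :: "real \<Rightarrow> nat \<Rightarrow> nat \<Rightarrow> real" where
  "drift_prod a m n = (\<Prod>k=m..<n. 1 + a / real k)"

text \<open>Step \<open>k\<close> enters with variance proxy 1 and is then multiplied by the drift
  factors with indices \<open>k\<close> to \<open>n - 1\<close>. The interval is open on the left
  because step \<open>m\<close> belongs to the given history.\<close>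

definition var_sum :: "real \<Rightarrow> nat \<Rightarrow> nat \<Rightarrow> real" where
  "var_sum a m n = (\<Sum>k\<in>{m<..n}. (drift_prod a k n)^2)"

lemma drift_prod_same [simp]: "drift_prod a n n = 1"
  by (simp add: drift_prod_def)

lemma drift_prod_Suc: "m \<le> n \<Longrightarrow> drift_prod a m (Suc n) = drift_prod a m n * (1 + a / real n)"
  by (simp add: drift_prod_def)

lemma drift_prod_left: "m < n \<Longrightarrow> drift_prod a m n = (1 + a / real m) * drift_prod a (Suc m) n"
  by (simp add: drift_prod_def prod.atLeast_Suc_lessThan)

lemma drift_factor_pos:
  assumes "-1 < a" "1 \<le> k" shows "0 < 1 + a / real k"
proof -
  have "- real k < a" using assms by linarith
  then show ?thesis using assms by (simp add: field_simps)
qed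

lemma drift_prod_pos: "-1 < a \<Longrightarrow> 1 \<le> m \<Longrightarrow> 0 < drift_prod a m n"
  unfolding drift_prod_def by (intro prod_pos) (auto intro: drift_factor_pos)

lemma var_sum_same [simp]: "var_sum a n n = 0"
  by (simp add: var_sum_def)

lemma var_sum_nonneg: "0 \<le> var_sum a m n"
  by (simp add: var_sum_def sum_nonneg)

lemma var_sum_Suc:
  assumes "m \<le> n"
  shows "var_sum a m (Suc n) = 1 + (1 + a / real n)^2 * var_sum a m n"
proof -
  have "{m<..Suc n} = insert (Suc n) {m<..n}" using assms by auto
  then have "var_sum a m (Suc n) = 1 + (\<Sum>k\<in>{m<..n}. (drift_prod a k (Suc n))^2)"
    by (simp add: var_sum_def)
  also have "(\<Sum>k\<in>{m<..n}. (drift_prod a k (Suc n))^2)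
    = (\<Sum>k\<in>{m<..n}. (1 + a / real n)^2 * (drift_prod a k n)^2)"
    by (intro sum.cong) (auto simp: drift_prod_Suc power_mult_distrib)
  finally show ?thesis by (simp add: var_sum_def sum_distrib_left)
qed

lemma var_sum_left:
  assumes "m < n"
  shows "var_sum a m n = (drift_prod a (Suc m) n)^2 + var_sum a (Suc m) n"
proof -
  have "{m<..n} = insert (Suc m) {Suc m<..n}" using assms by auto
  then show ?thesis by (simp add: var_sum_def)
qed

lemma var_sum_antimono: "m \<le> m' \<Longrightarrow> var_sum a m' n \<le> var_sum a m n"
  unfolding var_sum_def by (intro sum_mono2) auto

lemma ln_Suc_div:
  assumes "1 \<le> m" "m \<le> n"
  shows "ln (real (Suc n) / real m) = ln (real n / real m) + ln (1 + 1 / real n)"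
proof -
  have "real (Suc n) / real m = real n / real m * (1 + 1 / real n)" using assms by (simp add: field_simps)
  then show ?thesis using assms by (simp only:) (rule ln_mult_pos, auto intro: add_pos_nonneg)
qed

lemma harmonic_block_ge:
  assumes "1 \<le> m" "m \<le> n"
  shows "ln (real n / real m) \<le> (\<Sum>k=m..<n. 1 / real k)"
  using assms(2)
proof (induction n rule: dec_induct)
  case (step n)
  have "ln (real (Suc n) / real m) = ln (real n / real m) + ln (1 + 1 / real n)"
    using step assms by (intro ln_Suc_div) auto
  also have "ln (1 + 1 / real n) \<le> 1 / real n" by (intro ln_add_one_self_le_self) auto
  finally show ?case using step by simp
qed (use assms in auto)

lemma harmonic_block_le:
  assumes "1 \<le> m" "m \<le> n"
  shows "(\<Sum>k=m..<n. 1 / real k) \<le> 1 + ln (real n / real m)"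
proof -
  \<comment> \<open>The extra 1/n on the left reduces the induction step to 1/(n + 1) \<le> ln (1 +
    1/n).\<close>
  have "(\<Sum>k=m..<n. 1 / real k) + 1 / real n \<le> 1 / real m + ln (real n / real m)"
    using assms(2)
  proof (induction n rule: dec_induct)
    case (step n)
    have "1 / real (Suc n) \<le> ln (1 + 1 / real n)"
      using ln_add_one_self_le_self2[of "- 1 / real (Suc n)"] step assms
      by (subst ln_inverse[of "1 + 1 / real n", symmetric, THEN arg_cong[where f=uminus], simplified]) 
         (auto simp: field_simps)
    moreover have "ln (real (Suc n) / real m) = ln (real n / real m) + ln (1 + 1 / real n)"
      using step assms by (intro ln_Suc_div) auto
    ultimately show ?case using step by simp
  qed (use assms in auto)
  moreover have "1 / real m \<le> 1" "0 \<le> 1 / real n" using assms by auto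
  ultimately show ?thesis by linarith
qed

text \<open>From 1 + x \<le> exp x, with the harmonic sum compared to the logarithm from above or
  from below according to the sign of \<open>a\<close>. The comparison costs at most 1 in the
  exponent, hence the constant \<open>exp 1\<close>.\<close>

lemma drift_prod_le_powr:
  assumes "-1 < a" "a < 1" "1 \<le> m" "m \<le> n"
  shows "drift_prod a m n \<le> exp 1 * (real n / real m) powr a"
proof -
  have "drift_prod a m n \<le> (\<Prod>k=m..<n. exp (a / real k))"
    unfolding drift_prod_def
    by (intro prod_mono) (use assms drift_factor_pos in \<open>auto simp: exp_ge_add_one_self intro: less_imp_le\<close>)
  also have "\<dots> = exp (a * (\<Sum>k=m..<n. 1 / real k))"
    by (simp add: exp_sum[symmetric] sum_distrib_left)
  also have "\<dots> \<le> exp (1 + a * ln (real n / real m))"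
  proof (cases "a \<ge> 0")
    case True
    then have "a * (\<Sum>k=m..<n. 1 / real k) \<le> a * (1 + ln (real n / real m))"
      by (intro mult_left_mono harmonic_block_le) (use assms in auto)
    then show ?thesis using assms by (auto simp: algebra_simps)
  next
    case False
    then have "a * (\<Sum>k=m..<n. 1 / real k) \<le> a * ln (real n / real m)"
      by (intro mult_left_mono_neg harmonic_block_ge) (use assms in auto)
    then show ?thesis by auto
  qed
  also have "\<dots> = exp 1 * (real n / real m) powr a"
    using assms by (auto simp: powr_def exp_add)
  finally show ?thesis .
qed

text \<open>Together with its upper counterpart this is a bound free of \<open>a\<close> that tends
  to 1 as n/m does; it serves to pass between nearby times. Each factor is at least 1 - 1/k, and 1 -
  x \<ge> exp (-2x) is used for x \<le> 1/2, hence 2 \<le> m.\<close>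

lemma drift_prod_near_one:
  assumes "-1 < a" "a < 1" "2 \<le> m" "m \<le> n"
  shows "exp (- 2 * (real n - real m) / real m) \<le> drift_prod a m n"
proof -
  have "exp (- 2 / real m) ^ card {m..<n} \<le> drift_prod a m n"
    unfolding drift_prod_def prod_constant[symmetric]
  proof (intro prod_mono conjI)
    fix k assume k: "k \<in> {m..<n}"
    define x where "x = 1 / real k"
    have x: "0 < x" "x \<le> 1/2" "x \<le> 1 / real m" using k assms by (auto simp: x_def field_simps)
    have "exp (- 2 * x) \<le> 1 / (1 + 2 * x)" 
      using exp_ge_add_one_self[of "2*x"] x by (simp add: exp_minus field_simps)
    also have "\<dots> \<le> 1 - x" using x by (simp add: field_simps)
    also have "\<dots> \<le> 1 + a / real k"
      using mult_right_mono[of "-1" a x] assms x by (simp add: x_def)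
    finally have "exp (- 2 * x) \<le> 1 + a / real k" .
    moreover have "exp (- 2 / real m) \<le> exp (-2 * x)" using x by simp
    ultimately show "exp (- 2 / real m) \<le> 1 + a / real k" by linarith
  qed simp
  also have "exp (- 2 / real m) ^ card {m..<n} = exp (- 2 * (real n - real m) / real m)"
    using assms by (simp add: of_nat_diff field_simps flip: exp_of_nat_mult)
  finally show ?thesis .
qed

lemma drift_prod_near_one_le:
  assumes "-1 < a" "a < 1" "2 \<le> m" "m \<le> n"
  shows "drift_prod a m n \<le> exp (2 * (real n - real m) / real m)"
proof -
  have "drift_prod a m n \<le> exp (2 / real m) ^ card {m..<n}"
    unfolding drift_prod_def prod_constant[symmetric]
  proof (intro prod_mono conjI)
    fix k assume k: "k \<in> {m..<n}"
    have "1 + a / real k \<le> 1 + 2 / real m" using assms k by (intro add_left_mono frac_le) auto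
    also have "\<dots> \<le> exp (2 / real m)" by (rule exp_ge_add_one_self)
    finally show "1 + a / real k \<le> exp (2 / real m)" .
    show "0 \<le> 1 + a / real k" using drift_factor_pos[of a k] k assms by simp
  qed
  also have "exp (2 / real m) ^ card {m..<n} = exp (2 * (real n - real m) / real m)"
    using assms by (simp add: of_nat_diff mult.commute flip: exp_of_nat_mult)
  finally show ?thesis .
qed

text \<open>Exact solution of V(n+1) = 1 + (1 + a/n)^2 V(n) with V(m) = 0. The sequence c n
  satisfies the recursion up to the defect a^2 c / n, the second term is the homogeneous solution
  that restores V(m) = 0, and the sum carries every defect forward to time \<open>n\<close>.\<close>

lemma var_sum_eq:
  assumes "a < 1/2" "1 \<le> m" "m \<le> n"
  defines "c \<equiv> 1 / (1 - 2 * a)"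
  shows "var_sum a m n = c * real n - c * real m * (drift_prod a m n)^2
     + a^2 * c * (\<Sum>k=m..<n. (drift_prod a (Suc k) n)^2 / real k)"
  using assms(3)
proof (induction n rule: dec_induct)
  case (step n)
  let ?s = "\<lambda>n. \<Sum>k=m..<n. (drift_prod a (Suc k) n)^2 / real k"
  have n: "real n > 0" using step assms by simp
  have c: "1 + 2 * a * c = c" using assms(1) by (simp add: c_def field_simps)
  have s: "?s (Suc n) = (1 + a / real n)^2 * ?s n + 1 / real n"
  proof -
    have "?s (Suc n) = (\<Sum>k=m..<n. (drift_prod a (Suc k) (Suc n))^2 / real k) + 1 / real n"
      using step by simp
    also have "(\<Sum>k=m..<n. (drift_prod a (Suc k) (Suc n))^2 / real k)
       = (\<Sum>k=m..<n. (1 + a / real n)^2 * ((drift_prod a (Suc k) n)^2 / real k))"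
      by (intro sum.cong) (auto simp: drift_prod_Suc power_mult_distrib)
    finally show ?thesis by (simp add: sum_distrib_left)
  qed
  have "var_sum a m (Suc n) = 1 + (1 + a / real n)^2 * (c * real n)
      - (1 + a / real n)^2 * (c * real m * (drift_prod a m n)^2) + a^2 * c * ((1 + a / real n)^2 * ?s n)"
    by (simp only: var_sum_Suc[OF step(1)] step(3)) (simp add: algebra_simps)
  also have "1 + (1 + a / real n)^2 * (c * real n) = (1 + 2 * a * c) + c * real n + a^2 * c / real n"
    using n by (simp add: field_simps power2_eq_square)
  also have "\<dots> = c * real (Suc n) + a^2 * c / real n" unfolding c by (simp add: algebra_simps)
  also have "(1 + a / real n)^2 * (c * real m * (drift_prod a m n)^2) = c * real m * (drift_prod a m (Suc n))^2"
    using step by (simp add: drift_prod_Suc power_mult_distrib)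
  finally show ?case unfolding s by (simp add: algebra_simps)
qed simp

lemma var_sum_ge:
  assumes "a < 1/2" "1 \<le> m" "m \<le> n"
  shows "real n / (1 - 2 * a) - real m * (drift_prod a m n)^2 / (1 - 2 * a) \<le> var_sum a m n"
proof -
  have "0 \<le> a^2 * (1 / (1 - 2 * a)) * (\<Sum>k=m..<n. (drift_prod a (Suc k) n)^2 / real k)"
    using assms by (intro mult_nonneg_nonneg sum_nonneg) auto
  then show ?thesis using var_sum_eq[OF assms] by simp
qed

text \<open>The defects in \<open>var_sum_eq\<close> add up to at most order n^(2a) times the sum of
  k^(-1-2a), a series that diverges for a \<le> 0. Replacing 2a by the larger exponent
  \<open>\<alpha>\<close>, at least 1/2, makes it converge, and \<alpha> < 1 keeps the correction
  below order n.\<close>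

lemma var_sum_le:
  assumes "-1 < a" "a < 1/2"
  obtains C \<alpha> where "0 \<le> C" "0 < \<alpha>" "\<alpha> < 1"
    "\<And>n. 1 \<le> n \<Longrightarrow> var_sum a 1 n \<le> real n / (1 - 2 * a) + C * real n powr \<alpha>"
proof -
  define \<alpha> where "\<alpha> = max (2 * a) (1/2)"
  have \<alpha>: "0 < \<alpha>" "\<alpha> < 1" "2 * a \<le> \<alpha>" using assms by (auto simp: \<alpha>_def)
  define g where "g = (\<lambda>k::nat. 2 * real (Suc k) powr (- 1 - \<alpha>))"
  have sg: "summable g" unfolding g_def
    by (intro summable_mult, subst summable_Suc_iff, subst summable_real_powr_iff) (use \<alpha> in auto)
  define c where "c = 1 / (1 - 2 * a)"
  define C where "C = a^2 * c * (exp 1 ^ 2 * suminf g)"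
  have g0: "0 \<le> g k" for k by (simp add: g_def)
  have c0: "0 < c" using assms by (simp add: c_def)
  have C0: "0 \<le> C" unfolding C_def using c0 by (intro mult_nonneg_nonneg suminf_nonneg sg g0) auto
  have "var_sum a 1 n \<le> real n / (1 - 2 * a) + C * real n powr \<alpha>" if n: "1 \<le> n" for n
  proof -
    have b: "(drift_prod a (Suc k) n)^2 / real k \<le> exp 1 ^ 2 * real n powr \<alpha> * g k" if k: "k \<in> {1..<n}" for k
    proof -
      have kn: "1 \<le> k" "Suc k \<le> n" using k by auto
      have "(drift_prod a (Suc k) n)^2 \<le> (exp 1 * (real n / real (Suc k)) powr a)^2"
        by (intro power_mono drift_prod_le_powr less_imp_le[OF drift_prod_pos]) (use assms kn in auto)
      also have "\<dots> = exp 1 ^ 2 * (real n / real (Suc k)) powr (2 * a)"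
        using kn by (simp add: power_mult_distrib powr_powr[symmetric] powr_power)
      also have "\<dots> \<le> exp 1 ^ 2 * (real n / real (Suc k)) powr \<alpha>"
        by (intro mult_left_mono powr_mono) (use \<alpha> kn in \<open>auto simp: field_simps\<close>)
      finally have "(drift_prod a (Suc k) n)^2 \<le> exp 1 ^ 2 * (real n / real (Suc k)) powr \<alpha>" .
      moreover have "1 / real k \<le> 2 / real (Suc k)" using kn by (simp add: field_simps)
      ultimately have "(drift_prod a (Suc k) n)^2 * (1 / real k)
           \<le> exp 1 ^ 2 * (real n / real (Suc k)) powr \<alpha> * (2 / real (Suc k))"
        by (intro mult_mono) auto
      also have "\<dots> = exp 1 ^ 2 * real n powr \<alpha> * g k"
        using kn by (simp add: g_def powr_divide powr_diff powr_minus field_simps)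
      finally show ?thesis by simp
    qed
    have "(\<Sum>k=1..<n. (drift_prod a (Suc k) n)^2 / real k) \<le> (\<Sum>k=1..<n. exp 1 ^ 2 * real n powr \<alpha> * g k)"
      by (rule sum_mono) (rule b)
    also have "\<dots> = exp 1 ^ 2 * real n powr \<alpha> * (\<Sum>k=1..<n. g k)" by (simp add: sum_distrib_left)
    also have "\<dots> \<le> exp 1 ^ 2 * real n powr \<alpha> * suminf g"
      by (intro mult_left_mono sum_le_suminf sg) (auto simp: g0)
    finally have "a^2 * c * (\<Sum>k=1..<n. (drift_prod a (Suc k) n)^2 / real k)
       \<le> a^2 * c * (exp 1 ^ 2 * real n powr \<alpha> * suminf g)"
      using c0 by (intro mult_left_mono) auto
    moreover have "0 \<le> c * real 1 * (drift_prod a 1 n)^2" using c0 by simp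
    ultimately show ?thesis
      using var_sum_eq[OF assms(2) order_refl n, folded c_def] by (simp add: C_def c_def mult_ac)
  qed
  then show thesis using that[OF C0 \<alpha>(1,2)] by blast
qed

lemma var_sum_tendsto:
  assumes "-1 < a" "a < 1/2"
  shows "(\<lambda>n. var_sum a 1 n / real n) \<longlonglongrightarrow> 1 / (1 - 2 * a)"
proof -
  obtain C \<alpha> where C: "0 \<le> C" "0 < \<alpha>" "\<alpha> < 1"
    "\<And>n. 1 \<le> n \<Longrightarrow> var_sum a 1 n \<le> real n / (1 - 2 * a) + C * real n powr \<alpha>"
    using var_sum_le[OF assms] by blast
  let ?l = "\<lambda>n. 1 / (1 - 2 * a) - exp 1 ^ 2 / (1 - 2 * a) * real n powr (2 * a - 1)"
  let ?u = "\<lambda>n. 1 / (1 - 2 * a) + C * real n powr (\<alpha> - 1)"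
  have l: "?l \<longlonglongrightarrow> 1 / (1 - 2 * a) - exp 1 ^ 2 / (1 - 2 * a) * 0"
    by (intro tendsto_intros tendsto_neg_powr filterlim_real_sequentially) (use assms in auto)
  have u: "?u \<longlonglongrightarrow> 1 / (1 - 2 * a) + C * 0"
    by (intro tendsto_intros tendsto_neg_powr filterlim_real_sequentially) (use C in auto)
  show ?thesis
  proof (rule tendsto_sandwich[where f="?l" and h="?u"])
    show "\<forall>\<^sub>F n in sequentially. ?l n \<le> var_sum a 1 n / real n"
      using eventually_ge_at_top[of 1]
    proof eventually_elim
      case (elim n)
      have "(drift_prod a 1 n)^2 \<le> (exp 1 * (real n / real 1) powr a)^2"
        by (intro power_mono drift_prod_le_powr less_imp_le[OF drift_prod_pos]) (use assms elim in auto)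
      also have "\<dots> = exp 1 ^ 2 * real n powr (2 * a)" 
        using elim by (simp add: power_mult_distrib powr_power)
      finally have "(drift_prod a 1 n)^2 / (1 - 2 * a) \<le> exp 1 ^ 2 * real n powr (2 * a) / (1 - 2 * a)"
        using assms by (intro divide_right_mono) auto
      then have "real n / (1 - 2 * a) - exp 1 ^ 2 * real n powr (2 * a) / (1 - 2 * a) \<le> var_sum a 1 n"
        using var_sum_ge[OF assms(2) order_refl elim] by simp
      then have "(real n / (1 - 2 * a) - exp 1 ^ 2 * real n powr (2 * a) / (1 - 2 * a)) / real n
          \<le> var_sum a 1 n / real n" by (intro divide_right_mono) auto
      moreover have "(real n / (1 - 2 * a) - exp 1 ^ 2 * real n powr (2 * a) / (1 - 2 * a)) / real n = ?l n"
        using elim by (simp add: powr_diff diff_divide_distrib mult_ac)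
      ultimately show ?case by simp
    qed
    show "\<forall>\<^sub>F n in sequentially. var_sum a 1 n / real n \<le> ?u n"
      using eventually_ge_at_top[of 1]
    proof eventually_elim
      case (elim n)
      have "var_sum a 1 n / real n \<le> (real n / (1 - 2 * a) + C * real n powr \<alpha>) / real n"
        by (intro divide_right_mono C(4) elim) auto
      also have "\<dots> = ?u n" using elim by (simp add: powr_diff add_divide_distrib)
      finally show ?case .
    qed
  qed (use l u in auto)
qed

subsection \<open>Moment generating functions along the walk\<close>

definition pm_list :: "int list \<Rightarrow> bool" where
  "pm_list h \<longleftrightarrow> h \<noteq> [] \<and> set h \<subseteq> {-1, 1}"

definition endpoint :: "int list \<Rightarrow> real" where
  "endpoint h = real_of_int (sum_list h)"

lemma pm_list_snoc: "pm_list h \<Longrightarrow> x \<in> {-1, 1} \<Longrightarrow> pm_list (h @ [x])"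
  by (auto simp: pm_list_def)

lemma pm_list_length: "pm_list h \<Longrightarrow> 1 \<le> length h"
  by (cases h) (auto simp: pm_list_def)

lemma endpoint_snoc [simp]: "endpoint (h @ [x]) = endpoint h + real_of_int x"
  by (simp add: endpoint_def)

lemma abs_endpoint_le: "set h \<subseteq> {-1, 1} \<Longrightarrow> \<bar>endpoint h\<bar> \<le> real (length h)"
  by (induction h) (auto simp: endpoint_def)

text \<open>On {-1, 1} the indicator of equality is affine in the product of the two values, so the
  next step depends on the history only through its endpoint and length: it follows the two-point
  law with mean (2p - 1) S/n.\<close>

lemma erw_step_prob_eq:
  assumes "pm_list h" "x \<in> {-1, 1}"
  shows "erw_step_prob p h x = (1 + real_of_int x * ((2 * p - 1) * endpoint h / real (length h))) / 2"
proof -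
  have "(\<Sum>j<length h. if h ! j = x then p else 1 - p)
     = (\<Sum>j<length h. 1 / 2 + (2 * p - 1) * real_of_int x / 2 * real_of_int (h ! j))"
  proof (rule sum.cong)
    fix j assume "j \<in> {..<length h}"
    then have "h ! j \<in> {-1, 1}" using assms(1) nth_mem unfolding pm_list_def by blast
    then show "(if h ! j = x then p else 1 - p) = 1 / 2 + (2 * p - 1) * real_of_int x / 2 * real_of_int (h ! j)"
      using assms(2) by (auto simp: field_simps)
  qed simp
  also have "\<dots> = real (length h) / 2 + (2 * p - 1) * real_of_int x / 2 * endpoint h"
    by (simp add: sum.distrib endpoint_def sum_list_sum_nth sum_distrib_left atLeast0LessThan)
  finally have "erw_step_prob p h x
      = (real (length h) / 2 + (2 * p - 1) * real_of_int x / 2 * endpoint h) / real (length h)"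
    by (simp add: erw_step_prob_def)
  moreover have "(n / 2 + b * y / 2 * e) / n = (1 + y * (b * e / n)) / 2" if "n > 0" for n b y e :: real
    using that by (simp add: field_simps)
  ultimately show ?thesis
    using pm_list_length[OF assms(1)] by (simp only:)
qed

lemma step_mean_abs_le:
  assumes "pm_list h" "0 \<le> p" "p \<le> 1"
  shows "\<bar>(2 * p - 1) * endpoint h / real (length h)\<bar> \<le> 1"
proof -
  have "\<bar>2 * p - 1\<bar> * \<bar>endpoint h\<bar> \<le> 1 * real (length h)"
    using assms abs_endpoint_le[of h] by (intro mult_mono) (auto simp: pm_list_def)
  then have "\<bar>(2 * p - 1) * endpoint h\<bar> \<le> real (length h)" by (simp only: abs_mult mult_1)
  then show ?thesis using pm_list_length[OF assms(1)] by (simp only: abs_divide) (auto simp: divide_le_eq_1)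
qed

lemma erw_step_prob_nonneg:
  assumes "pm_list h" "x \<in> {-1, 1}" "0 \<le> p" "p \<le> 1"
  shows "0 \<le> erw_step_prob p h x"
  using abs_le_D1[OF step_mean_abs_le[OF assms(1,3,4)]] abs_le_D2[OF step_mean_abs_le[OF assms(1,3,4)]] assms(2)
  unfolding erw_step_prob_eq[OF assms(1,2)] by auto

lemma erw_step_prob_sum: "pm_list h \<Longrightarrow> (\<Sum>x\<in>{-1, 1}. erw_step_prob p h x) = 1"
  by (simp add: erw_step_prob_eq add_divide_distrib[symmetric])

lemma erw_step_mgf:
  fixes l p :: real
  assumes "pm_list h"
  defines "t \<equiv> (2 * p - 1) * endpoint h / real (length h)"
  shows "(\<Sum>x\<in>{-1, 1}. erw_step_prob p h x * exp (l * endpoint (h @ [x])))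
     = exp (l * endpoint h) * ((1 + t) / 2 * exp l + (1 - t) / 2 * exp (- l))"
  by (simp add: erw_step_prob_eq[OF assms(1)] distrib_left exp_add exp_diff exp_minus right_diff_distrib)
     (simp add: field_simps t_def)

text \<open>Adding the mean step to the endpoint amounts to multiplying the parameter by 1 + a/n;
  iterating this produces \<open>drift_prod\<close>.\<close>

lemma drift_exponent:
  fixes l p :: real
  assumes "pm_list h"
  shows "l * endpoint h + l * ((2 * p - 1) * endpoint h / real (length h))
    = l * (1 + (2 * p - 1) / real (length h)) * endpoint h"
  by (simp add: algebra_simps)

lemma erw_step_mgf_le:
  fixes l p :: real
  assumes "pm_list h" "0 \<le> p" "p \<le> 1"
  shows "(\<Sum>x\<in>{-1, 1}. erw_step_prob p h x * exp (l * endpoint (h @ [x])))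
     \<le> exp (l * (1 + (2 * p - 1) / real (length h)) * endpoint h + l^2 / 2)"
proof -
  define t where "t = (2 * p - 1) * endpoint h / real (length h)"
  have "(\<Sum>x\<in>{-1, 1}. erw_step_prob p h x * exp (l * endpoint (h @ [x])))
     = exp (l * endpoint h) * ((1 + t) / 2 * exp l + (1 - t) / 2 * exp (- l))"
    unfolding t_def by (rule erw_step_mgf[OF assms(1)])
  also have "\<dots> \<le> exp (l * endpoint h) * exp (l * t + l^2 / 2)"
    using step_mean_abs_le[OF assms] by (intro mult_left_mono two_point_mgf_le) (auto simp: t_def)
  also have "\<dots> = exp ((l * endpoint h + l * t) + l^2 / 2)" by (simp add: exp_add mult.assoc)
  finally show ?thesis unfolding t_def drift_exponent[OF assms(1)] .
qed

lemma erw_step_mgf_ge: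
  fixes l p :: real
  assumes "pm_list h" "0 \<le> p" "p \<le> 1"
  shows "exp (l * (1 + (2 * p - 1) / real (length h)) * endpoint h)
    \<le> (\<Sum>x\<in>{-1, 1}. erw_step_prob p h x * exp (l * endpoint (h @ [x])))"
proof -
  define t where "t = (2 * p - 1) * endpoint h / real (length h)"
  have "exp (l * (1 + (2 * p - 1) / real (length h)) * endpoint h) = exp (l * endpoint h) * exp (l * t)"
    unfolding drift_exponent[OF assms(1), symmetric] t_def by (simp add: exp_add)
  also have "\<dots> \<le> exp (l * endpoint h) * ((1 + t) / 2 * exp l + (1 - t) / 2 * exp (- l))"
    using step_mean_abs_le[OF assms] by (intro mult_left_mono two_point_mgf_ge_exp) (auto simp: t_def)
  also have "\<dots> = (\<Sum>x\<in>{-1, 1}. erw_step_prob p h x * exp (l * endpoint (h @ [x])))"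
    unfolding t_def by (rule erw_step_mgf[OF assms(1), symmetric])
  finally show ?thesis .
qed

text \<open>Phrased with S/n, which dominates the mean step in absolute value because |2p - 1| \<le>
  1, and which is the quantity that the exponential tail estimate controls.\<close>

lemma erw_step_mgf_ge_quadratic:
  fixes l p :: real
  assumes "pm_list h" "0 \<le> p" "p \<le> 1"
  shows "exp (l * (1 + (2 * p - 1) / real (length h)) * endpoint h)
      * (1 + l^2/2 * (1 - (endpoint h / real (length h))^2) - \<bar>l\<bar>^3/3)
    \<le> (\<Sum>x\<in>{-1, 1}. erw_step_prob p h x * exp (l * endpoint (h @ [x])))"
proof -
  define t where "t = (2 * p - 1) * endpoint h / real (length h)"
  have "t^2 = (2 * p - 1)^2 * (endpoint h / real (length h))^2"
    by (simp add: t_def power_mult_distrib power_divide)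
  also have "\<dots> \<le> 1 * (endpoint h / real (length h))^2"
    using assms by (intro mult_right_mono) (auto simp: abs_square_le_1)
  finally have t2: "l^2/2 * (1 - (endpoint h / real (length h))^2) \<le> l^2/2 * (1 - t^2)"
    by (intro mult_left_mono) auto
  have "exp (l * (1 + (2 * p - 1) / real (length h)) * endpoint h) = exp (l * endpoint h) * exp (l * t)"
    unfolding drift_exponent[OF assms(1), symmetric] t_def by (simp add: exp_add)
  then have "exp (l * (1 + (2 * p - 1) / real (length h)) * endpoint h)
      * (1 + l^2/2 * (1 - (endpoint h / real (length h))^2) - \<bar>l\<bar>^3/3)
     \<le> exp (l * endpoint h) * exp (l * t) * (1 + l^2/2 * (1 - t^2) - \<bar>l\<bar>^3/3)"
    using t2 by (auto intro!: mult_left_mono)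
  also have "\<dots> \<le> exp (l * endpoint h) * ((1 + t) / 2 * exp l + (1 - t) / 2 * exp (- l))"
    unfolding mult.assoc
    using step_mean_abs_le[OF assms] by (intro mult_left_mono two_point_mgf_ge) (auto simp: t_def)
  also have "\<dots> = (\<Sum>x\<in>{-1, 1}. erw_step_prob p h x * exp (l * endpoint (h @ [x])))"
    unfolding t_def by (rule erw_step_mgf[OF assms(1), symmetric])
  finally show ?thesis .
qed

text \<open>Expectation of \<open>F\<close> over the next \<open>r\<close> steps, given the history \<open>h\<close>; \<open>F\<close> receives the
  whole path, not only the new steps.\<close>

primrec path_exp :: "real \<Rightarrow> nat \<Rightarrow> int list \<Rightarrow> (int list \<Rightarrow> real) \<Rightarrow> real" where
  "path_exp p 0 h F = F h"
| "path_exp p (Suc r) h F = (\<Sum>x\<in>{-1, 1}. erw_step_prob p h x * path_exp p r (h @ [x]) F)"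

lemma path_exp_mono:
  assumes "0 \<le> p" "p \<le> 1" "pm_list h"
    and "\<And>g. pm_list g \<Longrightarrow> length g = length h + r \<Longrightarrow> F g \<le> G g"
  shows "path_exp p r h F \<le> path_exp p r h G"
  using assms(3,4)
proof (induction r arbitrary: h)
  case (Suc r)
  have "path_exp p r (h @ [x]) F \<le> path_exp p r (h @ [x]) G" if "x \<in> {-1, 1}" for x
    using Suc.prems that by (intro Suc.IH pm_list_snoc) auto
  then show ?case unfolding path_exp.simps
    by (intro sum_mono mult_left_mono erw_step_prob_nonneg Suc.prems assms(1,2)) auto
qed simp

lemma path_exp_linear:
  "path_exp p r h (\<lambda>g. b * F g + c * G g) = b * path_exp p r h F + c * path_exp p r h G"
  by (induction r arbitrary: h) (simp_all add: algebra_simps)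

lemma path_exp_cmult: "path_exp p r h (\<lambda>g. c * F g) = c * path_exp p r h F"
  using path_exp_linear[of p r h c F 0 F] by simp

text \<open>The defining recursion removes the first step; this one removes the last, as needed when
  the history is fixed and the horizon grows.\<close>

lemma path_exp_Suc_right:
  "path_exp p (Suc r) h F = path_exp p r h (\<lambda>g. \<Sum>x\<in>{-1, 1}. erw_step_prob p g x * F (g @ [x]))"
proof (induction r arbitrary: h)
  case (Suc r)
  show ?case unfolding path_exp.simps(2)[of p "Suc r" h F] Suc.IH by (rule path_exp.simps(2)[symmetric])
qed simp

lemma path_exp_const: "pm_list h \<Longrightarrow> path_exp p r h (\<lambda>_. c) = c"
proof (induction r arbitrary: h)
  case (Suc r)
  have "path_exp p r (h @ [x]) (\<lambda>_. c) = c" if "x \<in> {-1, 1}" for x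
    using Suc.prems that by (intro Suc.IH pm_list_snoc)
  then show ?case
    using erw_step_prob_sum[OF Suc.prems, of p] by (simp flip: distrib_right)
qed simp

section \<open>Exponential supermartingales and two-sided Gaussian bounds\<close>

definition gauss_weight :: "real \<Rightarrow> real \<Rightarrow> nat \<Rightarrow> int list \<Rightarrow> real" where
  "gauss_weight p l N h = exp (l * drift_prod (2 * p - 1) (length h) N * endpoint h
     + l^2 / 2 * var_sum (2 * p - 1) (length h) N)"

text \<open>The weight is the Gaussian bound for the conditional expectation of exp (l S) at time
  \<open>N\<close>. Each step uses up one factor of \<open>drift_prod\<close> and one summand of
  \<open>var_sum\<close>, by the one-step bound at the parameter \<open>l * ?B\<close>; at length
  \<open>N\<close> the weight is exp (l S) itself.\<close>

lemma gauss_weight_supermartingale: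
  assumes "pm_list h" "0 \<le> p" "p \<le> 1" "length h < N"
  shows "(\<Sum>x\<in>{-1, 1}. erw_step_prob p h x * gauss_weight p l N (h @ [x])) \<le> gauss_weight p l N h"
proof -
  let ?a = "2 * p - 1" and ?n = "length h"
  let ?B = "drift_prod ?a (Suc ?n) N" and ?V = "var_sum ?a (Suc ?n) N"
  have "(\<Sum>x\<in>{-1, 1}. erw_step_prob p h x * gauss_weight p l N (h @ [x]))
    = (\<Sum>x\<in>{-1, 1}. erw_step_prob p h x * exp ((l * ?B) * endpoint (h @ [x]))) * exp (l^2 / 2 * ?V)"
    by (simp add: gauss_weight_def exp_add algebra_simps)
  also have "\<dots> \<le> exp ((l * ?B) * (1 + ?a / real ?n) * endpoint h + (l * ?B)^2 / 2) * exp (l^2 / 2 * ?V)"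
    by (intro mult_right_mono erw_step_mgf_le assms) auto
  also have "\<dots> = exp (l * ((1 + ?a / real ?n) * ?B) * endpoint h + l^2 / 2 * (?B^2 + ?V))"
    by (simp add: algebra_simps power_mult_distrib flip: exp_add)
  also have "\<dots> = gauss_weight p l N h"
    unfolding gauss_weight_def var_sum_left[OF assms(4)] drift_prod_left[OF assms(4)] ..
  finally show ?thesis .
qed

lemma path_mgf_le:
  assumes "pm_list h" "0 \<le> p" "p \<le> 1" "N = length h + r"
  shows "path_exp p r h (\<lambda>g. exp (l * endpoint g)) \<le> gauss_weight p l N h"
  using assms(1,4)
proof (induction r arbitrary: h)
  case 0
  then show ?case by (simp add: gauss_weight_def)
next
  case (Suc r)
  have "path_exp p (Suc r) h (\<lambda>g. exp (l * endpoint g))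
     \<le> (\<Sum>x\<in>{-1, 1}. erw_step_prob p h x * gauss_weight p l N (h @ [x]))"
    unfolding path_exp.simps
    by (intro sum_mono mult_left_mono erw_step_prob_nonneg Suc.IH pm_list_snoc Suc.prems assms(2,3))
       (use Suc.prems in auto)
  also have "\<dots> \<le> gauss_weight p l N h"
    by (intro gauss_weight_supermartingale assms(2,3)) (use Suc.prems in auto)
  finally show ?case .
qed

text \<open>Jensen's inequality at every step; the exponent is \<open>l\<close> times the
  conditional mean of the endpoint at time \<open>N\<close>.\<close>

lemma path_mgf_ge_mean:
  assumes "pm_list h" "0 \<le> p" "p \<le> 1" "N = length h + r"
  shows "exp (l * drift_prod (2 * p - 1) (length h) N * endpoint h) \<le> path_exp p r h (\<lambda>g. exp (l * endpoint g))"
  using assms(1,4)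
proof (induction r arbitrary: h)
  case (Suc r)
  let ?a = "2 * p - 1"
  have n: "length h < N" using Suc.prems by simp
  have "exp (l * drift_prod ?a (length h) N * endpoint h)
    = exp ((l * drift_prod ?a (Suc (length h)) N) * (1 + ?a / real (length h)) * endpoint h)"
    unfolding drift_prod_left[OF n] by (simp add: mult_ac)
  also have "\<dots> \<le> (\<Sum>x\<in>{-1, 1}. erw_step_prob p h x
       * exp (l * drift_prod ?a (Suc (length h)) N * endpoint (h @ [x])))"
    by (intro erw_step_mgf_ge Suc.prems assms)
  also have "\<dots> \<le> path_exp p (Suc r) h (\<lambda>g. exp (l * endpoint g))"
  proof -
    have "exp (l * drift_prod ?a (Suc (length h)) N * endpoint (h @ [x]))
      \<le> path_exp p r (h @ [x]) (\<lambda>g. exp (l * endpoint g))" if "x \<in> {-1, 1}" for x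
      using Suc.IH[of "h @ [x]"] pm_list_snoc[OF Suc.prems(1) that] Suc.prems by simp
    then show ?thesis unfolding path_exp.simps
      by (intro sum_mono mult_left_mono erw_step_prob_nonneg Suc.prems assms(2,3)) auto
  qed
  finally show ?case .
qed simp

text \<open>The quadratic term needs the mean step to be small. Under the exponentially tilted law this
  fails only with exponentially small probability, by the sub-Gaussian bound at \<open>\<mu> \<plusminus> \<theta>\<close>.\<close>

lemma path_mgf_step_aux:
  fixes h :: "int list" and r :: nat and p l \<epsilon> \<theta> C :: real
  defines "a \<equiv> 2 * p - 1" and "n \<equiv> length h + r"
  defines "\<mu> \<equiv> l * (1 + a / real n)"
  assumes h: "pm_list h" and p: "0 < p" "p \<le> 1"
    and \<epsilon>: "0 < \<epsilon>" and C: "0 < C" and th: "\<theta> = \<epsilon> / (8 * C)"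
    and B: "drift_prod a (length h) n * real (length h) \<le> \<epsilon> * real n / 4"
    and V: "var_sum a (length h) n \<le> C * real n"
    and mu: "\<bar>\<mu>\<bar> \<le> \<theta>"
    and n0: "2 * exp (- \<theta> * \<epsilon> * real n / 2) \<le> \<epsilon>^2"
  shows "path_exp p r h (\<lambda>g. exp (\<mu> * endpoint g)) * (1 + l^2/2 * (1 - 2 * \<epsilon>^2) - \<bar>l\<bar>^3/3)
    \<le> path_exp p (Suc r) h (\<lambda>g. exp (l * endpoint g))"
proof -
  let ?f = "\<lambda>l. path_exp p r h (\<lambda>g. exp (l * endpoint g))"
  let ?m = "length h" and ?B = "drift_prod a (length h) n" and ?V = "var_sum a (length h) n"
  have th0: "0 < \<theta>" using \<epsilon> C th by simp
  have m1: "1 \<le> ?m" using pm_list_length[OF h] .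
  have n1: "0 < real n" using m1 by (simp add: n_def)
  have B0: "0 < ?B" using p m1 by (intro drift_prod_pos) (auto simp: a_def)
  define e where "e = exp (- \<theta> * \<epsilon> * real n)"
  \<comment> \<open>Shifting \<open>\<mu>\<close> by \<open>\<theta>\<close> in either direction
    costs a factor of at most \<open>exp (\<theta> * \<epsilon> * real n / 2)\<close>: one quarter
    of \<theta> \<epsilon> n comes from the endpoint of \<open>h\<close>, one quarter from the
    variance, and \<theta> = \<epsilon> / (8 C) is chosen for the latter. The weight
    \<open>e\<close> contains the whole of \<theta> \<epsilon> n and beats both.\<close>
  have tail: "e * ?f (\<mu> + s) \<le> \<epsilon>^2 / 2 * ?f \<mu>" if s: "\<bar>s\<bar> = \<theta>" for s
  proof -
    have "?f (\<mu> + s) \<le> gauss_weight p (\<mu> + s) n h"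
      by (intro path_mgf_le h) (use p n_def in auto)
    also have "\<dots> = exp (\<mu> * ?B * endpoint h) * exp (s * ?B * endpoint h + (\<mu> + s)^2 / 2 * ?V)"
      by (simp add: gauss_weight_def a_def algebra_simps flip: exp_add)
    also have "\<dots> \<le> exp (\<mu> * ?B * endpoint h) * exp (\<theta> * \<epsilon> * real n / 4 + \<theta> * \<epsilon> * real n / 4)"
    proof -
      have "s * (?B * endpoint h) \<le> \<theta> * (?B * real ?m)"
      proof -
        have "\<bar>s * (?B * endpoint h)\<bar> \<le> \<theta> * (?B * real ?m)"
          unfolding abs_mult using s B0 th0 abs_endpoint_le[of h] h
          by (auto intro!: mult_mono simp: pm_list_def)
        then show ?thesis by linarith
      qed
      also have "\<dots> \<le> \<theta> * (\<epsilon> * real n / 4)" using B th0 by (intro mult_left_mono) auto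
      finally have 1: "s * ?B * endpoint h \<le> \<theta> * \<epsilon> * real n / 4" by (simp add: mult_ac)
      have "(\<mu> + s)^2 \<le> (2 * \<theta>)^2"
        by (rule power2_le_iff_abs_le[THEN iffD2]) (use s mu th0 in auto)
      then have 2: "(\<mu> + s)^2 / 2 * ?V \<le> (2 * \<theta>)^2 / 2 * (C * real n)"
        using V by (intro mult_mono divide_right_mono var_sum_nonneg) auto
      have 3: "(2 * \<theta>)^2 / 2 * (C * real n) = \<theta> * \<epsilon> * real n / 4"
        using C by (simp add: th power2_eq_square field_simps)
      show ?thesis using add_mono[OF 1 2[unfolded 3]] by simp
    qed
    also have "exp (\<mu> * ?B * endpoint h) \<le> ?f \<mu>"
      using path_mgf_ge_mean[OF h, of p n r \<mu>] p by (simp add: a_def n_def)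
    finally have "?f (\<mu> + s) \<le> ?f \<mu> * exp (\<theta> * \<epsilon> * real n / 2)" by (simp add: mult_ac)
    then have "e * ?f (\<mu> + s) \<le> e * (?f \<mu> * exp (\<theta> * \<epsilon> * real n / 2))"
      by (intro mult_left_mono) (auto simp: e_def)
    also have "\<dots> = exp (- \<theta> * \<epsilon> * real n / 2) * ?f \<mu>"
      by (simp add: e_def flip: exp_add)
    also have "\<dots> \<le> \<epsilon>^2 / 2 * ?f \<mu>"
    proof (rule mult_right_mono)
      have "0 < exp (\<mu> * ?B * endpoint h)" by simp
      also have "\<dots> \<le> ?f \<mu>"
        using path_mgf_ge_mean[OF h, of p n r \<mu>] p by (simp add: a_def n_def)
      finally show "0 \<le> ?f \<mu>" by simp
    qed (use n0 in simp)
    finally show ?thesis .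
  qed
  have "?f \<mu> * (1 + l^2/2 * (1 - 2 * \<epsilon>^2) - \<bar>l\<bar>^3/3)
     \<le> (1 + l^2/2 * (1 - \<epsilon>^2) - \<bar>l\<bar>^3/3) * ?f \<mu> - l^2/2 * (e * ?f (\<mu> + \<theta>) + e * ?f (\<mu> - \<theta>))"
  proof -
    have eq: "x * (1 + L * (1 - 2 * \<epsilon>^2) - c) = (1 + L * (1 - \<epsilon>^2) - c) * x - L * (\<epsilon>^2 * x)" for x L c :: real
      by (simp add: algebra_simps)
    have "l^2/2 * (e * ?f (\<mu> + \<theta>) + e * ?f (\<mu> - \<theta>)) \<le> l^2/2 * (\<epsilon>^2 * ?f \<mu>)"
      using tail[of \<theta>] tail[of "- \<theta>"] th0 by (intro mult_left_mono) auto
    then show ?thesis unfolding eq by (rule diff_left_mono)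
  qed
  also have "\<dots> = path_exp p r h (\<lambda>g. 1 * ((1 + l^2/2 * (1 - \<epsilon>^2) - \<bar>l\<bar>^3/3) * exp (\<mu> * endpoint g))
     + (- (l^2/2)) * (e * exp ((\<mu> + \<theta>) * endpoint g) + e * exp ((\<mu> - \<theta>) * endpoint g)))"
    by (simp only: path_exp_linear path_exp_cmult)
  also have "\<dots> \<le> path_exp p r h (\<lambda>g. \<Sum>x\<in>{-1, 1}. erw_step_prob p g x * exp (l * endpoint (g @ [x])))"
  proof (intro path_exp_mono)
    fix g assume g: "pm_list g" "length g = length h + r"
    then have gn: "length g = n" by (simp add: n_def)
    define S where "S = endpoint g"
    have S: "\<bar>S\<bar> \<le> real n" using abs_endpoint_le[of g] g(1) gn by (simp add: S_def pm_list_def)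
    \<comment> \<open>A pointwise Chernoff bound: for |S| \<le> \<epsilon> n the first term
      suffices; beyond that the left side is at most 1, while one of the two weighted exponentials
      is at least 1.\<close>
    have ind: "(S / real n)^2 \<le> \<epsilon>^2 + (e * exp (\<theta> * S) + e * exp (- \<theta> * S))"
    proof (cases "\<bar>S\<bar> \<le> \<epsilon> * real n")
      case True
      then have "\<bar>S / real n\<bar> \<le> \<epsilon>" using n1 by (simp add: field_simps)
      then have "(S / real n)^2 \<le> \<epsilon>^2" using \<epsilon> by (intro power2_le_iff_abs_le[THEN iffD2]) auto
      moreover have "0 \<le> e" by (simp add: e_def)
      ultimately show ?thesis by (smt (verit) exp_gt_zero mult_nonneg_nonneg)
    next
      case False
      have "(S / real n)^2 \<le> 1" using S n1 by (simp add: abs_square_le_1)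
      also have "1 \<le> exp (\<theta> * \<bar>S\<bar> - \<theta> * \<epsilon> * real n)" 
        using False th0 mult_left_mono[of "\<epsilon> * real n" "\<bar>S\<bar>" \<theta>] by (simp add: mult.assoc)
      also have "\<dots> = e * exp (\<theta> * \<bar>S\<bar>)" by (simp add: e_def flip: exp_add)
      also have "\<dots> \<le> e * exp (\<theta> * S) + e * exp (- \<theta> * S)"
        by (cases "S \<ge> 0") (auto simp: e_def)
      also have "\<dots> \<le> \<epsilon>^2 + \<dots>" by simp
      finally show ?thesis .
    qed
    have "1 * ((1 + l^2/2 * (1 - \<epsilon>^2) - \<bar>l\<bar>^3/3) * exp (\<mu> * endpoint g))
       + (- (l^2/2)) * (e * exp ((\<mu> + \<theta>) * endpoint g) + e * exp ((\<mu> - \<theta>) * endpoint g))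
      = exp (\<mu> * S) * (1 + l^2/2 * (1 - (\<epsilon>^2 + (e * exp (\<theta> * S) + e * exp (- \<theta> * S)))) - \<bar>l\<bar>^3/3)"
      by (simp add: S_def[symmetric] distrib_right left_diff_distrib exp_add exp_diff exp_minus)
         (simp add: field_simps)
    also have "\<dots> \<le> exp (\<mu> * S) * (1 + l^2/2 * (1 - (S / real n)^2) - \<bar>l\<bar>^3/3)"
      using ind by (intro mult_left_mono add_left_mono diff_right_mono) auto
    also have "\<dots> \<le> (\<Sum>x\<in>{-1, 1}. erw_step_prob p g x * exp (l * endpoint (g @ [x])))"
      using erw_step_mgf_ge_quadratic[OF g(1), of p l] p by (simp add: gn \<mu>_def a_def S_def)
    finally show "1 * ((1 + l^2/2 * (1 - \<epsilon>^2) - \<bar>l\<bar>^3/3) * exp (\<mu> * endpoint g))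
       + (- (l^2/2)) * (e * exp ((\<mu> + \<theta>) * endpoint g) + e * exp ((\<mu> - \<theta>) * endpoint g))
      \<le> (\<Sum>x\<in>{-1, 1}. erw_step_prob p g x * exp (l * endpoint (g @ [x])))" .
  qed (use p h in auto)
  also have "\<dots> = path_exp p (Suc r) h (\<lambda>g. exp (l * endpoint g))"
    by (simp only: path_exp_Suc_right)
  finally show ?thesis .
qed

lemma var_sum_le_linear:
  assumes "-1 < a" "a < 1/2"
  obtains C where "0 < C" "\<And>m n. 1 \<le> m \<Longrightarrow> m \<le> n \<Longrightarrow> var_sum a m n \<le> C * real n"
proof -
  obtain C \<alpha> where C: "0 \<le> C" "0 < \<alpha>" "\<alpha> < 1"
    "\<And>n. 1 \<le> n \<Longrightarrow> var_sum a 1 n \<le> real n / (1 - 2 * a) + C * real n powr \<alpha>"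
    using var_sum_le[OF assms] by blast
  have "var_sum a m n \<le> (1 / (1 - 2 * a) + C) * real n" if mn: "1 \<le> m" "m \<le> n" for m n
  proof -
    have "var_sum a m n \<le> var_sum a 1 n" using mn by (intro var_sum_antimono)
    also have "\<dots> \<le> real n / (1 - 2 * a) + C * real n powr \<alpha>" using mn by (intro C(4)) auto
    also have "\<dots> \<le> real n / (1 - 2 * a) + C * real n powr 1"
      using mn C by (intro add_left_mono mult_left_mono powr_mono) auto
    finally show ?thesis using mn by (simp add: algebra_simps)
  qed
  moreover have "0 < 1 / (1 - 2 * a) + C" using assms C by (intro add_pos_nonneg) auto
  ultimately show thesis using that by blast
qed

text \<open>A budget in units of w = \<eta> l^2: lowering the exponent to (1 - \<eta>) l^2/2 gains
  w/2, which pays w/16 for the square term of \<open>exp\<close>, w/8 for the factor 1 - \<eta>/4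
  and w/12 for the cubic error.\<close>

lemma one_plus_ge_exp:
  fixes y l \<eta> :: real
  assumes "0 < \<eta>" "\<eta> < 1" "\<bar>l\<bar> \<le> \<eta> / 4"
  shows "exp ((1 - \<eta>) * l^2 / 2) \<le> 1 + l^2/2 * (1 - \<eta> / 4) - \<bar>l\<bar>^3/3"
proof -
  define y where "y = (1 - \<eta>) * l^2 / 2"
  have l2: "l^2 \<le> \<bar>l\<bar>" "l^2 \<le> \<eta> / 4"
  proof -
    have "\<bar>l\<bar> * \<bar>l\<bar> \<le> \<bar>l\<bar> * 1" using assms by (intro mult_left_mono) auto
    then show "l^2 \<le> \<bar>l\<bar>" by (simp add: power2_eq_square)
    then show "l^2 \<le> \<eta> / 4" using assms by simp
  qed
  have y: "0 \<le> y" "y \<le> l^2 / 2" "y \<le> 1"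
  proof -
    show "0 \<le> y" using assms by (simp add: y_def)
    have "(1 - \<eta>) * l^2 \<le> 1 * l^2" using assms by (intro mult_right_mono) auto
    then show "y \<le> l^2 / 2" by (simp add: y_def)
    then show "y \<le> 1" using l2 assms by simp
  qed
  have "exp y \<le> 1 + y + y^2" by (rule exp_bound) (use y in auto)
  also have "y^2 \<le> (l^2/2) * (\<eta> / 8)"
    unfolding power2_eq_square[of y] using y l2 by (intro mult_mono) auto
  also have "1 + y + (l^2/2) * (\<eta> / 8) \<le> 1 + l^2/2 * (1 - \<eta> / 4) - l^2 * (\<eta> / 4) / 3"
  proof -
    define w where "w = l^2 * \<eta>"
    have "0 \<le> w" using assms by (simp add: w_def)
    moreover have "y = l^2 / 2 - w / 2" "(l^2/2) * (\<eta> / 8) = w / 16"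
      "l^2/2 * (1 - \<eta> / 4) = l^2 / 2 - w / 8" "l^2 * (\<eta> / 4) / 3 = w / 12"
      by (simp_all add: y_def w_def field_simps)
    ultimately show ?thesis by linarith
  qed
  also have "\<dots> \<le> 1 + l^2/2 * (1 - \<eta> / 4) - \<bar>l\<bar>^3/3"
  proof -
    have "\<bar>l\<bar>^3 = l^2 * \<bar>l\<bar>" by (simp add: power3_eq_cube power2_eq_square flip: abs_mult)
    also have "\<dots> \<le> l^2 * (\<eta> / 4)" using assms by (intro mult_left_mono) auto
    finally show ?thesis by simp
  qed
  finally show ?thesis by (simp add: y_def)
qed

text \<open>As a < 1/2, the left side is at most exp 1 * sqrt (m n), which is at most \<epsilon> n
  once n/m reaches (exp 1 / \<epsilon>)^2, uniformly in \<open>m\<close>. It bounds the mean at time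
  \<open>n\<close> that any history of length \<open>m\<close> can leave behind.\<close>

lemma drift_prod_mult_start_le:
  assumes a: "-1 < a" "a < 1/2" and e: "0 < \<epsilon>"
  obtains K :: nat where "1 \<le> K"
    "\<And>m n. 1 \<le> m \<Longrightarrow> K * m \<le> n \<Longrightarrow> drift_prod a m n * real m \<le> \<epsilon> * real n"
proof -
  define K where "K = nat \<lceil>(exp 1 / \<epsilon>)^2\<rceil> + 1"
  have K: "(exp 1 / \<epsilon>)^2 \<le> real K" "1 \<le> K" by (auto simp: K_def) linarith
  have Ks: "exp 1 / \<epsilon> \<le> sqrt (real K)" by (rule real_le_rsqrt) (rule K)
  have "drift_prod a m n * real m \<le> \<epsilon> * real n" if m: "1 \<le> m" "K * m \<le> n" for m n
  proof -
    have "m \<le> K * m" using K by simp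
    then have mn: "m \<le> n" using m(2) by linarith
    have pos: "0 < real m" "0 < real n" using m(1) mn by auto
    have Kmn: "real K * real m \<le> real n" using m(2) by (metis of_nat_le_iff of_nat_mult)
    have "drift_prod a m n * real m \<le> exp 1 * (real n / real m) powr a * real m"
      by (intro mult_right_mono drift_prod_le_powr) (use a m mn in auto)
    also have "\<dots> \<le> exp 1 * (real n / real m) powr (1/2) * real m"
      by (intro mult_right_mono mult_left_mono powr_mono) (use a pos mn in \<open>auto simp: field_simps\<close>)
    also have "\<dots> = exp 1 * (sqrt (real n) * sqrt (real m))"
    proof -
      have "sqrt (real n / real m) * real m = sqrt (real n) * (real m / sqrt (real m))"
        by (simp add: real_sqrt_divide)
      then show ?thesis using pos by (simp add: powr_half_sqrt real_div_sqrt mult.assoc)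
    qed
    also have "\<dots> \<le> \<epsilon> * sqrt (real K) * (sqrt (real n) * sqrt (real m))"
      by (intro mult_right_mono) (use Ks e in \<open>auto simp: field_simps\<close>)
    also have "\<dots> = \<epsilon> * (sqrt (real n) * sqrt (real K * real m))" by (simp add: real_sqrt_mult)
    also have "\<dots> \<le> \<epsilon> * (sqrt (real n) * sqrt (real n))"
      using Kmn e by (intro mult_left_mono real_sqrt_le_mono) auto
    finally show ?thesis by simp
  qed
  then show thesis using that K(2) by blast
qed

lemma path_mgf_step:
  fixes p \<eta> :: real
  assumes p: "0 < p" "p < 3/4" and \<eta>: "0 < \<eta>" "\<eta> < 1"
  obtains K n0 :: nat and l0 :: real where "1 \<le> K" "0 < l0"
    "\<And>h r l. pm_list h \<Longrightarrow> K * length h \<le> length h + r \<Longrightarrow> n0 \<le> length h + r \<Longrightarrow> \<bar>l\<bar> \<le> l0 \<Longrightarrow>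
       exp ((1 - \<eta>) * l^2 / 2)
         * path_exp p r h (\<lambda>g. exp (l * (1 + (2 * p - 1) / real (length h + r)) * endpoint g))
       \<le> path_exp p (Suc r) h (\<lambda>g. exp (l * endpoint g))"
proof -
  define a where "a = 2 * p - 1"
  have a: "-1 < a" "a < 1/2" using p by (auto simp: a_def)
  \<comment> \<open>Chosen so that 1 - 2 \<epsilon>^2 = 1 - \<eta>/4, the form required by
    \<open>one_plus_ge_exp\<close>.\<close>
  define \<epsilon> where "\<epsilon> = sqrt (\<eta> / 8)"
  have e: "0 < \<epsilon>" "\<epsilon>^2 = \<eta> / 8" using \<eta> by (auto simp: \<epsilon>_def)
  obtain C where C: "0 < C" "\<And>m n. 1 \<le> m \<Longrightarrow> m \<le> n \<Longrightarrow> var_sum a m n \<le> C * real n"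
    using var_sum_le_linear[OF a] by blast
  obtain K where K: "1 \<le> K"
    "\<And>m n. 1 \<le> m \<Longrightarrow> K * m \<le> n \<Longrightarrow> drift_prod a m n * real m \<le> (\<epsilon> / 4) * real n"
    using drift_prod_mult_start_le[OF a, of "\<epsilon>/4"] e by auto
  define \<theta> where "\<theta> = \<epsilon> / (8 * C)"
  have th: "0 < \<theta>" using e C by (simp add: \<theta>_def)
  have "((\<lambda>n. 2 * exp (- \<theta> * \<epsilon> * real n / 2)) \<longlongrightarrow> 0) sequentially"
    using th e by real_asymp
  then have "eventually (\<lambda>n. 2 * exp (- \<theta> * \<epsilon> * real n / 2) < \<epsilon>^2) sequentially"
    by (rule order_tendstoD) (use e in simp)
  then obtain n0 where n0: "\<And>n. n \<ge> n0 \<Longrightarrow> 2 * exp (- \<theta> * \<epsilon> * real n / 2) < \<epsilon>^2"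
    by (auto simp: eventually_at_top_linorder)
  \<comment> \<open>The half compensates the factor 1 + a/n \<le> 2 by which removing the last step
    enlarges the parameter.\<close>
  define l0 where "l0 = min (\<theta> / 2) (\<eta> / 4)"
  have main: "exp ((1 - \<eta>) * l^2 / 2)
         * path_exp p r h (\<lambda>g. exp (l * (1 + a / real (length h + r)) * endpoint g))
       \<le> path_exp p (Suc r) h (\<lambda>g. exp (l * endpoint g))"
    if h: "pm_list h" "K * length h \<le> length h + r" "n0 \<le> length h + r" and l: "\<bar>l\<bar> \<le> l0" for h r l
  proof -
    let ?n = "length h + r"
    let ?mu = "l * (1 + a / real ?n)"
    let ?f = "path_exp p r h (\<lambda>g. exp (?mu * endpoint g))"
    have m: "1 \<le> length h" using pm_list_length[OF h(1)] .
    have "\<bar>?mu\<bar> \<le> l0 * 2" unfolding abs_mult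
    proof (rule mult_mono)
      have "\<bar>a / real ?n\<bar> \<le> 1" using a m by (simp add: field_simps)
      then show "\<bar>1 + a / real ?n\<bar> \<le> 2" by linarith
    qed (use l in auto)
    then have mu: "\<bar>?mu\<bar> \<le> \<theta>" by (simp add: l0_def)
    have "0 < exp (?mu * drift_prod a (length h) ?n * endpoint h)" by simp
    also have "\<dots> \<le> ?f"
      using path_mgf_ge_mean[OF h(1), of p ?n r ?mu] p by (simp add: a_def)
    finally have f: "0 \<le> ?f" by simp
    have "exp ((1 - \<eta>) * l^2 / 2) * ?f \<le> (1 + l^2/2 * (1 - 2 * \<epsilon>^2) - \<bar>l\<bar>^3/3) * ?f"
      using one_plus_ge_exp[OF \<eta>, of l] l f by (intro mult_right_mono) (auto simp: e(2) l0_def)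
    also have "\<dots> = ?f * (1 + l^2/2 * (1 - 2 * \<epsilon>^2) - \<bar>l\<bar>^3/3)" by simp
    also have "\<dots> \<le> path_exp p (Suc r) h (\<lambda>g. exp (l * endpoint g))"
      unfolding a_def
    proof (rule path_mgf_step_aux[where C = C and \<theta> = \<theta>])
      show "drift_prod (2 * p - 1) (length h) (length h + r) * real (length h) \<le> \<epsilon> * real (length h + r) / 4"
        using K(2)[OF m h(2)] by (simp add: a_def)
      show "var_sum (2 * p - 1) (length h) (length h + r) \<le> C * real (length h + r)"
        using C(2)[OF m, of "length h + r"] by (simp add: a_def)
      show "\<bar>l * (1 + (2 * p - 1) / real (length h + r))\<bar> \<le> \<theta>" using mu by (simp add: a_def)
      show "2 * exp (- \<theta> * \<epsilon> * real (length h + r) / 2) \<le> \<epsilon>\<^sup>2" using n0[OF h(3)] by simp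
    qed (use h p e C \<theta>_def in auto)
    finally show ?thesis .
  qed
  have "0 < l0" using th \<eta> by (simp add: l0_def)
  then show thesis by (rule that[OF K(1) _ main[unfolded a_def]])
qed

text \<open>Induction on the horizon with the history fixed. Removing the last step turns
  \<open>l\<close> into l (1 + a/N), so the smallness condition has to cover
  \<open>drift_prod\<close> from every k between n and N. Up to time \<open>n\<close> only the mean
  is kept, which is why the variance sum starts at \<open>n\<close> and not at the length of
  \<open>h\<close>.\<close>

lemma path_mgf_ge:
  fixes p \<eta> :: real
  assumes p: "0 < p" "p < 3/4" and \<eta>: "0 < \<eta>" "\<eta> < 1"
  obtains K n0 :: nat and l0 :: real where "1 \<le> K" "0 < l0"
    "\<And>h n N l. pm_list h \<Longrightarrow> K * length h \<le> n \<Longrightarrow> n0 \<le> n \<Longrightarrow> n \<le> N \<Longrightarrow>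
       (\<And>k. n \<le> k \<Longrightarrow> k \<le> N \<Longrightarrow> \<bar>l\<bar> * drift_prod (2 * p - 1) k N \<le> l0) \<Longrightarrow>
       exp (l * drift_prod (2 * p - 1) (length h) N * endpoint h + (1 - \<eta>) * l^2 / 2 * var_sum (2 * p - 1) n N)
       \<le> path_exp p (N - length h) h (\<lambda>g. exp (l * endpoint g))"
proof -
  define a where "a = 2 * p - 1"
  obtain K n0 :: nat and l0 :: real where K: "1 \<le> K" "0 < l0"
    and mstep: "\<And>h r l. pm_list h \<Longrightarrow> K * length h \<le> length h + r \<Longrightarrow> n0 \<le> length h + r \<Longrightarrow> \<bar>l\<bar> \<le> l0 \<Longrightarrow>
       exp ((1 - \<eta>) * l^2 / 2)
         * path_exp p r h (\<lambda>g. exp (l * (1 + (2 * p - 1) / real (length h + r)) * endpoint g))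
       \<le> path_exp p (Suc r) h (\<lambda>g. exp (l * endpoint g))"
  proof (rule path_mgf_step[OF assms])
  qed (rule that)
  have main: "exp (l * drift_prod a (length h) N * endpoint h + (1 - \<eta>) * l^2 / 2 * var_sum a n N)
       \<le> path_exp p (N - length h) h (\<lambda>g. exp (l * endpoint g))"
    if h: "pm_list h" "K * length h \<le> n" "n0 \<le> n" "n \<le> N"
      and l: "\<And>k. n \<le> k \<Longrightarrow> k \<le> N \<Longrightarrow> \<bar>l\<bar> * drift_prod a k N \<le> l0" for h n N l
    using h(4) l
  proof (induction N arbitrary: l rule: dec_induct)
    case base
    have "length h \<le> K * length h" using K by simp
    then have "length h \<le> n" using h(2) by linarith
    then show ?case using path_mgf_ge_mean[OF h(1), of p n "n - length h" l] p by (simp add: a_def)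
  next
    case (step N)
    have "length h \<le> K * length h" using K by simp
    then have hN: "length h \<le> N" using h(2) step.hyps by linarith
    define r where "r = N - length h"
    have N: "N = length h + r" using hN by (simp add: r_def)
    have N1: "1 \<le> N" using pm_list_length[OF h(1)] hN by simp
    let ?b = "1 + a / real N"
    have b: "0 < ?b" using drift_factor_pos[of a N] N1 p by (simp add: a_def)
    have l0: "\<bar>l\<bar> \<le> l0" using step.prems[of "Suc N"] step.hyps by simp
    have IH: "exp ((l * ?b) * drift_prod a (length h) N * endpoint h + (1 - \<eta>) * (l * ?b)^2 / 2 * var_sum a n N)
       \<le> path_exp p (N - length h) h (\<lambda>g. exp ((l * ?b) * endpoint g))"
    proof (rule step.IH)
      fix k assume k: "n \<le> k" "k \<le> N"
      show "\<bar>l * ?b\<bar> * drift_prod a k N \<le> l0"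
        using step.prems[of k] k b by (simp add: drift_prod_Suc abs_mult mult_ac)
    qed
    have "exp (l * drift_prod a (length h) (Suc N) * endpoint h + (1 - \<eta>) * l^2 / 2 * var_sum a n (Suc N))
      = exp ((1 - \<eta>) * l^2 / 2) *
        exp ((l * ?b) * drift_prod a (length h) N * endpoint h + (1 - \<eta>) * (l * ?b)^2 / 2 * var_sum a n N)"
    proof -
      have "l * (B * b) * S + (1 - \<eta>) * l^2 / 2 * (1 + b^2 * V)
          = (1 - \<eta>) * l^2 / 2 + ((l * b) * B * S + (1 - \<eta>) * (l * b)^2 / 2 * V)" for B b V S
        by (simp add: field_simps power2_eq_square)
      then show ?thesis
        unfolding drift_prod_Suc[OF hN] var_sum_Suc[OF step.hyps(1)] exp_add[symmetric] by (simp only:)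
    qed
    also have "\<dots> \<le> exp ((1 - \<eta>) * l^2 / 2) * path_exp p r h (\<lambda>g. exp ((l * ?b) * endpoint g))"
      using IH by (intro mult_left_mono) (auto simp: r_def)
    also have "\<dots> \<le> path_exp p (Suc r) h (\<lambda>g. exp (l * endpoint g))"
      unfolding N a_def by (rule mstep) (use h step.hyps l0 N in auto)
    finally show ?case using hN by (simp add: r_def Suc_diff_le)
  qed
  show thesis by (rule that[OF K main[unfolded a_def]])
qed

text \<open>Tilting by \<open>exp (\<lambda> D)\<close> concentrates the law near \<open>\<lambda> Q\<close>: the mass that the tilted law puts
  outside \<open>(1 \<plusminus> \<delta>) \<lambda> Q\<close> is controlled by the moment generating function at \<open>(1 \<plusminus> \<delta>) \<lambda>\<close>.\<close>

lemma tilted_tail_bound: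
  fixes E :: "('b \<Rightarrow> real) \<Rightarrow> real" and D :: "'b \<Rightarrow> real"
  assumes lin: "\<And>F G b c. E (\<lambda>x. b * F x + c * G x) = b * E F + c * E G"
    and mono: "\<And>F G. (\<And>x. F x \<le> G x) \<Longrightarrow> E F \<le> E G"
    and up: "\<And>l. E (\<lambda>x. exp (l * D x)) \<le> exp (l^2 / 2 * Q)"
    and low: "exp ((1 - \<eta>) * l^2 / 2 * Q) \<le> E (\<lambda>x. exp (l * D x))"
    and d: "0 < \<delta>" "\<delta> < 1" and l: "0 < l"
    and big: "4 * exp (- (\<delta>^2 - \<eta>) * l^2 / 2 * Q) \<le> 1"
  shows "exp (- (1 / 2 + \<delta> + \<eta> / 2) * l^2 * Q) / 2 \<le> E (\<lambda>x. of_bool ((1 - \<delta>) * l * Q \<le> D x))"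
proof -
  let ?P = "\<lambda>x. of_bool ((1 - \<delta>) * l * Q \<le> D x) :: real"
  let ?s = "exp (\<delta> * (1 - \<delta>) * l^2 * Q)" and ?t = "exp (- \<delta> * (1 + \<delta>) * l^2 * Q)"
  let ?u = "exp ((1 + \<delta>) * l^2 * Q)"
  \<comment> \<open>Below the window \<open>exp (l * D x)\<close> is dominated by the weaker tilt,
    above it by the stronger one, inside by its maximum \<open>?u\<close>. The factors
    \<open>?s\<close> and \<open>?t\<close> make the competing exponentials agree at the edges of
    the window.\<close>
  have pt: "1 * exp (l * D x) + (-1) * (?s * exp ((1 - \<delta>) * l * D x) + ?t * exp ((1 + \<delta>) * l * D x)) \<le> ?u * ?P x" for x
  proof -
    have s: "?s * exp ((1 - \<delta>) * l * D x) = exp (l * D x + \<delta> * l * ((1 - \<delta>) * l * Q - D x))"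
      by (simp add: algebra_simps power2_eq_square flip: exp_add)
    have t: "?t * exp ((1 + \<delta>) * l * D x) = exp (l * D x + \<delta> * l * (D x - (1 + \<delta>) * l * Q))"
      by (simp add: algebra_simps power2_eq_square flip: exp_add)
    have st: "0 \<le> ?s * exp ((1 - \<delta>) * l * D x)" "0 \<le> ?t * exp ((1 + \<delta>) * l * D x)" by auto
    have arith: "1 * e + (-1) * (x + y) \<le> z" if "0 \<le> x" "0 \<le> y" "0 \<le> z" "e \<le> x \<or> e \<le> y \<or> e \<le> z"
      for e x y z :: real
    proof -
      have "1 * e + (-1) * (x + y) = e - (x + y)" by simp
      then show ?thesis using that by linarith
    qed
    have u: "0 \<le> ?u * ?P x" by simp
    consider "D x < (1 - \<delta>) * l * Q" | "(1 + \<delta>) * l * Q < D x"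
      | "(1 - \<delta>) * l * Q \<le> D x" "D x \<le> (1 + \<delta>) * l * Q" by linarith
    then show ?thesis
    proof cases
      case 1
      have "exp (l * D x) \<le> ?s * exp ((1 - \<delta>) * l * D x)"
        unfolding s using 1 d l by simp
      then show ?thesis by (intro arith st u) simp
    next
      case 2
      have "exp (l * D x) \<le> ?t * exp ((1 + \<delta>) * l * D x)"
        unfolding t using 2 d l by simp
      then show ?thesis by (intro arith st u) simp
    next
      case 3
      have "l * D x \<le> (1 + \<delta>) * l^2 * Q"
        using mult_left_mono[OF 3(2), of l] l by (simp add: algebra_simps power2_eq_square)
      then have "exp (l * D x) \<le> ?u * ?P x" using 3(1) by simp
      then show ?thesis by (intro arith st u) simp
    qed
  qed
  have "1 * E (\<lambda>x. exp (l * D x)) + (-1) * (?s * E (\<lambda>x. exp ((1 - \<delta>) * l * D x)) + ?t * E (\<lambda>x. exp ((1 + \<delta>) * l * D x)))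
     \<le> E (\<lambda>x. ?u * ?P x)"
    unfolding lin[symmetric] by (rule mono) (rule pt)
  also have "E (\<lambda>x. ?u * ?P x) = ?u * E ?P" using lin[of ?u ?P 0 ?P] by simp
  finally have 1: "E (\<lambda>x. exp (l * D x)) - (?s * E (\<lambda>x. exp ((1 - \<delta>) * l * D x)) + ?t * E (\<lambda>x. exp ((1 + \<delta>) * l * D x)))
     \<le> ?u * E ?P" by simp
  define v where "v = exp ((1 - \<eta>) * l^2 / 2 * Q)"
  \<comment> \<open>Both side terms have the bound \<open>z\<close>, because \<delta>(1 - \<delta>)
    + (1 - \<delta>)^2/2 and -\<delta>(1 + \<delta>) + (1 + \<delta>)^2/2 both equal (1 -
    \<delta>^2)/2. By \<open>big\<close>, 4z is at most \<open>v\<close>, so together they consume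
    at most half of \<open>v\<close>.\<close>
  define z where "z = exp ((1 - \<delta>^2) * l^2 / 2 * Q)"
  have z: "z = exp (- (\<delta>^2 - \<eta>) * l^2 / 2 * Q) * v"
    unfolding z_def v_def by (simp add: algebra_simps add_divide_distrib diff_divide_distrib flip: exp_add)
  have "?s * E (\<lambda>x. exp ((1 - \<delta>) * l * D x)) \<le> ?s * exp (((1 - \<delta>) * l)^2 / 2 * Q)"
    by (intro mult_left_mono up) auto
  also have "\<dots> = z" unfolding z_def
    by (simp flip: exp_add) (simp add: field_simps power2_eq_square)
  finally have 2: "?s * E (\<lambda>x. exp ((1 - \<delta>) * l * D x)) \<le> z" .
  have "?t * E (\<lambda>x. exp ((1 + \<delta>) * l * D x)) \<le> ?t * exp (((1 + \<delta>) * l)^2 / 2 * Q)"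
    by (intro mult_left_mono up) auto
  also have "\<dots> = z" unfolding z_def
    by (simp flip: exp_add) (simp add: field_simps power2_eq_square)
  finally have 3: "?t * E (\<lambda>x. exp ((1 + \<delta>) * l * D x)) \<le> z" .
  have "4 * z \<le> 1 * v" unfolding z mult.assoc[symmetric] by (intro mult_right_mono big) (simp add: v_def)
  then have "v / 2 \<le> ?u * E ?P" using 1 2 3 low unfolding v_def[symmetric] by linarith
  then have "exp (- ((1 + \<delta>) * l^2 * Q)) * (v / 2) \<le> exp (- ((1 + \<delta>) * l^2 * Q)) * (?u * E ?P)"
    by (intro mult_left_mono) auto
  also have "\<dots> = E ?P" by (simp add: exp_minus)
  also have "exp (- ((1 + \<delta>) * l^2 * Q)) * (v / 2) = exp (- (1 / 2 + \<delta> + \<eta> / 2) * l^2 * Q) / 2"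
    unfolding v_def by (simp flip: exp_add) (simp add: field_simps)
  finally show ?thesis .
qed

subsection \<open>Path probabilities and the maximal inequality\<close>

definition hist :: "(nat \<Rightarrow> 'a \<Rightarrow> int) \<Rightarrow> nat \<Rightarrow> 'a \<Rightarrow> int list" where
  "hist X n \<omega> = map (\<lambda>i. X i \<omega>) [0..<n]"

lemma length_hist [simp]: "length (hist X n \<omega>) = n"
  by (simp add: hist_def)

lemma hist_Suc: "hist X (Suc n) \<omega> = hist X n \<omega> @ [X n \<omega>]"
  by (simp add: hist_def)

lemma take_hist: "m \<le> n \<Longrightarrow> take m (hist X n \<omega>) = hist X m \<omega>"
  by (simp add: hist_def take_map)

lemma hist_eq_iff: "hist X n \<omega> = h \<longleftrightarrow> length h = n \<and> (\<forall>i<length h. X i \<omega> = h ! i)"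
  by (auto simp: hist_def list_eq_iff_nth_eq)

lemma endpoint_hist: "endpoint (hist X n \<omega>) = real_of_int (walk X n \<omega>)"
  by (simp add: endpoint_def hist_def walk_def interv_sum_list_conv_sum_set_nat atLeast0LessThan)

lemma erw_path_prob_snoc:
  assumes "h \<noteq> []"
  shows "erw_path_prob p q (h @ [x]) = erw_path_prob p q h * erw_step_prob p h x"
proof -
  have "(\<Prod>k\<in>{1..<length h}. erw_step_prob p (take k (h @ [x])) ((h @ [x]) ! k))
     = (\<Prod>k\<in>{1..<length h}. erw_step_prob p (take k h) (h ! k))"
    by (intro prod.cong) (auto simp: nth_append)
  moreover have "{1..<length (h @ [x])} = insert (length h) {1..<length h}" using assms by (cases h) auto
  ultimately show ?thesis using assms by (simp add: erw_path_prob_def)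
qed

lemma (in prob_space) AE_eq_one_of:
  assumes "A \<in> events" "B \<in> events" "C \<in> events" "A \<inter> B = {}" "A \<subseteq> C" "B \<subseteq> C"
    and "prob C = prob A + prob B"
  shows "AE \<omega> in M. \<omega> \<in> C \<longrightarrow> \<omega> \<in> A \<or> \<omega> \<in> B"
proof -
  have "prob (A \<union> B) = prob A + prob B" using assms by (intro finite_measure_Union) auto
  then have "prob (C - (A \<union> B)) = 0" using assms by (subst finite_measure_Diff) auto
  then have "C - (A \<union> B) \<in> null_sets M" using assms by (auto simp: null_sets_def emeasure_eq_measure)
  then have "AE \<omega> in M. \<omega> \<notin> C - (A \<union> B)" by (rule AE_not_in)
  then show ?thesis by eventually_elim auto
qed

lemma measurable_hist [measurable]:
  assumes "\<And>i. X i \<in> measurable M (count_space UNIV)"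
  shows "hist X n \<in> measurable M (count_space UNIV)"
proof (subst measurable_count_space_eq2_countable, safe)
  fix h :: "int list"
  have [measurable]: "\<And>i. X i \<in> measurable M (count_space UNIV)" by fact
  have "hist X n -` {h} \<inter> space M = {\<omega> \<in> space M. length h = n \<and> (\<forall>i\<in>{..<length h}. X i \<omega> = h ! i)}"
    by (auto simp: hist_eq_iff vimage_def)
  also have "\<dots> \<in> sets M" by measurable
  finally show "hist X n -` {h} \<inter> space M \<in> sets M" .
qed auto

text \<open>The steps are merely integer-valued, and the law speaks only about lists over {-1, 1}.
  Other values are null because the two continuations of a path carry its whole probability; there
  are countably many paths, so one null set serves for all of them.\<close>

lemma (in prob_space) erw_AE_pm_list:
  assumes [measurable]: "\<And>i. X i \<in> measurable M (count_space UNIV)"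
    and law: "\<And>h. set h \<subseteq> {-1, 1} \<Longrightarrow> prob {\<omega> \<in> space M. hist X (length h) \<omega> = h} = erw_path_prob p q h"
  shows "AE \<omega> in M. \<forall>n\<ge>1. pm_list (hist X n \<omega>)"
proof -
  have h0: "AE \<omega> in M. X 0 \<omega> = 1 \<or> X 0 \<omega> = - 1"
  proof -
    have "prob (space M) = prob {\<omega> \<in> space M. hist X 1 \<omega> = [1]} + prob {\<omega> \<in> space M. hist X 1 \<omega> = [-1]}"
      using law[of "[1]"] law[of "[-1]"]
      by (simp add: prob_space erw_path_prob_def erw_first_prob_def)
    then have "AE \<omega> in M. \<omega> \<in> space M \<longrightarrow> \<omega> \<in> {\<omega> \<in> space M. hist X 1 \<omega> = [1]} \<or> \<omega> \<in> {\<omega> \<in> space M. hist X 1 \<omega> = [-1]}"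
      by (intro AE_eq_one_of) auto
    then show ?thesis by (auto simp: hist_def)
  qed
  have "AE \<omega> in M. pm_list h \<longrightarrow> hist X (length h) \<omega> = h \<longrightarrow> X (length h) \<omega> = 1 \<or> X (length h) \<omega> = -1" for h
  proof (cases "pm_list h")
    case True
    let ?C = "\<lambda>h. {\<omega> \<in> space M. hist X (length h) \<omega> = h}"
    have h: "h \<noteq> []" "set h \<subseteq> {-1, 1}" using True by (auto simp: pm_list_def)
    have "erw_path_prob p q h = erw_path_prob p q (h @ [1]) + erw_path_prob p q (h @ [-1])"
      using erw_step_prob_sum[OF True, of p] h by (simp add: erw_path_prob_snoc flip: distrib_left)
    then have "prob (?C h) = prob (?C (h @ [1])) + prob (?C (h @ [-1]))"
      using law[of h] law[of "h @ [1]"] law[of "h @ [-1]"] h by simp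
    then have "AE \<omega> in M. \<omega> \<in> ?C h \<longrightarrow> \<omega> \<in> ?C (h @ [1]) \<or> \<omega> \<in> ?C (h @ [-1])"
      by (intro AE_eq_one_of) (auto simp: hist_Suc)
    moreover have "AE \<omega> in M. \<omega> \<in> space M" by simp
    ultimately show ?thesis by eventually_elim (auto simp: hist_Suc)
  qed simp
  then have "AE \<omega> in M. \<forall>h. pm_list h \<longrightarrow> hist X (length h) \<omega> = h \<longrightarrow> X (length h) \<omega> = 1 \<or> X (length h) \<omega> = -1"
    by (simp add: AE_all_countable)
  then show ?thesis using h0
  proof eventually_elim
    case (elim \<omega>)
    have "pm_list (hist X n \<omega>)" if "1 \<le> n" for n
      using that
    proof (induction n rule: dec_induct)
      case base
      then show ?case using elim by (auto simp: hist_def pm_list_def)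
    next
      case (step n)
      then have "X n \<omega> = 1 \<or> X n \<omega> = -1" using elim(1) by (metis length_hist)
      then show ?case unfolding hist_Suc by (intro pm_list_snoc step) auto
    qed
    then show ?case by blast
  qed
qed

section \<open>The pair of walks: finite histories, maximal inequality\<close>

locale erw_pair = prob_space M for M :: "'a measure" +
  fixes p q p' q' :: real and X Y :: "nat \<Rightarrow> 'a \<Rightarrow> int"
  assumes q: "0 \<le> q" "q \<le> 1" "0 \<le> q'" "q' \<le> 1"
    and p: "0 < p" "p < 3/4" "0 < p'" "p' < 3/4"
    and indep: "indep_erw_pair M p q p' q' X Y"
begin

definition hist2 :: "nat \<Rightarrow> 'a \<Rightarrow> int list \<times> int list" where
  "hist2 n \<omega> = (hist X n \<omega>, hist Y n \<omega>)"

definition pair_prob :: "int list \<Rightarrow> int list \<Rightarrow> real" where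
  "pair_prob h h' = erw_path_prob p q h * erw_path_prob p' q' h'"

lemma measurable_X [measurable]: "X i \<in> measurable M (count_space UNIV)"
  and measurable_Y [measurable]: "Y i \<in> measurable M (count_space UNIV)"
  using indep by (auto simp: indep_erw_pair_def)

lemma measurable_hist2 [measurable]: "hist2 n \<in> measurable M (count_space UNIV)"
proof (subst measurable_count_space_eq2_countable, safe)
  fix h h'
  have "hist2 n -` {(h, h')} \<inter> space M = {\<omega> \<in> space M. hist X n \<omega> = h \<and> hist Y n \<omega> = h'}"
    by (auto simp: hist2_def)
  also have "\<dots> \<in> sets M" by measurable
  finally show "hist2 n -` {(h, h')} \<inter> space M \<in> sets M" .
qed auto

lemma events_hist2: "{\<omega> \<in> space M. Q (hist2 n \<omega>)} \<in> events"
proof -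
  have "hist2 n -` {z. Q z} \<inter> space M \<in> events" by (rule measurable_sets[OF measurable_hist2]) simp
  then show ?thesis by (simp add: vimage_def Int_def conj_commute)
qed

lemma cylinder_law:
  assumes "set h \<subseteq> {-1, 1}" "set h' \<subseteq> {-1, 1}"
  shows "prob {\<omega> \<in> space M. hist X (length h) \<omega> = h \<and> hist Y (length h') \<omega> = h'} = pair_prob h h'"
  using indep assms by (simp add: indep_erw_pair_def hist_eq_iff pair_prob_def)

lemma prob_hist2:
  assumes "set h \<subseteq> {-1, 1}" "set h' \<subseteq> {-1, 1}" "length h = n" "length h' = n"
  shows "prob {\<omega> \<in> space M. hist2 n \<omega> = (h, h')} = pair_prob h h'"
  using cylinder_law[OF assms(1,2)] assms by (simp add: hist2_def)

lemma AE_pm_list: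
  "AE \<omega> in M. \<forall>n\<ge>1. pm_list (hist X n \<omega>) \<and> pm_list (hist Y n \<omega>)"
proof -
  have "AE \<omega> in M. \<forall>n\<ge>1. pm_list (hist X n \<omega>)"
  proof (rule erw_AE_pm_list[OF measurable_X])
    show "prob {\<omega> \<in> space M. hist X (length h) \<omega> = h} = erw_path_prob p q h" if "set h \<subseteq> {-1, 1}" for h
      \<comment> \<open>The empty list imposes no condition on the other walk and has path
        probability 1, which extracts the marginal law.\<close>
      using cylinder_law[OF that, of "[]"] by (simp add: hist_def pair_prob_def erw_path_prob_def[of _ _ "[]"])
  qed
  moreover have "AE \<omega> in M. \<forall>n\<ge>1. pm_list (hist Y n \<omega>)"
  proof (rule erw_AE_pm_list[OF measurable_Y])
    show "prob {\<omega> \<in> space M. hist Y (length h) \<omega> = h} = erw_path_prob p' q' h" if "set h \<subseteq> {-1, 1}" for h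
      using cylinder_law[OF _ that, of "[]"] by (simp add: hist_def pair_prob_def erw_path_prob_def[of _ _ "[]"])
  qed
  ultimately show ?thesis by eventually_elim auto
qed

lemma pair_prob_nonneg: "set h \<subseteq> {-1, 1} \<Longrightarrow> set h' \<subseteq> {-1, 1} \<Longrightarrow> 0 \<le> pair_prob h h'"
  using cylinder_law[of h h'] by (metis measure_nonneg)

lemma pair_prob_snoc:
  assumes "pm_list h" "pm_list h'"
  shows "pair_prob (h @ [x]) (h' @ [y]) = pair_prob h h' * (erw_step_prob p h x * erw_step_prob p' h' y)"
  using assms by (simp add: pair_prob_def erw_path_prob_snoc pm_list_def)

text \<open>The pieces need to exhaust the event only almost surely, as is the case for cylinders
  over paths with steps in {-1, 1}.\<close>

lemma prob_split_finite:
  assumes "finite S" "A \<in> events" "\<And>z. z \<in> S \<Longrightarrow> C z \<in> events"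
    and "\<And>z w. z \<in> S \<Longrightarrow> w \<in> S \<Longrightarrow> z \<noteq> w \<Longrightarrow> C z \<inter> C w = {}"
    and "\<And>z. z \<in> S \<Longrightarrow> C z \<subseteq> A" "AE \<omega> in M. \<omega> \<in> A \<longrightarrow> (\<exists>z\<in>S. \<omega> \<in> C z)"
  shows "prob A = (\<Sum>z\<in>S. prob (C z))"
proof -
  have "prob A = prob (\<Union>z\<in>S. C z)"
  proof (rule finite_measure_eq_AE)
    show "AE \<omega> in M. \<omega> \<in> A \<longleftrightarrow> \<omega> \<in> (\<Union>z\<in>S. C z)"
      using assms(6) by eventually_elim (use assms(5) in auto)
  qed (use assms in \<open>auto simp: sets.finite_UN\<close>)
  also have "\<dots> = (\<Sum>z\<in>S. prob (C z))"
    by (rule finite_measure_finite_Union) (use assms in \<open>auto simp: disjoint_family_on_def\<close>)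
  finally show ?thesis .
qed

lemma prob_split_step:
  assumes "pm_list h" "pm_list h'" "length h = n" "length h' = n" "A \<in> events"
  shows "prob ({\<omega> \<in> space M. hist2 n \<omega> = (h, h')} \<inter> A) =
    (\<Sum>x\<in>{-1, 1}. \<Sum>y\<in>{-1, 1}. prob ({\<omega> \<in> space M. hist2 (Suc n) \<omega> = (h @ [x], h' @ [y])} \<inter> A))"
proof -
  have "prob ({\<omega> \<in> space M. hist2 n \<omega> = (h, h')} \<inter> A) =
    (\<Sum>(x, y)\<in>{-1, 1} \<times> {-1, 1}. prob ({\<omega> \<in> space M. hist2 (Suc n) \<omega> = (h @ [x], h' @ [y])} \<inter> A))"
    unfolding case_prod_unfold
  proof (rule prob_split_finite)
    show "AE \<omega> in M. \<omega> \<in> {\<omega> \<in> space M. hist2 n \<omega> = (h, h')} \<inter> A \<longrightarrow>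
      (\<exists>z\<in>{-1, 1} \<times> {-1, 1}. \<omega> \<in> {\<omega> \<in> space M. hist2 (Suc n) \<omega> = (h @ [fst z], h' @ [snd z])} \<inter> A)"
      using AE_pm_list
    proof eventually_elim
      case (elim \<omega>)
      then have "pm_list (hist X (Suc n) \<omega>)" "pm_list (hist Y (Suc n) \<omega>)" by auto
      then have "X n \<omega> \<in> {-1, 1}" "Y n \<omega> \<in> {-1, 1}" by (auto simp: pm_list_def hist_Suc)
      then show ?case by (auto simp: hist2_def hist_Suc)
    qed
  qed (use assms(5) in \<open>auto intro!: sets.Int events_hist2 simp: hist2_def hist_Suc\<close>)
  then show ?thesis by (simp only: sum.cartesian_product)
qed

text \<open>The conditional law of the future, multiplied out instead of divided, so that it stays
  true for histories of probability zero (as occur for q = 0 or q = 1). The nested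
  \<open>path_exp\<close> expresses independence of the two futures given the history.\<close>

lemma prob_cylinder_future:
  assumes "pm_list h" "pm_list h'" "length h = n" "length h' = n"
  shows "prob ({\<omega> \<in> space M. hist2 n \<omega> = (h, h')} \<inter> {\<omega> \<in> space M. Q (hist2 (n + r) \<omega>)}) =
    pair_prob h h' * path_exp p r h (\<lambda>g. path_exp p' r h' (\<lambda>g'. of_bool (Q (g, g'))))"
  using assms
proof (induction r arbitrary: h h' n)
  case 0
  have s: "set h \<subseteq> {-1, 1}" "set h' \<subseteq> {-1, 1}" using 0 by (auto simp: pm_list_def)
  have "{\<omega> \<in> space M. hist2 n \<omega> = (h, h')} \<inter> {\<omega> \<in> space M. Q (hist2 (n + 0) \<omega>)} =
    (if Q (h, h') then {\<omega> \<in> space M. hist2 n \<omega> = (h, h')} else {})" by auto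
  then show ?case using prob_hist2[OF s 0(3,4)] by auto
next
  case (Suc r)
  let ?F = "\<lambda>g g'. of_bool (Q (g, g')) :: real"
  have "prob ({\<omega> \<in> space M. hist2 n \<omega> = (h, h')} \<inter> {\<omega> \<in> space M. Q (hist2 (n + Suc r) \<omega>)}) =
    (\<Sum>x\<in>{-1, 1}. \<Sum>y\<in>{-1, 1}. prob ({\<omega> \<in> space M. hist2 (Suc n) \<omega> = (h @ [x], h' @ [y])}
        \<inter> {\<omega> \<in> space M. Q (hist2 (Suc n + r) \<omega>)}))"
    by (subst prob_split_step[OF Suc.prems events_hist2]) simp
  also have "\<dots> = (\<Sum>x\<in>{-1, 1}. \<Sum>y\<in>{-1, 1}. pair_prob (h @ [x]) (h' @ [y])
       * path_exp p r (h @ [x]) (\<lambda>g. path_exp p' r (h' @ [y]) (?F g)))"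
    by (intro sum.cong refl Suc.IH pm_list_snoc Suc.prems) (use Suc.prems in auto)
  also have "\<dots> = (\<Sum>x\<in>{-1, 1}. \<Sum>y\<in>{-1, 1}. pair_prob h h' * (erw_step_prob p h x * erw_step_prob p' h' y)
       * path_exp p r (h @ [x]) (\<lambda>g. path_exp p' r (h' @ [y]) (?F g)))"
    by (simp only: pair_prob_snoc[OF Suc.prems(1,2)])
  also have "\<dots> = pair_prob h h' * path_exp p (Suc r) h (\<lambda>g. path_exp p' (Suc r) h' (?F g))"
    by (simp add: path_exp_linear algebra_simps)
  finally show ?case .
qed

text \<open>Doob's maximal inequality for a nonnegative supermartingale, by induction on the horizon
  in place of optional stopping. If \<open>W\<close> has reached \<open>c\<close> at the current
  history, the probability of the cylinder is bound enough; otherwise the event concerns later times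
  only, and the supermartingale property carries the bounds for the four continuations back.\<close>

lemma maximal_inequality_cylinder:
  assumes "pm_list h" "pm_list h'" "length h = n" "length h' = n" "n + r \<le> N" "0 < c"
    and W0: "\<And>h h'. 0 \<le> W h h'"
    and W: "\<And>h h'. pm_list h \<Longrightarrow> pm_list h' \<Longrightarrow> length h < N \<Longrightarrow> length h' = length h \<Longrightarrow>
      (\<Sum>x\<in>{-1, 1}. \<Sum>y\<in>{-1, 1}. erw_step_prob p h x * erw_step_prob p' h' y * W (h @ [x]) (h' @ [y])) \<le> W h h'"
  shows "prob ({\<omega> \<in> space M. hist2 n \<omega> = (h, h')} \<inter>
      {\<omega> \<in> space M. \<exists>k\<in>{n..n + r}. c \<le> W (hist X k \<omega>) (hist Y k \<omega>)}) \<le> pair_prob h h' * (W h h' / c)"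
  using assms(1-5)
proof (induction r arbitrary: h h' n)
  case (0 h h' n)
  have s: "set h \<subseteq> {-1, 1}" "set h' \<subseteq> {-1, 1}" using 0 by (auto simp: pm_list_def)
  have pp: "0 \<le> pair_prob h h'" by (rule pair_prob_nonneg[OF s])
  show ?case
  proof (cases "c \<le> W h h'")
    case True
    have "prob ({\<omega> \<in> space M. hist2 n \<omega> = (h, h')} \<inter>
      {\<omega> \<in> space M. \<exists>k\<in>{n..n + 0}. c \<le> W (hist X k \<omega>) (hist Y k \<omega>)}) \<le> prob {\<omega> \<in> space M. hist2 n \<omega> = (h, h')}"
      by (intro finite_measure_mono events_hist2) auto
    also have "\<dots> = pair_prob h h' * 1" using prob_hist2[OF s 0(3,4)] by simp
    also have "\<dots> \<le> pair_prob h h' * (W h h' / c)"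
      using True assms(6) pp by (intro mult_left_mono) auto
    finally show ?thesis .
  next
    case False
    then have "{\<omega> \<in> space M. hist2 n \<omega> = (h, h')} \<inter>
      {\<omega> \<in> space M. \<exists>k\<in>{n..n + 0}. c \<le> W (hist X k \<omega>) (hist Y k \<omega>)} = {}" by (auto simp: hist2_def)
    then show ?thesis using pp W0 assms(6) by (simp add: divide_nonneg_pos)
  qed
next
  case (Suc r h h' n)
  have s: "set h \<subseteq> {-1, 1}" "set h' \<subseteq> {-1, 1}" using Suc.prems by (auto simp: pm_list_def)
  have pp: "0 \<le> pair_prob h h'" by (rule pair_prob_nonneg[OF s])
  show ?case
  proof (cases "c \<le> W h h'")
    case True
    have "prob ({\<omega> \<in> space M. hist2 n \<omega> = (h, h')} \<inter>
      {\<omega> \<in> space M. \<exists>k\<in>{n..n + Suc r}. c \<le> W (hist X k \<omega>) (hist Y k \<omega>)}) \<le> prob {\<omega> \<in> space M. hist2 n \<omega> = (h, h')}"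
      by (intro finite_measure_mono events_hist2) auto
    also have "\<dots> = pair_prob h h' * 1" using prob_hist2[OF s Suc.prems(3,4)] by simp
    also have "\<dots> \<le> pair_prob h h' * (W h h' / c)"
      using True assms(6) pp by (intro mult_left_mono) auto
    finally show ?thesis .
  next
    case False
    let ?A = "\<lambda>n r. {\<omega> \<in> space M. \<exists>k\<in>{n..n + r}. c \<le> W (hist X k \<omega>) (hist Y k \<omega>)}"
    have ev: "?A n r \<in> events" for n r
      using events_hist2[of "\<lambda>(g, g'). c \<le> W g g'"] 
      by (auto simp: hist2_def intro!: sets.sets_Collect_finite_Ex)
    have "{n..n + Suc r} = insert n {Suc n..Suc n + r}" by auto
    then have "{\<omega> \<in> space M. hist2 n \<omega> = (h, h')} \<inter> ?A n (Suc r)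
        = {\<omega> \<in> space M. hist2 n \<omega> = (h, h')} \<inter> ?A (Suc n) r"
      using False by (auto simp: hist2_def)
    then have "prob ({\<omega> \<in> space M. hist2 n \<omega> = (h, h')} \<inter> ?A n (Suc r)) =
      (\<Sum>x\<in>{-1, 1}. \<Sum>y\<in>{-1, 1}. prob ({\<omega> \<in> space M. hist2 (Suc n) \<omega> = (h @ [x], h' @ [y])} \<inter> ?A (Suc n) r))"
      using prob_split_step[OF Suc.prems(1-4) ev[of "Suc n" r]] by (simp only:)
    also have "\<dots> \<le> (\<Sum>x\<in>{-1, 1}. \<Sum>y\<in>{-1, 1}. pair_prob (h @ [x]) (h' @ [y]) * (W (h @ [x]) (h' @ [y]) / c))"
      by (intro sum_mono Suc.IH pm_list_snoc Suc.prems) (use Suc.prems in auto)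
    also have "\<dots> = (\<Sum>x\<in>{-1, 1}. \<Sum>y\<in>{-1, 1}. pair_prob h h' / c * (erw_step_prob p h x * erw_step_prob p' h' y * W (h @ [x]) (h' @ [y])))"
      by (simp only: pair_prob_snoc[OF Suc.prems(1,2)]) (simp add: field_simps)
    also have "\<dots> = pair_prob h h' / c * (\<Sum>x\<in>{-1, 1}. \<Sum>y\<in>{-1, 1}. erw_step_prob p h x * erw_step_prob p' h' y * W (h @ [x]) (h' @ [y]))"
      by (simp only: sum_distrib_left)
    also have "\<dots> \<le> pair_prob h h' / c * W h h'"
      using pp assms(6) Suc.prems by (intro mult_left_mono W) auto
    finally show ?thesis by (simp add: field_simps)
  qed
qed

text \<open>The process starts at time 1, since the first steps follow a law of their own; bounding
  \<open>W\<close> there by one \<open>K\<close> makes the result free of \<open>q\<close> and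
  \<open>q'\<close>.\<close>

lemma maximal_inequality:
  assumes "1 \<le> N" "0 < c"
    and W0: "\<And>h h'. 0 \<le> W h h'"
    and W: "\<And>h h'. pm_list h \<Longrightarrow> pm_list h' \<Longrightarrow> length h < N \<Longrightarrow> length h' = length h \<Longrightarrow>
      (\<Sum>x\<in>{-1, 1}. \<Sum>y\<in>{-1, 1}. erw_step_prob p h x * erw_step_prob p' h' y * W (h @ [x]) (h' @ [y])) \<le> W h h'"
    and K: "\<And>x y. x \<in> {-1, 1} \<Longrightarrow> y \<in> {-1, 1} \<Longrightarrow> W [x] [y] \<le> K"
  shows "prob {\<omega> \<in> space M. \<exists>k\<in>{1..N}. c \<le> W (hist X k \<omega>) (hist Y k \<omega>)} \<le> K / c"
proof -
  let ?A = "{\<omega> \<in> space M. \<exists>k\<in>{1..N}. c \<le> W (hist X k \<omega>) (hist Y k \<omega>)}"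
  let ?C = "\<lambda>z. {\<omega> \<in> space M. hist2 1 \<omega> = ([fst z], [snd z])}"
  have ev: "?A \<in> events"
    using events_hist2[of "\<lambda>(g, g'). c \<le> W g g'"]
    by (auto simp: hist2_def intro!: sets.sets_Collect_finite_Ex)
  have "prob ?A = (\<Sum>z\<in>{-1, 1} \<times> {-1, 1}. prob (?C z \<inter> ?A))"
  proof (rule prob_split_finite)
    show "AE \<omega> in M. \<omega> \<in> ?A \<longrightarrow> (\<exists>z\<in>{-1, 1} \<times> {-1, 1}. \<omega> \<in> ?C z \<inter> ?A)"
      using AE_pm_list
    proof eventually_elim
      case (elim \<omega>)
      then have "pm_list (hist X 1 \<omega>)" "pm_list (hist Y 1 \<omega>)" by auto
      then have "X 0 \<omega> \<in> {-1, 1}" "Y 0 \<omega> \<in> {-1, 1}" by (auto simp: pm_list_def hist_def)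
      then show ?case by (auto simp: hist2_def hist_def)
    qed
  qed (use ev in \<open>auto intro!: sets.Int events_hist2 simp: hist2_def\<close>)
  also have "\<dots> \<le> (\<Sum>z\<in>{-1, 1} \<times> {-1, 1}. pair_prob [fst z] [snd z] * (K / c))"
  proof (rule sum_mono)
    fix z :: "int \<times> int" assume z: "z \<in> {-1, 1} \<times> {-1, 1}"
    have "prob (?C z \<inter> {\<omega> \<in> space M. \<exists>k\<in>{1..1 + (N - 1)}. c \<le> W (hist X k \<omega>) (hist Y k \<omega>)})
       \<le> pair_prob [fst z] [snd z] * (W [fst z] [snd z] / c)"
      by (rule maximal_inequality_cylinder[where N = N]) (use assms z in \<open>auto simp: pm_list_def\<close>)
    also have "\<dots> \<le> pair_prob [fst z] [snd z] * (K / c)"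
      by (intro mult_left_mono divide_right_mono K pair_prob_nonneg) (use z assms in auto)
    finally show "prob (?C z \<inter> ?A) \<le> pair_prob [fst z] [snd z] * (K / c)" using assms(1) by simp
  qed
  also have "\<dots> = (\<Sum>z\<in>{-1, 1} \<times> {-1, 1}. pair_prob [fst z] [snd z]) * (K / c)"
    by (simp only: sum_distrib_right)
  also have "(\<Sum>z\<in>{-1, 1} \<times> {-1, 1}. pair_prob [fst z] [snd z]) = (\<Sum>x\<in>{-1, 1}. \<Sum>y\<in>{-1, 1}. pair_prob [x] [y])"
    by (simp only: sum.cartesian_product case_prod_unfold)
  also have "\<dots> = 1"
    by (simp add: pair_prob_def erw_path_prob_def erw_first_prob_def algebra_simps)
  finally show ?thesis by simp
qed

section \<open>A conditional Borel--Cantelli lemma along blocks\<close>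

lemma prob_block_fail:
  assumes "1 \<le> m" "m \<le> N" "0 \<le> \<kappa>" "\<kappa> \<le> 1"
    and low: "\<And>h h'. pm_list h \<Longrightarrow> pm_list h' \<Longrightarrow> length h = m \<Longrightarrow> length h' = m \<Longrightarrow>
      \<kappa> \<le> path_exp p (N - m) h (\<lambda>g. path_exp p' (N - m) h' (\<lambda>g'. of_bool (Q (g, g'))))"
  shows "prob ({\<omega> \<in> space M. R (hist2 m \<omega>)} \<inter> {\<omega> \<in> space M. \<not> Q (hist2 N \<omega>)})
    \<le> (1 - \<kappa>) * prob {\<omega> \<in> space M. R (hist2 m \<omega>)}"
proof -
  define L where "L = {h. pm_list h \<and> length h = m}"
  define S where "S = {z \<in> L \<times> L. R z}"
  have "L \<subseteq> {h. set h \<subseteq> {-1, 1} \<and> length h = m}" by (auto simp: L_def pm_list_def)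
  then have "finite L" using finite_lists_length_eq[of "{-1, 1 :: int}" m] finite_subset by blast
  then have finS: "finite S" by (simp add: S_def)
  let ?C = "\<lambda>z. {\<omega> \<in> space M. hist2 m \<omega> = z}"
  have AE_S: "AE \<omega> in M. R (hist2 m \<omega>) \<longrightarrow> hist2 m \<omega> \<in> S"
    using AE_pm_list by eventually_elim (use assms(1) in \<open>auto simp: S_def L_def hist2_def\<close>)
  have 1: "prob {\<omega> \<in> space M. R (hist2 m \<omega>)} = (\<Sum>z\<in>S. prob (?C z))"
  proof (rule prob_split_finite)
    show "AE \<omega> in M. \<omega> \<in> {\<omega> \<in> space M. R (hist2 m \<omega>)} \<longrightarrow> (\<exists>z\<in>S. \<omega> \<in> ?C z)"
      using AE_S by eventually_elim auto
  qed (use finS in \<open>auto intro!: events_hist2 simp: S_def\<close>)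
  have "prob ({\<omega> \<in> space M. R (hist2 m \<omega>)} \<inter> {\<omega> \<in> space M. \<not> Q (hist2 N \<omega>)})
     = (\<Sum>z\<in>S. prob (?C z \<inter> {\<omega> \<in> space M. \<not> Q (hist2 N \<omega>)}))"
  proof (rule prob_split_finite)
    show "AE \<omega> in M. \<omega> \<in> {\<omega> \<in> space M. R (hist2 m \<omega>)} \<inter> {\<omega> \<in> space M. \<not> Q (hist2 N \<omega>)}
       \<longrightarrow> (\<exists>z\<in>S. \<omega> \<in> ?C z \<inter> {\<omega> \<in> space M. \<not> Q (hist2 N \<omega>)})"
      using AE_S by eventually_elim auto
  qed (use finS in \<open>auto intro!: sets.Int events_hist2 simp: S_def\<close>)
  also have "\<dots> \<le> (\<Sum>z\<in>S. (1 - \<kappa>) * prob (?C z))"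
  proof (rule sum_mono)
    fix z assume z: "z \<in> S"
    obtain h h' where zh: "z = (h, h')" by (cases z)
    have h: "pm_list h" "pm_list h'" "length h = m" "length h' = m" using z by (auto simp: zh S_def L_def)
    have s: "set h \<subseteq> {-1, 1}" "set h' \<subseteq> {-1, 1}" using h by (auto simp: pm_list_def)
    let ?E = "\<lambda>F. path_exp p (N - m) h (\<lambda>g. path_exp p' (N - m) h' (F g))"
    have "prob (?C z \<inter> {\<omega> \<in> space M. \<not> Q (hist2 N \<omega>)}) = pair_prob h h' * ?E (\<lambda>g g'. of_bool (\<not> Q (g, g')))"
      using prob_cylinder_future[OF h, of "\<lambda>z. \<not> Q z" "N - m"] assms(2) by (simp add: zh)
    also have "?E (\<lambda>g g'. of_bool (\<not> Q (g, g'))) = ?E (\<lambda>g g'. 1 * 1 + (-1) * of_bool (Q (g, g')))"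
      by (simp add: of_bool_not_iff)
    also have "\<dots> = 1 - ?E (\<lambda>g g'. of_bool (Q (g, g')))"
      unfolding path_exp_linear path_exp_const[OF h(1)] path_exp_const[OF h(2)] by simp
    also have "\<dots> \<le> 1 - \<kappa>" using low[OF h] by simp
    finally have "prob (?C z \<inter> {\<omega> \<in> space M. \<not> Q (hist2 N \<omega>)}) \<le> pair_prob h h' * (1 - \<kappa>)"
      using pair_prob_nonneg[OF s] by (simp add: mult_left_mono)
    then show "prob (?C z \<inter> {\<omega> \<in> space M. \<not> Q (hist2 N \<omega>)}) \<le> (1 - \<kappa>) * prob (?C z)"
      using prob_hist2[OF s h(3,4)] by (simp add: zh mult.commute)
  qed
  also have "\<dots> = (1 - \<kappa>) * prob {\<omega> \<in> space M. R (hist2 m \<omega>)}"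
    unfolding 1 sum_distrib_left ..
  finally show ?thesis .
qed

text \<open>Given any past, block j fails with probability at most j/(j + 1). The probability that
  all of the blocks J, ..., k - 1 fail is thus at most the product of these numbers, which is J/k
  and tends to 0.\<close>

lemma AE_infinitely_often_block:
  fixes N :: "nat \<Rightarrow> nat" and Q :: "nat \<Rightarrow> int list \<times> int list \<Rightarrow> bool"
  assumes "mono N" "\<And>j. 1 \<le> N j"
    and low: "\<And>j h h'. J0 \<le> j \<Longrightarrow> pm_list h \<Longrightarrow> pm_list h' \<Longrightarrow> length h = N j \<Longrightarrow> length h' = N j \<Longrightarrow>
      1 / real (Suc j) \<le> path_exp p (N (Suc j) - N j) h
         (\<lambda>g. path_exp p' (N (Suc j) - N j) h' (\<lambda>g'. of_bool (Q j (g, g'))))"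
  shows "AE \<omega> in M. \<exists>\<^sub>\<infinity>j. Q j (hist2 (N (Suc j)) \<omega>)"
proof -
  let ?F = "\<lambda>J k. {\<omega> \<in> space M. \<forall>i\<in>{J..<k}. \<not> Q i (hist2 (N (Suc i)) \<omega>)}"
  have ev: "?F J k \<in> events" for J k
    using events_hist2 by (auto intro!: sets.sets_Collect_finite_All')
  have bound: "prob (?F J k) \<le> real J / real k" if J: "J0 \<le> J" "1 \<le> J" "J \<le> k" for J k
    using J(3)
  proof (induction k rule: dec_induct)
    case base
    then show ?case using J by simp
  next
    case (step k)
    \<comment> \<open>Truncation reads the earlier failures off the history at time
      \<open>N k\<close>, which makes them a past event in the sense of
      \<open>prob_block_fail\<close>.\<close>
    define R where "R = (\<lambda>z :: int list \<times> int list. \<forall>i\<in>{J..<k}. \<not> Q i (take (N (Suc i)) (fst z), take (N (Suc i)) (snd z)))"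
    have R: "R (hist2 (N k) \<omega>) \<longleftrightarrow> (\<forall>i\<in>{J..<k}. \<not> Q i (hist2 (N (Suc i)) \<omega>))" for \<omega>
      using monoD[OF assms(1), of "Suc _" k] by (auto simp: R_def hist2_def take_hist)
    have "?F J (Suc k) = {\<omega> \<in> space M. R (hist2 (N k) \<omega>)} \<inter> {\<omega> \<in> space M. \<not> Q k (hist2 (N (Suc k)) \<omega>)}"
      unfolding R using step.hyps by (auto simp: less_Suc_eq)
    then have "prob (?F J (Suc k)) \<le> (1 - 1 / real (Suc k)) * prob {\<omega> \<in> space M. R (hist2 (N k) \<omega>)}"
      using prob_block_fail[of "N k" "N (Suc k)" "1 / real (Suc k)" "Q k" R] assms(2)
        monoD[OF assms(1), of k "Suc k"] low[of k] J(1) step.hyps by simp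
    also have "\<dots> \<le> (1 - 1 / real (Suc k)) * (real J / real k)"
      unfolding R by (intro mult_left_mono step.IH) auto
    also have "\<dots> = real J / real (Suc k)" using step.hyps J by (simp add: field_simps)
    finally show ?case .
  qed
  have null: "AE \<omega> in M. \<not> (\<forall>i\<ge>J. \<not> Q i (hist2 (N (Suc i)) \<omega>))" if J: "J0 \<le> J" "1 \<le> J" for J
  proof -
    let ?G = "{\<omega> \<in> space M. \<forall>i\<ge>J. \<not> Q i (hist2 (N (Suc i)) \<omega>)}"
    have evG: "?G \<in> events"
    proof -
      have "?G = (\<Inter>k. ?F J k)" by (auto simp: Ball_def)
      moreover have "(\<Inter>k. ?F J k) \<in> events" using ev by (intro sets.countable_INT) auto
      ultimately show ?thesis by simp
    qed
    have "prob ?G \<le> real J / real k" if "k \<ge> J" for k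
    proof -
      have "prob ?G \<le> prob (?F J k)" by (intro finite_measure_mono ev) auto
      then show ?thesis using bound[OF J that] by linarith
    qed
    moreover have "(\<lambda>k. real J / real k) \<longlonglongrightarrow> 0" by real_asymp
    ultimately have "prob ?G \<le> 0"
      by (intro tendsto_lowerbound[where f = "\<lambda>k. real J / real k" and F = sequentially])
         (auto simp: eventually_at_top_linorder intro: exI[of _ J])
    then have "prob ?G = 0" using measure_nonneg[of M ?G] by linarith
    then have "?G \<in> null_sets M" using evG by (auto simp: null_sets_def emeasure_eq_measure)
    then have "AE \<omega> in M. \<omega> \<notin> ?G" by (rule AE_not_in)
    moreover have "AE \<omega> in M. \<omega> \<in> space M" by simp
    ultimately show ?thesis by eventually_elim auto
  qed
  have "AE \<omega> in M. \<forall>J. J0 \<le> J \<and> 1 \<le> J \<longrightarrow> \<not> (\<forall>i\<ge>J. \<not> Q i (hist2 (N (Suc i)) \<omega>))"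
    using null by (simp add: AE_all_countable)
  then show ?thesis
  proof eventually_elim
    case (elim \<omega>)
    show ?case unfolding INFM_nat_le
    proof
      fix J
      have "J0 \<le> J + J0 + 1 \<and> 1 \<le> J + J0 + 1" by simp
      then have "\<not> (\<forall>i\<ge>J + J0 + 1. \<not> Q i (hist2 (N (Suc i)) \<omega>))" using elim by blast
      then show "\<exists>i\<ge>J. Q i (hist2 (N (Suc i)) \<omega>)" by (meson le_trans le_add1 add_leD1)
    qed
  qed
qed

end

subsection \<open>Upper bound\<close>

definition lil_scale :: "nat \<Rightarrow> real" where
  "lil_scale n = sqrt (2 * real n * ln (ln (real n)))"

lemma lil_scale_nonneg: "1 \<le> ln (ln (real n)) \<Longrightarrow> 0 \<le> lil_scale n"
  unfolding lil_scale_def by (intro real_sqrt_ge_zero mult_nonneg_nonneg) auto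

lemma gauss_weight_pos: "0 < gauss_weight p l N h"
  by (simp add: gauss_weight_def)

text \<open>The first step reaches time N with weight \<open>drift_prod a 1 N\<close>; for a < 1/2
  this is negligible on the scale sqrt N, so it does not shift the threshold in the tail
  bound.\<close>

lemma drift_prod_over_sqrt_tendsto:
  assumes "-1 < a" "a < 1/2"
  shows "(\<lambda>N. drift_prod a 1 N / sqrt (real N)) \<longlonglongrightarrow> 0"
proof (rule tendsto_sandwich)
  show "\<forall>\<^sub>F N in sequentially. 0 \<le> drift_prod a 1 N / sqrt (real N)"
    using drift_prod_pos[OF assms(1) order_refl] by (intro always_eventually) (simp add: less_imp_le)
  show "\<forall>\<^sub>F N in sequentially. drift_prod a 1 N / sqrt (real N) \<le> exp 1 * real N powr (a - 1/2)"
    using eventually_ge_at_top[of 1]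
  proof eventually_elim
    case (elim N)
    have "drift_prod a 1 N / sqrt (real N) \<le> exp 1 * (real N / real 1) powr a / sqrt (real N)"
      by (intro divide_right_mono drift_prod_le_powr) (use assms elim in auto)
    also have "\<dots> = exp 1 * real N powr (a - 1/2)" using elim by (simp add: powr_diff powr_half_sqrt)
    finally show ?case .
  qed
  have "(\<lambda>N. exp 1 * real N powr (a - 1/2)) \<longlonglongrightarrow> exp 1 * 0"
    by (intro tendsto_intros tendsto_neg_powr filterlim_real_sequentially) (use assms in auto)
  then show "(\<lambda>N. exp 1 * real N powr (a - 1/2)) \<longlonglongrightarrow> 0" by simp
qed simp

lemma eventually_lil_pos: "\<forall>\<^sub>F n in sequentially. 1 \<le> ln (ln (real n))"
  by real_asymp

lemma eventually_ln_ln_mult_le: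
  fixes r :: real
  assumes "1 < r"
  shows "\<forall>\<^sub>F n in sequentially. ln (ln (r * real n)) \<le> r * ln (ln (real n))"
  using assms by real_asymp

section \<open>Tail bounds for linear combinations of the two walks\<close>

context erw_pair
begin

definition sigma :: "real \<Rightarrow> real \<Rightarrow> real" where
  "sigma u w = sqrt (u^2 / (3 - 4 * p) + w^2 / (3 - 4 * p'))"

definition comb :: "real \<Rightarrow> real \<Rightarrow> nat \<Rightarrow> 'a \<Rightarrow> real" where
  "comb u w n \<omega> = u * real_of_int (walk X n \<omega>) + w * real_of_int (walk Y n \<omega>)"

text \<open>For fixed \<open>N\<close> this is a martingale in \<open>k \<le> N\<close> which ends in \<open>comb u w N\<close>; the
  two walks have different normalisations, so no single martingale works for all \<open>N\<close>.\<close>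

definition drift_comb :: "real \<Rightarrow> real \<Rightarrow> nat \<Rightarrow> nat \<Rightarrow> 'a \<Rightarrow> real" where
  "drift_comb u w k N \<omega> = u * drift_prod (2 * p - 1) k N * real_of_int (walk X k \<omega>)
     + w * drift_prod (2 * p' - 1) k N * real_of_int (walk Y k \<omega>)"

definition comb_var :: "real \<Rightarrow> real \<Rightarrow> nat \<Rightarrow> nat \<Rightarrow> real" where
  "comb_var u w m N = u^2 * var_sum (2 * p - 1) m N + w^2 * var_sum (2 * p' - 1) m N"

lemma sigma_nonneg: "0 \<le> sigma u w"
  using p by (auto simp: sigma_def)

lemma sigma_sq: "(sigma u w)^2 = u^2 / (3 - 4 * p) + w^2 / (3 - 4 * p')"
  using p by (simp add: sigma_def add_nonneg_nonneg)

lemma comb_var_tendsto: "(\<lambda>N. comb_var u w 1 N / real N) \<longlonglongrightarrow> (sigma u w)^2"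
proof -
  have "(\<lambda>N. u^2 * (var_sum (2 * p - 1) 1 N / real N) + w^2 * (var_sum (2 * p' - 1) 1 N / real N))
     \<longlonglongrightarrow> u^2 * (1 / (1 - 2 * (2 * p - 1))) + w^2 * (1 / (1 - 2 * (2 * p' - 1)))"
    by (intro tendsto_intros var_sum_tendsto) (use p in auto)
  then show ?thesis by (simp add: comb_var_def sigma_sq add_divide_distrib)
qed

lemma measurable_drift_comb [measurable]: "drift_comb u w k N \<in> borel_measurable M"
proof -
  have [measurable]: "(\<lambda>\<omega>. real_of_int (walk X k \<omega>)) \<in> borel_measurable M"
    "(\<lambda>\<omega>. real_of_int (walk Y k \<omega>)) \<in> borel_measurable M"
    unfolding walk_def of_int_sum by measurable
  show ?thesis unfolding drift_comb_def by measurable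
qed

text \<open>The maximal inequality for the product of the two \<open>gauss_weight\<close> functions
  at the parameters l u and l w; the first term of the exponent bounds what the two first steps
  contribute.\<close>

lemma drift_comb_tail:
  assumes "1 \<le> N" "0 < l"
  shows "prob {\<omega> \<in> space M. \<exists>k\<in>{1..N}. y \<le> drift_comb u w k N \<omega>}
    \<le> exp (l * (\<bar>u\<bar> * drift_prod (2 * p - 1) 1 N + \<bar>w\<bar> * drift_prod (2 * p' - 1) 1 N)
        + l^2 / 2 * comb_var u w 1 N - l * y)"
proof -
  let ?W = "\<lambda>h h'. gauss_weight p (l * u) N h * gauss_weight p' (l * w) N h'"
  let ?B = "drift_prod (2 * p - 1) 1 N" and ?B' = "drift_prod (2 * p' - 1) 1 N"
  let ?K = "exp (l * (\<bar>u\<bar> * ?B + \<bar>w\<bar> * ?B') + l^2 / 2 * comb_var u w 1 N)"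
  have B: "0 < ?B" "0 < ?B'" using p by (auto intro!: drift_prod_pos)
  have "prob {\<omega> \<in> space M. \<exists>k\<in>{1..N}. y \<le> drift_comb u w k N \<omega>}
    \<le> prob {\<omega> \<in> space M. \<exists>k\<in>{1..N}. exp (l * y) \<le> ?W (hist X k \<omega>) (hist Y k \<omega>)}"
  proof (rule finite_measure_mono)
    show "{\<omega> \<in> space M. \<exists>k\<in>{1..N}. exp (l * y) \<le> ?W (hist X k \<omega>) (hist Y k \<omega>)} \<in> events"
      using events_hist2[of "\<lambda>(g, g'). exp (l * y) \<le> ?W g g'"]
      by (auto simp: hist2_def intro!: sets.sets_Collect_finite_Ex)
    have "exp (l * y) \<le> ?W (hist X k \<omega>) (hist Y k \<omega>)" if "y \<le> drift_comb u w k N \<omega>" for k \<omega>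
    proof -
      have "l * y \<le> l * drift_comb u w k N \<omega>" using that assms by (intro mult_left_mono) auto
      \<comment> \<open>The variance still to come at time \<open>k\<close> only increases the
        weight, so the crossing of \<open>y\<close> by the martingale forces the crossing of
        \<open>exp (l * y)\<close> by the weight.\<close>
      moreover have "0 \<le> (l * u)^2 / 2 * var_sum (2 * p - 1) k N" "0 \<le> (l * w)^2 / 2 * var_sum (2 * p' - 1) k N"
        by (auto intro!: mult_nonneg_nonneg var_sum_nonneg)
      ultimately show ?thesis
        by (simp add: gauss_weight_def endpoint_hist drift_comb_def algebra_simps flip: exp_add)
    qed
    then show "{\<omega> \<in> space M. \<exists>k\<in>{1..N}. y \<le> drift_comb u w k N \<omega>}
      \<subseteq> {\<omega> \<in> space M. \<exists>k\<in>{1..N}. exp (l * y) \<le> ?W (hist X k \<omega>) (hist Y k \<omega>)}" by auto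
  qed
  also have "\<dots> \<le> ?K / exp (l * y)"
  proof (rule maximal_inequality[OF assms(1)])
    show "(\<Sum>x\<in>{-1, 1}. \<Sum>z\<in>{-1, 1}. erw_step_prob p h x * erw_step_prob p' h' z * ?W (h @ [x]) (h' @ [z])) \<le> ?W h h'"
      if h: "pm_list h" "pm_list h'" "length h < N" "length h' = length h" for h h'
    proof -
      have "(\<Sum>x\<in>{-1, 1}. \<Sum>z\<in>{-1, 1}. erw_step_prob p h x * erw_step_prob p' h' z * ?W (h @ [x]) (h' @ [z]))
        = (\<Sum>x\<in>{-1, 1}. erw_step_prob p h x * gauss_weight p (l * u) N (h @ [x]))
          * (\<Sum>z\<in>{-1, 1}. erw_step_prob p' h' z * gauss_weight p' (l * w) N (h' @ [z]))"
        unfolding sum_product by (simp only: mult_ac)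
      also have "\<dots> \<le> ?W h h'"
        by (intro mult_mono gauss_weight_supermartingale sum_nonneg mult_nonneg_nonneg erw_step_prob_nonneg
             less_imp_le[OF gauss_weight_pos]) (use h p in auto)
      finally show ?thesis .
    qed
    show "?W [x] [z] \<le> ?K" if "x \<in> {-1, 1}" "z \<in> {-1, 1}" for x z
    proof -
      have xu: "u * real_of_int x \<le> \<bar>u\<bar>" "w * real_of_int z \<le> \<bar>w\<bar>" using that by auto
      have "l * (u * real_of_int x * ?B + w * real_of_int z * ?B') \<le> l * (\<bar>u\<bar> * ?B + \<bar>w\<bar> * ?B')"
        using xu B assms by (intro mult_left_mono add_mono mult_right_mono) auto
      then show ?thesis
        by (simp add: gauss_weight_def endpoint_def comb_var_def algebra_simps power_mult_distrib add_divide_distrib flip: exp_add)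
    qed
  qed (auto simp: gauss_weight_pos less_imp_le)
  also have "\<dots> = exp (l * (\<bar>u\<bar> * ?B + \<bar>w\<bar> * ?B') + l^2 / 2 * comb_var u w 1 N - l * y)"
    by (simp add: exp_diff)
  finally show ?thesis .
qed

lemma drift_comb_tail_gaussian:
  fixes u w :: real and N :: nat
  defines "\<mu> \<equiv> \<bar>u\<bar> * drift_prod (2 * p - 1) 1 N + \<bar>w\<bar> * drift_prod (2 * p' - 1) 1 N"
  assumes "1 \<le> N" "\<mu> < y" "0 < comb_var u w 1 N"
  shows "prob {\<omega> \<in> space M. \<exists>k\<in>{1..N}. y \<le> drift_comb u w k N \<omega>}
    \<le> exp (- ((y - \<mu>)^2 / (2 * comb_var u w 1 N)))"
proof -
  let ?Q = "comb_var u w 1 N"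
  \<comment> \<open>The minimiser of the exponent, a quadratic in \<open>l\<close>.\<close>
  define l where "l = (y - \<mu>) / ?Q"
  have "l * \<mu> + l^2 / 2 * ?Q - l * y = - ((y - \<mu>)^2 / (2 * ?Q))"
  proof -
    have "l * \<mu> + l^2 / 2 * ?Q - l * y = l * (l * ?Q) / 2 - l * (y - \<mu>)"
      by (simp add: algebra_simps power2_eq_square)
    also have "l * ?Q = y - \<mu>" using assms by (simp add: l_def)
    finally show ?thesis by (simp add: l_def power2_eq_square field_simps)
  qed
  moreover have "0 < l" using assms by (simp add: l_def)
  ultimately show ?thesis using drift_comb_tail[OF assms(2), of l y u w] by (simp add: \<mu>_def)
qed

text \<open>At this level the Gaussian exponent is T N times ln (ln N), and T tends to L = (s +
  \<epsilon>)^2 / s^2 > 1 with s = \<open>sigma u w\<close>. Half of the excess L - 1 is kept as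
  \<open>\<kappa>\<close>, which leaves a power of ln N that is summable along geometric
  sequences.\<close>

lemma drift_comb_tail_lil:
  assumes s: "0 < sigma u w" and e: "0 < \<epsilon>"
  obtains \<kappa> where "0 < \<kappa>"
    "\<forall>\<^sub>F N in sequentially. prob {\<omega> \<in> space M. \<exists>k\<in>{1..N}. (sigma u w + \<epsilon>) * lil_scale N \<le> drift_comb u w k N \<omega>}
       \<le> ln (real N) powr - (1 + \<kappa>)"
proof -
  let ?s = "sigma u w"
  define \<mu> where "\<mu> = (\<lambda>N. \<bar>u\<bar> * drift_prod (2 * p - 1) 1 N + \<bar>w\<bar> * drift_prod (2 * p' - 1) 1 N)"
  define T where "T = (\<lambda>N. ((?s + \<epsilon>) * sqrt 2 - \<mu> N / sqrt (real N) / sqrt (ln (ln (real N))))^2 / (2 * (comb_var u w 1 N / real N)))"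
  define L where "L = (?s + \<epsilon>)^2 / ?s^2"
  have mu0: "(\<lambda>N. \<mu> N / sqrt (real N)) \<longlonglongrightarrow> 0"
  proof -
    have "(\<lambda>N. \<bar>u\<bar> * (drift_prod (2 * p - 1) 1 N / sqrt (real N)) + \<bar>w\<bar> * (drift_prod (2 * p' - 1) 1 N / sqrt (real N)))
       \<longlonglongrightarrow> \<bar>u\<bar> * 0 + \<bar>w\<bar> * 0"
      by (intro tendsto_intros drift_prod_over_sqrt_tendsto) (use p in auto)
    then show ?thesis by (simp add: \<mu>_def add_divide_distrib)
  qed
  have L0: "(\<lambda>N. inverse (sqrt (ln (ln (real N))))) \<longlonglongrightarrow> 0" by real_asymp
  have "(\<lambda>N. \<mu> N / sqrt (real N) / sqrt (ln (ln (real N)))) \<longlonglongrightarrow> 0"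
    using tendsto_mult[OF mu0 L0] by (simp add: divide_inverse)
  then have "T \<longlonglongrightarrow> ((?s + \<epsilon>) * sqrt 2 - 0)^2 / (2 * ?s^2)"
    unfolding T_def by (intro tendsto_intros comb_var_tendsto) (use s in auto)
  then have T: "T \<longlonglongrightarrow> L" by (simp add: L_def power_mult_distrib)
  have "1 < L"
  proof -
    have "?s^2 < (?s + \<epsilon>)^2" using s e by (intro power_strict_mono) auto
    then show ?thesis using s by (simp add: L_def)
  qed
  define \<kappa> where "\<kappa> = (L - 1) / 2"
  have k: "0 < \<kappa>" "1 + \<kappa> < L" using \<open>1 < L\<close> by (auto simp: \<kappa>_def field_simps)
  have mu1: "\<forall>\<^sub>F N in sequentially. \<mu> N / sqrt (real N) < ?s"
    by (rule order_tendstoD(2)[OF mu0 s])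
  have Q1: "\<forall>\<^sub>F N in sequentially. 0 < comb_var u w 1 N / real N"
    by (rule order_tendstoD(1)[OF comb_var_tendsto]) (use s in simp)
  have "\<forall>\<^sub>F N in sequentially. prob {\<omega> \<in> space M. \<exists>k\<in>{1..N}. (?s + \<epsilon>) * lil_scale N \<le> drift_comb u w k N \<omega>}
       \<le> ln (real N) powr - (1 + \<kappa>)"
    using order_tendstoD(1)[OF T k(2)] mu1 Q1 eventually_lil_pos eventually_ge_at_top[of 3]
  proof eventually_elim
    case (elim N)
    let ?L = "ln (ln (real N))" and ?Q = "comb_var u w 1 N"
    have N: "0 < real N" using elim by simp
    have Q: "0 < ?Q" using elim N by (simp add: zero_less_divide_iff)
    have sc: "lil_scale N = sqrt 2 * sqrt (real N) * sqrt ?L" by (simp add: lil_scale_def real_sqrt_mult)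
    have "\<mu> N < ?s * sqrt (real N)" using elim N by (simp add: field_simps)
    also have "\<dots> \<le> (?s + \<epsilon>) * lil_scale N"
    proof -
      have "1 * sqrt (real N) * 1 \<le> sqrt 2 * sqrt (real N) * sqrt ?L"
        using elim by (intro mult_mono) auto
      then have "?s * sqrt (real N) \<le> ?s * lil_scale N" using s unfolding sc by simp
      also have "\<dots> \<le> (?s + \<epsilon>) * lil_scale N"
        using e elim by (intro mult_right_mono lil_scale_nonneg) auto
      finally show ?thesis .
    qed
    finally have y: "\<mu> N < (?s + \<epsilon>) * lil_scale N" .
    have "((?s + \<epsilon>) * lil_scale N - \<mu> N)^2 / (2 * ?Q) = T N * ?L"
    proof -
      have "(?s + \<epsilon>) * lil_scale N - \<mu> N = (sqrt (real N) * sqrt ?L) * ((?s + \<epsilon>) * sqrt 2 - \<mu> N / sqrt (real N) / sqrt ?L)"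
      proof -
        have "b * (sqrt 2 * x * z) - m = (x * z) * (b * sqrt 2 - m / x / z)" if "0 < x" "0 < z" for b x z m :: real
          using that by (simp add: field_simps)
        moreover have "0 < sqrt ?L" unfolding real_sqrt_gt_0_iff using elim by linarith
        ultimately show ?thesis using N unfolding sc by simp
      qed
      then have "((?s + \<epsilon>) * lil_scale N - \<mu> N)^2 = (real N * ?L) * ((?s + \<epsilon>) * sqrt 2 - \<mu> N / sqrt (real N) / sqrt ?L)^2"
      proof -
        have "0 \<le> ?L" using elim by linarith
        then show ?thesis using N \<open>(?s + \<epsilon>) * lil_scale N - \<mu> N = _\<close> by (simp only: power_mult_distrib real_sqrt_pow2 of_nat_0_le_iff)
      qed
      then show ?thesis using N Q by (simp add: T_def)
    qed
    moreover have "(1 + \<kappa>) * ?L \<le> T N * ?L" using elim by (intro mult_right_mono) linarith+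
    ultimately have "exp (- (((?s + \<epsilon>) * lil_scale N - \<mu> N)^2 / (2 * ?Q))) \<le> exp (- ((1 + \<kappa>) * ?L))" by simp
    also have "\<dots> = ln (real N) powr - (1 + \<kappa>)"
    proof -
      have "0 < ln (real N)" using elim by simp
      then show ?thesis by (simp add: powr_def algebra_simps)
    qed
    finally show ?case
      using drift_comb_tail_gaussian[of N u w "(?s + \<epsilon>) * lil_scale N"] y Q elim
      by (simp add: \<mu>_def)
  qed
  with k show thesis using that by blast
qed

text \<open>Along the sequence ln N is at least j ln \<rho>, so the tail probabilities are dominated
  by a multiple of j^(-1-\<kappa>) and Borel--Cantelli applies.\<close>

lemma AE_drift_comb_less:
  fixes \<rho> \<epsilon> :: real
  assumes s: "0 < sigma u w" and e: "0 < \<epsilon>" and \<rho>: "1 < \<rho>"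
  shows "AE \<omega> in M. \<forall>\<^sub>F j in sequentially. \<forall>k\<in>{1..nat \<lceil>\<rho> ^ j\<rceil>}.
    drift_comb u w k (nat \<lceil>\<rho> ^ j\<rceil>) \<omega> < (sigma u w + \<epsilon>) * lil_scale (nat \<lceil>\<rho> ^ j\<rceil>)"
proof -
  define N where "N = (\<lambda>j::nat. nat \<lceil>\<rho> ^ j\<rceil>)"
  have N: "\<rho> ^ j \<le> real (N j)" for j unfolding N_def by linarith
  have Ntop: "filterlim N sequentially sequentially"
    unfolding N_def using \<rho> by real_asymp
  let ?A = "\<lambda>N. {\<omega> \<in> space M. \<exists>k\<in>{1..N}. (sigma u w + \<epsilon>) * lil_scale N \<le> drift_comb u w k N \<omega>}"
  obtain \<kappa> where k: "0 < \<kappa>" "\<forall>\<^sub>F N in sequentially. prob (?A N) \<le> ln (real N) powr - (1 + \<kappa>)"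
    using drift_comb_tail_lil[OF s e] by blast
  have ev: "?A N \<in> events" for N by measurable
  have sum: "summable (\<lambda>j. prob (?A (N j)))"
  proof (rule summable_comparison_test_ev)
    show "\<forall>\<^sub>F j in sequentially. norm (prob (?A (N j))) \<le> ln \<rho> powr - (1 + \<kappa>) * real j powr - (1 + \<kappa>)"
      using eventually_compose_filterlim[OF k(2) Ntop] eventually_ge_at_top[of 1]
    proof eventually_elim
      case (elim j)
      have "real j * ln \<rho> = ln (\<rho> ^ j)" using \<rho> by (simp add: ln_realpow)
      also have "\<dots> \<le> ln (real (N j))" using N[of j] \<rho> by (intro ln_mono) auto
      finally have "ln (real (N j)) powr - (1 + \<kappa>) \<le> (real j * ln \<rho>) powr - (1 + \<kappa>)"
        using \<rho> k elim by (intro powr_mono2') auto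
      also have "\<dots> = ln \<rho> powr - (1 + \<kappa>) * real j powr - (1 + \<kappa>)"
        using \<rho> by (simp add: powr_mult)
      finally show ?case using elim by simp
    qed
    show "summable (\<lambda>j. ln \<rho> powr - (1 + \<kappa>) * real j powr - (1 + \<kappa>))"
      by (intro summable_mult) (use k in \<open>simp add: summable_real_powr_iff\<close>)
  qed
  have "AE \<omega> in M. \<forall>\<^sub>F j in sequentially. \<omega> \<in> space M - ?A (N j)"
    by (rule borel_cantelli_AE1[OF ev _ sum]) (simp add: less_top[symmetric])
  then show ?thesis
  proof eventually_elim
    case (elim \<omega>)
    then show ?case by eventually_elim (auto simp: N_def not_le)
  qed
qed

text \<open>Interpolation: eventually every \<open>n\<close> lies below a geometric time
  \<open>m\<close> with m \<le> \<rho>^2 n. The martingale for horizon \<open>m\<close>, taken at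
  time \<open>n\<close>, weights the two walks by different drift products, so it is not a multiple
  of \<open>comb u w n\<close>. Both weights are close to 1 for \<rho> close to 1, and the
  single-walk bounds make the resulting error small against \<open>lil_scale m\<close>.\<close>

lemma AE_comb_le:
  assumes s: "0 < sigma u w" and e: "0 < \<epsilon>"
  shows "AE \<omega> in M. \<forall>\<^sub>F n in sequentially. comb u w n \<omega> \<le> (sigma u w + \<epsilon>) * lil_scale n"
proof -
  let ?s = "sigma u w" and ?a = "2 * p - 1" and ?a' = "2 * p' - 1"
  \<comment> \<open>Dominates both single-walk constants \<open>sigma 1 0 + 1\<close> and
    \<open>sigma 0 1 + 1\<close>.\<close>
  define C where "C = sigma 1 0 + sigma 0 1 + 1"
  have s10: "0 < sigma 1 0" "0 < sigma (-1) 0" "0 < sigma 0 1" "0 < sigma 0 (-1)"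
    "sigma (-1) 0 = sigma 1 0" "sigma 0 (-1) = sigma 0 1"
    using p by (auto simp: sigma_def)
  \<comment> \<open>The distance of 1 / \<open>drift_prod b n m\<close> from 1 when m \<le> \<rho>^2
    n, obtained from the exponential bounds with exponent 2 (m - n) / n.\<close>
  define \<tau> where "\<tau> = (\<lambda>\<rho>::real. exp (2 * (\<rho>^2 - 1)) - 1)"
  have "((\<lambda>\<rho>. (\<bar>u\<bar> + \<bar>w\<bar>) * \<tau> \<rho> * C) \<longlongrightarrow> (\<bar>u\<bar> + \<bar>w\<bar>) * (exp (2 * (1^2 - 1)) - 1) * C) (at_right 1)"
    unfolding \<tau>_def by (intro tendsto_intros)
  then have "\<forall>\<^sub>F \<rho> in at_right 1. (\<bar>u\<bar> + \<bar>w\<bar>) * \<tau> \<rho> * C < \<epsilon> / 4"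
    by (rule order_tendstoD) (use e in simp)
  moreover have "((\<lambda>\<rho>. \<rho>^2 * (?s + \<epsilon> / 2)) \<longlongrightarrow> 1^2 * (?s + \<epsilon> / 2)) (at_right 1)"
    by (intro tendsto_intros)
  then have "\<forall>\<^sub>F \<rho> in at_right 1. \<rho>^2 * (?s + \<epsilon> / 2) < ?s + \<epsilon>"
    by (rule order_tendstoD) (use e in simp)
  moreover have "\<forall>\<^sub>F \<rho> in at_right 1. (1::real) < \<rho>" by (simp add: eventually_at_right_less)
  ultimately have "\<forall>\<^sub>F \<rho> in at_right 1. 1 < \<rho> \<and> (\<bar>u\<bar> + \<bar>w\<bar>) * \<tau> \<rho> * C < \<epsilon> / 4 \<and> \<rho>^2 * (?s + \<epsilon> / 2) < ?s + \<epsilon>"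
    by eventually_elim auto
  then obtain \<rho> where r: "1 < \<rho>" "(\<bar>u\<bar> + \<bar>w\<bar>) * \<tau> \<rho> * C < \<epsilon> / 4" "\<rho>^2 * (?s + \<epsilon> / 2) < ?s + \<epsilon>"
    using eventually_happens'[of "at_right (1::real)"] by (auto simp: trivial_limit_at_right_real)
  define N where "N = (\<lambda>j::nat. nat \<lceil>\<rho> ^ j\<rceil>)"
  define J where "J = (\<lambda>n::nat. nat \<lceil>log \<rho> (real n)\<rceil>)"
  have Jtop: "filterlim J sequentially sequentially"
    unfolding J_def using r(1) by real_asymp
  have LL: "\<forall>\<^sub>F n in sequentially. ln (ln (\<rho>^2 * real n)) \<le> \<rho>^2 * ln (ln (real n))"
    by (rule eventually_ln_ln_mult_le) (use r(1) in simp)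
  \<comment> \<open>The slack between \<rho> and \<rho>^2 absorbs the rounding up in
    \<open>N\<close>.\<close>
  have rn: "\<forall>\<^sub>F n in sequentially. \<rho> * real n + 1 \<le> \<rho>^2 * real n"
  proof -
    have "\<rho> < \<rho>^2" using r(1) by (simp add: power2_eq_square)
    then show ?thesis by real_asymp
  qed
  have AE1: "AE \<omega> in M. \<forall>\<^sub>F n in sequentially. \<forall>k\<in>{1..N (J n)}.
      drift_comb u' w' k (N (J n)) \<omega> < (sigma u' w' + d) * lil_scale (N (J n))"
    if "0 < sigma u' w'" "0 < d" for u' w' d
    using AE_drift_comb_less[OF that r(1)]
    by eventually_elim (use eventually_compose_filterlim[OF _ Jtop] in \<open>simp add: N_def\<close>)
  have e4: "0 < \<epsilon> / 4" using e by simp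
  show ?thesis
    using AE1[OF s e4] AE1[OF s10(1) zero_less_one] AE1[OF s10(2) zero_less_one]
      AE1[OF s10(3) zero_less_one] AE1[OF s10(4) zero_less_one]
  proof eventually_elim
    case (elim \<omega>)
    show ?case using elim LL rn eventually_lil_pos eventually_ge_at_top[of 3]
    proof eventually_elim
      case (elim n)
      define m where "m = N (J n)"
      have n: "3 \<le> n" using elim by simp
      have nm: "n \<le> m"
      proof -
        have "log \<rho> (real n) \<le> real (J n)" unfolding J_def by linarith
        then have "real n \<le> \<rho> powr real (J n)" using r(1) n by (simp add: log_le_iff)
        also have "\<dots> = \<rho> ^ J n" using r(1) by (simp add: powr_realpow)
        also have "\<dots> \<le> real m" unfolding m_def N_def by linarith
        finally show ?thesis by simp
      qed
      have mn: "real m \<le> \<rho>^2 * real n"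
      proof -
        have "0 \<le> log \<rho> (real n)" using r(1) n by simp
        then have "real (J n) \<le> log \<rho> (real n) + 1" unfolding J_def by linarith
        then have "\<rho> powr real (J n) \<le> \<rho> powr (log \<rho> (real n) + 1)" using r(1) by (intro powr_mono) auto
        also have "\<dots> = \<rho> * real n" using r(1) n by (simp add: powr_add)
        finally have "\<rho> ^ J n \<le> \<rho> * real n" using r(1) by (simp add: powr_realpow)
        moreover have "real m \<le> \<rho> ^ J n + 1"
        proof -
          have "0 \<le> \<rho> ^ J n" using r(1) by simp
          then show ?thesis unfolding m_def N_def by linarith
        qed
        ultimately show ?thesis using elim by linarith
      qed
      have nin: "n \<in> {1..m}" using n nm by simp
      have Bb: "\<bar>1 / drift_prod b n m - 1\<bar> \<le> \<tau> \<rho>" "0 < drift_prod b n m" if b: "-1 < b" "b < 1" for b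
      proof -
        let ?x = "2 * (real m - real n) / real n"
        have x: "?x \<le> 2 * (\<rho>^2 - 1)" using mn n by (simp add: field_simps)
        show B0: "0 < drift_prod b n m" using b n by (intro drift_prod_pos) auto
        have lo: "exp (- ?x) \<le> drift_prod b n m" 
        proof -
          have "- 2 * (real m - real n) / real n = - ?x" using n by (simp add: field_simps)
          then show ?thesis using drift_prod_near_one[OF b, of n m] n nm by simp
        qed
        have hi: "drift_prod b n m \<le> exp ?x" using drift_prod_near_one_le[OF b, of n m] n nm by simp
        have "1 / drift_prod b n m \<le> 1 / exp (- ?x)" using lo B0 by (intro divide_left_mono) auto
        also have "\<dots> = exp ?x" by (simp add: exp_minus field_simps)
        also have "\<dots> \<le> exp (2 * (\<rho>^2 - 1))" using x by simp
        finally have 1: "1 / drift_prod b n m - 1 \<le> \<tau> \<rho>" by (simp add: \<tau>_def)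
        have "1 / exp ?x \<le> 1 / drift_prod b n m" using hi B0 by (intro divide_left_mono) auto
        moreover have "1 - \<tau> \<rho> \<le> 1 / exp ?x"
        proof -
          define z where "z = exp (2 * (\<rho>^2 - 1))"
          have z: "1 \<le> z" using r(1) by (simp add: z_def)
          \<comment> \<open>Equivalent to (z - 1)^2 \<ge> 0.\<close>
          have "2 - z \<le> 1 / z" using z sum_squares_ge_zero[of "z - 1" 0] by (simp add: field_simps)
          also have "\<dots> \<le> 1 / exp ?x" using x z by (intro divide_left_mono) (auto simp: z_def)
          finally show ?thesis by (simp add: \<tau>_def z_def)
        qed
        ultimately show "\<bar>1 / drift_prod b n m - 1\<bar> \<le> \<tau> \<rho>" using 1 by linarith
      qed
      let ?B = "drift_prod ?a n m" and ?B' = "drift_prod ?a' n m"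
      let ?x = "real_of_int (walk X n \<omega>)" and ?y = "real_of_int (walk Y n \<omega>)"
      have sc0: "0 \<le> lil_scale m"
      proof -
        have "1 < ln (real n)" 
        proof -
          have "0 < ln (real n)" using n by simp
          moreover have "0 < ln (ln (real n))" using elim by linarith
          ultimately show ?thesis using ln_gt_zero_iff by blast
        qed
        also have "\<dots> \<le> ln (real m)" using n nm by simp
        finally show ?thesis by (simp add: lil_scale_def)
      qed
      have C: "\<bar>?B * ?x\<bar> \<le> C * lil_scale m" "\<bar>?B' * ?y\<bar> \<le> C * lil_scale m"
      proof -
        have le: "(sigma 1 0 + 1) * lil_scale m \<le> C * lil_scale m" "(sigma 0 1 + 1) * lil_scale m \<le> C * lil_scale m"
          unfolding C_def using sc0 s10 by (auto intro!: mult_right_mono)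
        have "?B * ?x < (sigma 1 0 + 1) * lil_scale m" "- (?B * ?x) < (sigma 1 0 + 1) * lil_scale m"
          "?B' * ?y < (sigma 0 1 + 1) * lil_scale m" "- (?B' * ?y) < (sigma 0 1 + 1) * lil_scale m"
          using elim nin s10(5,6) unfolding m_def[symmetric] by (auto simp: drift_comb_def)
        then show "\<bar>?B * ?x\<bar> \<le> C * lil_scale m" "\<bar>?B' * ?y\<bar> \<le> C * lil_scale m" using le by linarith+
      qed
      have B: "\<bar>1 / ?B - 1\<bar> \<le> \<tau> \<rho>" "0 < ?B" "\<bar>1 / ?B' - 1\<bar> \<le> \<tau> \<rho>" "0 < ?B'"
        using Bb[of ?a] Bb[of ?a'] p by auto
      have "comb u w n \<omega> = drift_comb u w n m \<omega> + (u * ((1 / ?B - 1) * (?B * ?x)) + w * ((1 / ?B' - 1) * (?B' * ?y)))"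
        using B by (simp add: comb_def drift_comb_def field_simps)
      also have "\<dots> \<le> (?s + \<epsilon> / 4) * lil_scale m + (\<bar>u\<bar> * (\<tau> \<rho> * (C * lil_scale m)) + \<bar>w\<bar> * (\<tau> \<rho> * (C * lil_scale m)))"
      proof (intro add_mono)
        show "drift_comb u w n m \<omega> \<le> (?s + \<epsilon> / 4) * lil_scale m"
          using elim nin unfolding m_def[symmetric] by (simp add: less_imp_le)
        have "\<bar>u * ((1 / ?B - 1) * (?B * ?x))\<bar> \<le> \<bar>u\<bar> * (\<tau> \<rho> * (C * lil_scale m))"
          unfolding abs_mult[of u] abs_mult[of "1 / ?B - 1"] using B C by (intro mult_left_mono mult_mono) auto
        then show "u * ((1 / ?B - 1) * (?B * ?x)) \<le> \<bar>u\<bar> * (\<tau> \<rho> * (C * lil_scale m))" by linarith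
        have "\<bar>w * ((1 / ?B' - 1) * (?B' * ?y))\<bar> \<le> \<bar>w\<bar> * (\<tau> \<rho> * (C * lil_scale m))"
          unfolding abs_mult[of w] abs_mult[of "1 / ?B' - 1"] using B C by (intro mult_left_mono mult_mono) auto
        then show "w * ((1 / ?B' - 1) * (?B' * ?y)) \<le> \<bar>w\<bar> * (\<tau> \<rho> * (C * lil_scale m))" by linarith
      qed
      also have "\<dots> = ((?s + \<epsilon> / 4) + (\<bar>u\<bar> + \<bar>w\<bar>) * \<tau> \<rho> * C) * lil_scale m" by (simp add: algebra_simps)
      also have "\<dots> \<le> (?s + \<epsilon> / 2) * lil_scale m" using r(2) sc0 by (intro mult_right_mono) auto
      also have "\<dots> \<le> (?s + \<epsilon> / 2) * (\<rho>^2 * lil_scale n)"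
      proof (intro mult_left_mono)
        have "0 < ln (real n)" using n by simp
        then have "ln (ln (real m)) \<le> ln (ln (\<rho>^2 * real n))"
          using mn n nm r(1) by (intro ln_mono) auto
        also have "\<dots> \<le> \<rho>^2 * ln (ln (real n))" using elim by simp
        finally have "2 * real m * ln (ln (real m)) \<le> 2 * (\<rho>^2 * real n) * (\<rho>^2 * ln (ln (real n)))"
          using mn elim sc0 n nm by (intro mult_mono) (auto simp: lil_scale_def zero_le_mult_iff)
        then have "lil_scale m \<le> sqrt ((\<rho>^2)^2 * (2 * real n * ln (ln (real n))))"
          unfolding lil_scale_def by (intro real_sqrt_le_mono) (simp add: power2_eq_square mult_ac)
        also have "\<dots> = \<rho>^2 * lil_scale n" 
          unfolding real_sqrt_mult[of "(\<rho>^2)^2"] real_sqrt_abs lil_scale_def by simp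
        finally show "lil_scale m \<le> \<rho>^2 * lil_scale n" .
      qed (use s e in auto)
      also have "\<dots> = (\<rho>^2 * (?s + \<epsilon> / 2)) * lil_scale n" by simp
      also have "\<dots> \<le> (?s + \<epsilon>) * lil_scale n"
        using r(3) elim by (intro mult_right_mono lil_scale_nonneg) auto
      finally show ?case .
    qed
  qed
qed

end

subsection \<open>Lower bound\<close>

text \<open>A block event has to be a function of the whole path and therefore re-reads its starting
  point by truncation. Appending steps does not change that prefix, so given \<open>h\<close> it may
  be replaced by the prefix of \<open>h\<close>.\<close>

lemma path_exp_take:
  assumes "m \<le> length h"
  shows "path_exp p r h (\<lambda>g. F (take m g) g) = path_exp p r h (\<lambda>g. F (take m h) g)"
  using assms
proof (induction r arbitrary: h)
  case (Suc r)
  have "path_exp p r (h @ [x]) (\<lambda>g. F (take m g) g) = path_exp p r (h @ [x]) (\<lambda>g. F (take m h) g)" for x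
    using Suc.IH[of "h @ [x]"] Suc.prems by simp
  then show ?case by simp
qed simp

lemma path_exp_nonneg:
  assumes "0 \<le> p" "p \<le> 1" "pm_list h" "\<And>g. 0 \<le> F g"
  shows "0 \<le> path_exp p r h F"
  using path_exp_mono[of p h r "\<lambda>_. 0" F] assms by (simp add: path_exp_const)

lemma path_exp_prod:
  "path_exp p r h (\<lambda>g. path_exp p' r' h' (\<lambda>g'. F g * G g')) = path_exp p r h F * path_exp p' r' h' G"
  by (simp add: path_exp_cmult) (simp add: path_exp_cmult mult.commute[of "F _"] mult.commute[of "path_exp p r h F"])

lemma filterlim_fact: "filterlim (\<lambda>j. fact (Suc j) :: nat) at_top sequentially"
proof (rule filterlim_at_top_mono[OF filterlim_Suc])
  show "\<forall>\<^sub>F j in sequentially. Suc j \<le> fact (Suc j)"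
    by (intro always_eventually allI fact_ge_self)
qed

text \<open>The ratio x = (j + 1)/K of the end to the start of the block tends to infinity, and the
  variance lost before the start has relative size of order at most x^(2a - 1), which tends to
  0.\<close>

lemma var_sum_fact_tendsto:
  assumes a: "-1 < a" "a < 1/2" and K: "1 \<le> K"
  shows "(\<lambda>j. var_sum a (K * fact j) (fact (Suc j)) / real (fact (Suc j))) \<longlonglongrightarrow> 1 / (1 - 2 * a)"
proof -
  let ?c = "1 / (1 - 2 * a)"
  let ?l = "\<lambda>j. ?c - ?c * exp 1 ^ 2 * (real (Suc j) / real K) powr (2 * a - 1)"
  let ?u = "\<lambda>j. var_sum a 1 (fact (Suc j)) / real (fact (Suc j))"
  show ?thesis
  proof (rule tendsto_sandwich[where f = ?l and h = ?u])
  show "\<forall>\<^sub>F j in sequentially. var_sum a (K * fact j) (fact (Suc j)) / real (fact (Suc j))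
     \<le> var_sum a 1 (fact (Suc j)) / real (fact (Suc j))"
    using K by (intro always_eventually allI divide_right_mono var_sum_antimono) (auto simp: Suc_le_eq)
  show "(\<lambda>j. var_sum a 1 (fact (Suc j)) / real (fact (Suc j))) \<longlonglongrightarrow> ?c"
    by (rule filterlim_compose[OF var_sum_tendsto[OF a] filterlim_fact])
  have "filterlim (\<lambda>j. real (Suc j) / real K) at_top sequentially" using K by real_asymp
  then have "?l \<longlonglongrightarrow> ?c - ?c * exp 1 ^ 2 * 0"
    by (intro tendsto_intros tendsto_neg_powr) (use a in auto)
  then show "?l \<longlonglongrightarrow> ?c" by simp
  show "\<forall>\<^sub>F j in sequentially. ?l j \<le> var_sum a (K * fact j) (fact (Suc j)) / real (fact (Suc j))"
    using eventually_ge_at_top[of K]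
  proof eventually_elim
    case (elim j)
    define n where "n = K * fact j"
    define N where "N = (fact (Suc j) :: nat)"
    define x where "x = real (Suc j) / real K"
    have n1: "1 \<le> n" using K by (simp add: n_def Suc_le_eq)
    have N1: "1 \<le> N" by (simp add: N_def Suc_le_eq)
    have nN: "n \<le> N" unfolding n_def N_def fact_Suc of_nat_id by (rule mult_le_mono1) (use elim in simp)
    have x0: "0 < x" using K by (simp add: x_def)
    have q: "real N / real n = x" using K by (simp add: n_def N_def x_def field_simps)
    have "(drift_prod a n N)^2 \<le> (exp 1 * x powr a)^2"
      using drift_prod_le_powr[OF a(1) _ n1 nN] a drift_prod_pos[OF a(1) n1, of N]
      unfolding q by (intro power_mono) auto
    also have "\<dots> = exp 1 ^ 2 * x powr (2 * a)" using x0 by (simp add: power_mult_distrib powr_power)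
    finally have "real n * (drift_prod a n N)^2 / (1 - 2 * a) \<le> real n * (exp 1 ^ 2 * x powr (2 * a)) / (1 - 2 * a)"
      using a by (intro divide_right_mono mult_left_mono) auto
    then have "real N / (1 - 2 * a) - real n * (exp 1 ^ 2 * x powr (2 * a)) / (1 - 2 * a) \<le> var_sum a n N"
      using var_sum_ge[OF a(2) n1 nN] by linarith
    then have "(real N / (1 - 2 * a) - real n * (exp 1 ^ 2 * x powr (2 * a)) / (1 - 2 * a)) / real N \<le> var_sum a n N / real N"
      by (intro divide_right_mono) auto
    moreover have "(real N / (1 - 2 * a) - real n * (exp 1 ^ 2 * x powr (2 * a)) / (1 - 2 * a)) / real N
       = ?c - ?c * exp 1 ^ 2 * x powr (2 * a - 1)"
    proof -
      have "real n = real N / x" using q n1 N1 x0 by (auto simp: field_simps)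
      then show ?thesis using N1 x0 by (simp add: powr_diff diff_divide_distrib)
    qed
    ultimately show ?case by (simp add: n_def N_def x_def)
  qed
qed
qed

text \<open>By the upper bound a walk at time \<open>fact j\<close> is at most of order
  \<open>lil_scale (fact j)\<close>. What remains of it at the next factorial is relatively at most
  of order (j + 1)^(a - 1/2), hence negligible.\<close>

lemma drift_prod_lil_scale_fact_tendsto:
  assumes a: "-1 < a" "a < 1/2"
  shows "(\<lambda>j. drift_prod a (fact j) (fact (Suc j)) * lil_scale (fact j) / lil_scale (fact (Suc j))) \<longlonglongrightarrow> 0"
proof (rule tendsto_sandwich)
  let ?u = "\<lambda>j. exp 1 * real (Suc j) powr (a - 1/2)"
  have ftop: "filterlim (\<lambda>j. fact j :: nat) at_top sequentially"
    by (rule filterlim_at_top_mono[OF filterlim_ident]) (intro always_eventually allI fact_ge_self)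
  have ev: "\<forall>\<^sub>F j in sequentially. 1 \<le> ln (ln (real (fact j :: nat)))"
    by (rule eventually_compose_filterlim[OF eventually_lil_pos ftop])
  have *: "0 \<le> drift_prod a (fact j) (fact (Suc j)) * lil_scale (fact j) / lil_scale (fact (Suc j)) \<and>
    drift_prod a (fact j) (fact (Suc j)) * lil_scale (fact j) / lil_scale (fact (Suc j)) \<le> ?u j"
    if L: "1 \<le> ln (ln (real (fact j :: nat)))" and j: "3 \<le> j" for j
  proof -
    define m where "m = (fact j :: nat)"
    define N where "N = (fact (Suc j) :: nat)"
    define x where "x = real (Suc j)"
    have m: "3 \<le> m" using fact_ge_self[of j] j unfolding m_def by linarith
    have N: "real N = x * real m" by (simp add: N_def m_def x_def algebra_simps)
    have mN: "m \<le> N" by (simp add: N_def m_def)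
    have x: "1 \<le> x" by (simp add: x_def)
    have lm: "0 < ln (real m)" using m by simp
    have LL: "ln (ln (real m)) \<le> ln (ln (real N))" using m mN lm by (intro ln_mono) auto
    have sm: "0 < lil_scale m" "0 < lil_scale N"
    proof -
      have "0 < ln (ln (real m))" "0 < ln (ln (real N))" using L LL unfolding m_def[symmetric] by linarith+
      then show "0 < lil_scale m" "0 < lil_scale N" using m mN unfolding lil_scale_def
        by (auto simp del: ln_gt_zero_iff)
    qed
    have B0: "0 < drift_prod a m N" using a m by (intro drift_prod_pos) auto
    have "lil_scale m \<le> lil_scale N / sqrt x"
    proof -
      have "sqrt x * lil_scale m = sqrt (x * (2 * real m * ln (ln (real m))))"
        by (simp add: lil_scale_def real_sqrt_mult)
      also have "\<dots> \<le> lil_scale N"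
        unfolding lil_scale_def N using LL x L m unfolding N
        by (intro real_sqrt_le_mono) (simp add: mult_ac mult_left_mono)
      finally show ?thesis using x by (simp add: field_simps)
    qed
    moreover have "drift_prod a m N \<le> exp 1 * x powr a"
    proof -
      have "real N / real m = x" using N m by simp
      then show ?thesis using drift_prod_le_powr[OF a(1) _ _ mN] a m by simp
    qed
    ultimately have "drift_prod a m N * lil_scale m \<le> exp 1 * x powr a * (lil_scale N / sqrt x)"
      using B0 sm by (intro mult_mono) auto
    then have "drift_prod a m N * lil_scale m / lil_scale N \<le> exp 1 * x powr a * (lil_scale N / sqrt x) / lil_scale N"
      using sm by (intro divide_right_mono) auto
    also have "\<dots> = exp 1 * x powr (a - 1/2)" using sm x by (simp add: powr_diff powr_half_sqrt)
    finally have "drift_prod a m N * lil_scale m / lil_scale N \<le> exp 1 * x powr (a - 1/2)" .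
    moreover have "0 \<le> drift_prod a m N * lil_scale m / lil_scale N" using B0 sm by simp
    ultimately show ?thesis by (simp add: m_def N_def x_def)
  qed
  show "\<forall>\<^sub>F j in sequentially. 0 \<le> drift_prod a (fact j) (fact (Suc j)) * lil_scale (fact j) / lil_scale (fact (Suc j))"
    using ev eventually_ge_at_top[of 3] by eventually_elim (use * in blast)
  show "\<forall>\<^sub>F j in sequentially. drift_prod a (fact j) (fact (Suc j)) * lil_scale (fact j) / lil_scale (fact (Suc j)) \<le> ?u j"
    using ev eventually_ge_at_top[of 3] by eventually_elim (use * in blast)
  have "filterlim (\<lambda>j. real (Suc j)) at_top sequentially" by real_asymp
  then have "?u \<longlonglongrightarrow> exp 1 * 0"
    by (intro tendsto_intros tendsto_neg_powr) (use a in auto)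
  then show "?u \<longlonglongrightarrow> 0" by simp
qed simp

text \<open>From n! \<le> n^n. The bound is ln (j + 1) up to an iterated logarithm, which any factor
  \<kappa> < 1 in front absorbs.\<close>

lemma ln_ln_fact_le:
  assumes "3 \<le> j"
  shows "ln (ln (real (fact (Suc j)))) \<le> ln (real (Suc j) * ln (real (Suc j)))"
proof -
  have "(3::nat) \<le> fact (Suc j)" using fact_ge_self[of "Suc j"] assms by linarith
  then have f3: "3 \<le> real (fact (Suc j) :: nat)" by (metis of_nat_le_iff of_nat_numeral)
  have "real (fact (Suc j) :: nat) \<le> real (Suc j) ^ Suc j"
    using fact_le_power[of "Suc j", where 'a = nat] by (metis of_nat_le_iff of_nat_power of_nat_id order_refl)
  then have "ln (real (fact (Suc j) :: nat)) \<le> ln (real (Suc j) ^ Suc j)" using f3 by (intro ln_mono) auto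
  also have "\<dots> = real (Suc j) * ln (real (Suc j))" by (subst ln_realpow) auto
  finally have "ln (real (fact (Suc j) :: nat)) \<le> real (Suc j) * ln (real (Suc j))" .
  moreover have "0 < ln (real (fact (Suc j) :: nat))" using f3 by (intro ln_gt_zero) auto
  ultimately show ?thesis by (intro ln_mono) auto
qed

section \<open>Block events along the factorials\<close>

context erw_pair
begin

lemma comb_var_fact_tendsto:
  assumes "1 \<le> K"
  shows "(\<lambda>j. comb_var u w (K * fact j) (fact (Suc j)) / real (fact (Suc j))) \<longlonglongrightarrow> (sigma u w)^2"
proof -
  have "(\<lambda>j. u^2 * (var_sum (2 * p - 1) (K * fact j) (fact (Suc j)) / real (fact (Suc j)))
       + w^2 * (var_sum (2 * p' - 1) (K * fact j) (fact (Suc j)) / real (fact (Suc j))))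
     \<longlonglongrightarrow> u^2 * (1 / (1 - 2 * (2 * p - 1))) + w^2 * (1 / (1 - 2 * (2 * p' - 1)))"
    by (intro tendsto_intros var_sum_fact_tendsto assms) (use p in auto)
  then show ?thesis by (simp only: comb_var_def sigma_sq add_divide_distrib) simp
qed

text \<open>Along \<open>fact j\<close> consecutive times have ratio tending to infinity, so a block forgets its past;
  yet \<open>ln (fact j)\<close> grows slowly enough for the block probabilities to exceed \<open>1 / (j + 1)\<close>, which
  makes the product of the failure probabilities telescope to \<open>0\<close>.\<close>

definition block_event :: "real \<Rightarrow> real \<Rightarrow> real \<Rightarrow> nat \<Rightarrow> int list \<times> int list \<Rightarrow> bool" where
  "block_event u w c j z \<longleftrightarrow> c * sigma u w * lil_scale (fact (Suc j)) \<le>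
     u * (endpoint (fst z) - drift_prod (2 * p - 1) (fact j) (fact (Suc j)) * endpoint (take (fact j) (fst z)))
     + w * (endpoint (snd z) - drift_prod (2 * p' - 1) (fact j) (fact (Suc j)) * endpoint (take (fact j) (snd z)))"

lemma block_mgf_eq:
  fixes r r' :: nat
  shows "path_exp p r h (\<lambda>g. path_exp p' r' h' (\<lambda>g'.
      exp (l * (u * (endpoint g - b * endpoint h) + w * (endpoint g' - b' * endpoint h')))))
   = exp (- (l * u) * b * endpoint h) * path_exp p r h (\<lambda>g. exp ((l * u) * endpoint g))
     * (exp (- (l * w) * b' * endpoint h') * path_exp p' r' h' (\<lambda>g'. exp ((l * w) * endpoint g')))"
proof -
  have "path_exp p r h (\<lambda>g. path_exp p' r' h' (\<lambda>g'.
      exp (l * (u * (endpoint g - b * endpoint h) + w * (endpoint g' - b' * endpoint h')))))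
   = path_exp p r h (\<lambda>g. path_exp p' r' h' (\<lambda>g'.
      (exp (- (l * u) * b * endpoint h) * exp ((l * u) * endpoint g)) *
      (exp (- (l * w) * b' * endpoint h') * exp ((l * w) * endpoint g'))))"
    by (simp add: algebra_simps flip: exp_add)
  also have "\<dots> = path_exp p r h (\<lambda>g. exp (- (l * u) * b * endpoint h) * exp ((l * u) * endpoint g))
     * path_exp p' r' h' (\<lambda>g'. exp (- (l * w) * b' * endpoint h') * exp ((l * w) * endpoint g'))"
    by (rule path_exp_prod)
  finally show ?thesis by (simp only: path_exp_cmult)
qed

text \<open>Tilting given an arbitrary history yields a block probability of at least exp (-\<kappa>
  ln (ln N)) / 2 with \<kappa> < 1. For N = (j + 1)! this is at least ((j + 1) ln (j +
  1))^(-\<kappa>) / 2, eventually above 1/(j + 1).\<close>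

lemma block_prob_ge:
  assumes s: "0 < sigma u w" and e: "0 < \<epsilon>" "\<epsilon> < 1"
  obtains J0 where "\<And>j h h'. J0 \<le> j \<Longrightarrow> pm_list h \<Longrightarrow> pm_list h' \<Longrightarrow> length h = fact j \<Longrightarrow> length h' = fact j \<Longrightarrow>
    1 / real (Suc j) \<le> path_exp p (fact (Suc j) - fact j) h
         (\<lambda>g. path_exp p' (fact (Suc j) - fact j) h' (\<lambda>g'. of_bool (block_event u w (1 - \<epsilon>) j (g, g'))))"
proof -
  note fact_Suc [simp del]
  let ?s = "sigma u w"
  let ?N = "\<lambda>j. fact (Suc j) :: nat"
  let ?L = "\<lambda>j. ln (ln (real (?N j)))"
  \<comment> \<open>\<open>\<beta>\<close> lowers the target of the tilt, \<open>\<delta>\<close> is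
    the width of the window around it, \<open>\<eta>\<close> the loss in the moment generating
    function. They are balanced so that (1 - \<delta>) \<beta> still exceeds 1 - \<epsilon>, while
    \<gamma> = 2 \<beta>^2 (1/2 + \<delta> + \<eta>/2), the cost in units of ln (ln N), stays below
    1.\<close>
  define \<beta> where "\<beta> = 1 - \<epsilon> / 2"
  define \<delta> where "\<delta> = \<epsilon> / 4"
  define \<eta> where "\<eta> = \<delta>^2 / 2"
  define \<gamma> where "\<gamma> = (1 + 2 * \<delta> + \<eta>) * \<beta>^2"
  define \<kappa> where "\<kappa> = (1 + \<gamma>) / 2"
  have b: "0 < \<beta>" using e by (simp add: \<beta>_def)
  have d: "0 < \<delta>" "\<delta> < 1" using e by (auto simp: \<delta>_def)
  have eta: "0 < \<eta>" "\<eta> < 1" "\<delta>^2 - \<eta> = \<delta>^2 / 2"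
    using d power_less_one_iff[of \<delta> 2] by (auto simp: \<eta>_def)
  have bd: "1 - \<epsilon> < (1 - \<delta>) * \<beta>"
  proof -
    have "(1 - \<delta>) * \<beta> = 1 - \<epsilon> + \<epsilon> / 4 + \<epsilon>^2 / 8"
      by (simp add: \<beta>_def \<delta>_def field_simps power2_eq_square)
    moreover have "0 < \<epsilon>^2" using e by simp
    ultimately show ?thesis using e by linarith
  qed
  have g: "0 < \<gamma>" "\<gamma> < 1"
  proof -
    show "0 < \<gamma>" using b d eta by (simp add: \<gamma>_def)
    have e2: "\<epsilon>^2 \<le> \<epsilon>" "0 \<le> \<epsilon>^2" using e by (auto simp: power2_eq_square)
    have b2: "\<beta>^2 \<le> 1 - 3 / 4 * \<epsilon>"
    proof -
      have "\<beta>^2 = 1 - \<epsilon> + \<epsilon>^2 / 4" by (simp add: \<beta>_def power2_eq_square field_simps)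
      then show ?thesis using e2 by simp
    qed
    have "\<eta> = \<epsilon>^2 / 32" by (simp add: \<eta>_def \<delta>_def power_divide)
    then have "1 + 2 * \<delta> + \<eta> \<le> 1 + 17 / 32 * \<epsilon>" using e2 by (simp add: \<delta>_def)
    then have "\<gamma> \<le> (1 + 17 / 32 * \<epsilon>) * (1 - 3 / 4 * \<epsilon>)"
      unfolding \<gamma>_def using b2 e by (intro mult_mono) auto
    also have "\<dots> = 1 - 7 / 32 * \<epsilon> - 51 / 128 * \<epsilon>^2" by (simp add: field_simps power2_eq_square)
    also have "\<dots> < 1" using e e2 by linarith
    finally show "\<gamma> < 1" .
  qed
  have k: "0 < \<kappa>" "\<kappa> < 1" "\<gamma> < \<kappa>" using g by (auto simp: \<kappa>_def field_simps)
  \<comment> \<open>Only half of \<eta> is spent on the moment generating function; the other half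
    pays for counting the variance from K * fact j instead of from fact j.\<close>
  have eta2: "0 < \<eta> / 2" "\<eta> / 2 < 1" using eta by auto
  obtain K1 n1 :: nat and l1 :: real where K1: "1 \<le> K1" "0 < l1"
    and low1: "\<And>h n N l. pm_list h \<Longrightarrow> K1 * length h \<le> n \<Longrightarrow> n1 \<le> n \<Longrightarrow> n \<le> N \<Longrightarrow>
       (\<And>k. n \<le> k \<Longrightarrow> k \<le> N \<Longrightarrow> \<bar>l\<bar> * drift_prod (2 * p - 1) k N \<le> l1) \<Longrightarrow>
       exp (l * drift_prod (2 * p - 1) (length h) N * endpoint h + (1 - \<eta> / 2) * l^2 / 2 * var_sum (2 * p - 1) n N)
       \<le> path_exp p (N - length h) h (\<lambda>g. exp (l * endpoint g))"
  proof (rule path_mgf_ge[OF p(1,2) eta2], goal_cases)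
    case (1 K n0 l0)
    show ?thesis by (rule that[of K l0 n0]; fact 1)
  qed
  obtain K2 n2 :: nat and l2 :: real where K2: "1 \<le> K2" "0 < l2"
    and low2: "\<And>h n N l. pm_list h \<Longrightarrow> K2 * length h \<le> n \<Longrightarrow> n2 \<le> n \<Longrightarrow> n \<le> N \<Longrightarrow>
       (\<And>k. n \<le> k \<Longrightarrow> k \<le> N \<Longrightarrow> \<bar>l\<bar> * drift_prod (2 * p' - 1) k N \<le> l2) \<Longrightarrow>
       exp (l * drift_prod (2 * p' - 1) (length h) N * endpoint h + (1 - \<eta> / 2) * l^2 / 2 * var_sum (2 * p' - 1) n N)
       \<le> path_exp p' (N - length h) h (\<lambda>g. exp (l * endpoint g))"
  proof (rule path_mgf_ge[OF p(3,4) eta2], goal_cases)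
    case (1 K n0 l0)
    show ?thesis by (rule that[of K l0 n0]; fact 1)
  qed
  define K where "K = max K1 K2"
  have K: "1 \<le> K" "K1 \<le> K" "K2 \<le> K" using K1 by (auto simp: K_def)
  define t where "t = (\<lambda>j. comb_var u w (1 * fact j) (?N j) / real (?N j) / ?s^2)"
  define t' where "t' = (\<lambda>j. comb_var u w (K * fact j) (?N j) / real (?N j) / ?s^2)"
  have "t \<longlonglongrightarrow> ?s^2 / ?s^2" unfolding t_def
    by (intro tendsto_divide comb_var_fact_tendsto tendsto_const) (use s in auto)
  then have t: "t \<longlonglongrightarrow> 1" using s by simp
  have "t' \<longlonglongrightarrow> ?s^2 / ?s^2" unfolding t'_def
    by (intro tendsto_divide comb_var_fact_tendsto tendsto_const K) (use s in auto)
  then have t': "t' \<longlonglongrightarrow> 1" using s by simp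
  \<comment> \<open>As the block variance Q is about \<open>?s^2\<close> times N, this tilt places
    the centre \<open>l * Q\<close> of the window at about \<beta> \<open>?s\<close> times
    \<open>lil_scale N\<close>.\<close>
  define lam where "lam = (\<lambda>n::nat. \<beta> * sqrt 2 * sqrt (ln (ln (real n)) / real n) / ?s)"
  have small: "\<forall>\<^sub>F j in sequentially. \<forall>k. 1 \<le> k \<longrightarrow> k \<le> ?N j \<longrightarrow> \<bar>lam (?N j) * v\<bar> * drift_prod a k (?N j) \<le> l0"
    if a: "-1 < a" "a < 1/2" and l0: "0 < l0" for a v l0
  proof -
    \<comment> \<open>Nonnegative, so that (N/k)^d \<le> N^d uniformly in k \<ge> 1, and still below
      1/2, so that \<open>lam\<close> decays faster than N^d grows.\<close>
    define d where "d = max a 0"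
    have d: "0 \<le> d" "d < 1/2" "a \<le> d" using a by (auto simp: d_def)
    have "(\<lambda>n::nat. sqrt (ln (ln (real n)) / real n) * real n powr d) \<longlonglongrightarrow> 0"
      using d(2) by real_asymp
    then have "(\<lambda>n. \<bar>v\<bar> * exp 1 * \<beta> * sqrt 2 / ?s * (sqrt (ln (ln (real n)) / real n) * real n powr d))
       \<longlonglongrightarrow> \<bar>v\<bar> * exp 1 * \<beta> * sqrt 2 / ?s * 0"
      by (intro tendsto_mult tendsto_const)
    then have "\<forall>\<^sub>F n in sequentially. \<bar>v\<bar> * exp 1 * \<beta> * sqrt 2 / ?s * (sqrt (ln (ln (real n)) / real n) * real n powr d) < l0"
      by (rule order_tendstoD) (use l0 in simp)
    then have "\<forall>\<^sub>F j in sequentially. \<bar>v\<bar> * exp 1 * \<beta> * sqrt 2 / ?s * (sqrt (?L j / real (?N j)) * real (?N j) powr d) < l0"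
      by (rule eventually_compose_filterlim[OF _ filterlim_fact])
    moreover have "\<forall>\<^sub>F j in sequentially. 1 \<le> ?L j"
      by (rule eventually_compose_filterlim[OF eventually_lil_pos filterlim_fact])
    ultimately show ?thesis
    proof eventually_elim
      case (elim j)
      show ?case
      proof (intro allI impI)
        fix k :: nat assume k: "1 \<le> k" "k \<le> ?N j"
        have L0: "0 \<le> ?L j" using elim by linarith
        have lam0: "0 \<le> lam (?N j)" unfolding lam_def using b s L0
          by (intro divide_nonneg_pos mult_nonneg_nonneg real_sqrt_ge_zero) auto
        have q: "1 \<le> real n / real k \<and> real n / real k \<le> real n" if "k \<le> n" for n
        proof -
          have "real n * 1 \<le> real n * real k" using k by (intro mult_left_mono) auto
          then show ?thesis using that k by (simp add: field_simps)
        qed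
        have "drift_prod a k (?N j) \<le> exp 1 * (real (?N j) / real k) powr a"
          by (rule drift_prod_le_powr) (use a k in auto)
        also have "\<dots> \<le> exp 1 * (real (?N j) / real k) powr d"
          using q[OF k(2)] d by (intro mult_left_mono powr_mono) auto
        also have "\<dots> \<le> exp 1 * real (?N j) powr d"
          using q[OF k(2)] d by (intro mult_left_mono powr_mono2) auto
        finally have "\<bar>lam (?N j) * v\<bar> * drift_prod a k (?N j) \<le> \<bar>lam (?N j) * v\<bar> * (exp 1 * real (?N j) powr d)"
          by (intro mult_left_mono) auto
        also have "\<dots> = \<bar>v\<bar> * exp 1 * \<beta> * sqrt 2 / ?s * (sqrt (?L j / real (?N j)) * real (?N j) powr d)"
          using lam0 by (simp only: abs_mult abs_of_nonneg) (simp add: lam_def mult_ac)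
        finally show "\<bar>lam (?N j) * v\<bar> * drift_prod a k (?N j) \<le> l0" using elim by linarith
      qed
    qed
  qed
  \<comment> \<open>With ln (ln N) \<ge> M and t j > 1/2 the exponent (\<delta>^2 - \<eta>) l^2 Q /
    2 is at least ln 4, as the tilting bound requires.\<close>
  define M where "M = 4 * ln 4 / (\<delta>^2 * \<beta>^2)"
  have bt: "(\<lambda>j. (1 - \<delta>) * \<beta> * t j) \<longlonglongrightarrow> (1 - \<delta>) * \<beta> * 1"
    "(\<lambda>j. \<gamma> * t j) \<longlonglongrightarrow> \<gamma> * 1"
    "(\<lambda>j. (1 - \<eta> / 2) * t' j - (1 - \<eta>) * t j) \<longlonglongrightarrow> (1 - \<eta> / 2) * 1 - (1 - \<eta>) * 1"
    by (intro tendsto_intros t t')+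
  have "\<forall>\<^sub>F j in sequentially. 1 - \<epsilon> < (1 - \<delta>) * \<beta> * t j"
    by (rule order_tendstoD(1)[OF bt(1)]) (use bd in simp)
  moreover have "\<forall>\<^sub>F j in sequentially. \<gamma> * t j < \<kappa>"
    by (rule order_tendstoD(2)[OF bt(2)]) (use k in simp)
  moreover have "\<forall>\<^sub>F j in sequentially. 0 < (1 - \<eta> / 2) * t' j - (1 - \<eta>) * t j"
    by (rule order_tendstoD(1)[OF bt(3)]) (use eta in simp)
  moreover have "\<forall>\<^sub>F j in sequentially. 1 / 2 < t j"
    by (rule order_tendstoD(1)[OF t]) simp
  moreover have "\<forall>\<^sub>F j in sequentially. M \<le> ?L j"
  proof -
    have "\<forall>\<^sub>F n in sequentially. M \<le> ln (ln (real n))" by real_asymp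
    then show ?thesis by (rule eventually_compose_filterlim[OF _ filterlim_fact])
  qed
  moreover have "\<forall>\<^sub>F j in sequentially. 1 \<le> ?L j"
    by (rule eventually_compose_filterlim[OF eventually_lil_pos filterlim_fact])
  \<comment> \<open>This is where \<kappa> < 1 matters: the logarithmic factor is then beaten by (j
    + 1)^(1 - \<kappa>).\<close>
  moreover have "\<forall>\<^sub>F j in sequentially. 1 / real (Suc j) \<le> exp (- \<kappa> * ln (real (Suc j) * ln (real (Suc j)))) / 2"
    using k(1,2) by real_asymp
  moreover have "\<forall>\<^sub>F j in sequentially. \<forall>k. 1 \<le> k \<longrightarrow> k \<le> ?N j \<longrightarrow> \<bar>lam (?N j) * u\<bar> * drift_prod (2 * p - 1) k (?N j) \<le> l1"
    by (rule small) (use p K1 in auto)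
  moreover have "\<forall>\<^sub>F j in sequentially. \<forall>k. 1 \<le> k \<longrightarrow> k \<le> ?N j \<longrightarrow> \<bar>lam (?N j) * w\<bar> * drift_prod (2 * p' - 1) k (?N j) \<le> l2"
    by (rule small) (use p K2 in auto)
  moreover note eventually_ge_at_top[of "3 + K + n1 + n2"]
  ultimately have "\<forall>\<^sub>F j in sequentially. \<forall>h h'. pm_list h \<longrightarrow> pm_list h' \<longrightarrow> length h = fact j \<longrightarrow> length h' = fact j \<longrightarrow>
    1 / real (Suc j) \<le> path_exp p (?N j - fact j) h
         (\<lambda>g. path_exp p' (?N j - fact j) h' (\<lambda>g'. of_bool (block_event u w (1 - \<epsilon>) j (g, g'))))"
  proof eventually_elim
    case (elim j)
    show ?case
    proof (intro allI impI)
      fix h h' assume h: "pm_list h" "pm_list h'" "length h = fact j" "length h' = fact j"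
      define m where "m = (fact j :: nat)"
      define N where "N = ?N j"
      define n where "n = K * m"
      define L where "L = ln (ln (real N))"
      define l where "l = lam N"
      define Q where "Q = comb_var u w m N"
      let ?B = "drift_prod (2 * p - 1) m N" and ?B' = "drift_prod (2 * p' - 1) m N"
      let ?E = "\<lambda>F. path_exp p (N - m) h (\<lambda>g. path_exp p' (N - m) h' (\<lambda>g'. F (g, g')))"
      define D where "D = (\<lambda>z. u * (endpoint (fst z) - ?B * endpoint h) + w * (endpoint (snd z) - ?B' * endpoint h'))"
      have jm: "j \<le> m" unfolding m_def by (rule fact_ge_self)
      have m1: "1 \<le> m" by (simp add: m_def Suc_le_eq)
      have mN: "m \<le> N" unfolding m_def N_def by (rule fact_mono) simp
      have nN: "n \<le> N" unfolding n_def m_def N_def fact_Suc of_nat_id by (rule mult_le_mono1) (use elim in simp)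
      have mn: "m \<le> n" using K by (simp add: n_def)
      have N0: "0 < real N" using m1 mN by simp
      have L: "1 \<le> L" "M \<le> L" using elim by (auto simp: L_def N_def)
      have l: "0 < l" unfolding l_def lam_def L_def[symmetric] using b s L N0 by simp
      have l2: "l^2 * real N * ?s^2 = 2 * \<beta>^2 * L"
        unfolding l_def lam_def L_def[symmetric] using s L N0 by (simp add: power_mult_distrib power_divide)
      have Qt: "Q = t j * real N * ?s^2" unfolding Q_def t_def m_def N_def using s by simp
      have Q't: "comb_var u w n N = t' j * real N * ?s^2" unfolding n_def t'_def m_def N_def using s by simp
      have l2Q: "l^2 * Q = 2 * \<beta>^2 * L * t j"
      proof -
        have "l^2 * Q = (l^2 * real N * ?s^2) * t j" by (simp add: Qt)
        then show ?thesis unfolding l2 .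
      qed
      have lin: "?E (\<lambda>x. b * F x + c * G x) = b * ?E F + c * ?E G" for F G b c
        by (simp only: path_exp_linear)
      have mono: "?E F \<le> ?E G" if "\<And>x. F x \<le> G x" for F G
        by (intro path_exp_mono h that) (use p in auto)
      have up: "?E (\<lambda>x. exp (x0 * D x)) \<le> exp (x0^2 / 2 * Q)" for x0
      proof -
        have "?E (\<lambda>x. exp (x0 * D x)) = exp (- (x0 * u) * ?B * endpoint h) * path_exp p (N - m) h (\<lambda>g. exp ((x0 * u) * endpoint g))
     * (exp (- (x0 * w) * ?B' * endpoint h') * path_exp p' (N - m) h' (\<lambda>g'. exp ((x0 * w) * endpoint g')))"
          unfolding D_def fst_conv snd_conv by (rule block_mgf_eq)
        also have "\<dots> \<le> exp (- (x0 * u) * ?B * endpoint h) * gauss_weight p (x0 * u) N h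
     * (exp (- (x0 * w) * ?B' * endpoint h') * gauss_weight p' (x0 * w) N h')"
        proof (intro mult_mono mult_left_mono)
          show "path_exp p (N - m) h (\<lambda>g. exp ((x0 * u) * endpoint g)) \<le> gauss_weight p (x0 * u) N h"
            by (rule path_mgf_le) (use p h mN m_def in auto)
          show "path_exp p' (N - m) h' (\<lambda>g. exp ((x0 * w) * endpoint g)) \<le> gauss_weight p' (x0 * w) N h'"
            by (rule path_mgf_le) (use p h mN m_def in auto)
        qed (use p h in \<open>auto simp: gauss_weight_pos less_imp_le intro!: mult_nonneg_nonneg path_exp_nonneg\<close>)
        also have "\<dots> = exp (x0^2 / 2 * Q)"
          unfolding gauss_weight_def h(3,4) m_def[symmetric] Q_def comb_var_def
          by (simp add: field_simps power_mult_distrib flip: exp_add)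
        finally show ?thesis .
      qed
      have low: "exp ((1 - \<eta>) * l^2 / 2 * Q) \<le> ?E (\<lambda>x. exp (l * D x))"
      proof -
        have "(1 - \<eta>) * t j \<le> (1 - \<eta> / 2) * t' j" using elim by linarith
        then have "(1 - \<eta>) * t j * (l^2 / 2 * (real N * ?s^2)) \<le> (1 - \<eta> / 2) * t' j * (l^2 / 2 * (real N * ?s^2))"
          by (intro mult_right_mono) auto
        then have "(1 - \<eta>) * l^2 / 2 * Q \<le> (1 - \<eta> / 2) * l^2 / 2 * comb_var u w n N"
          by (simp add: Qt Q't mult_ac)
        then have "exp ((1 - \<eta>) * l^2 / 2 * Q) \<le> exp ((1 - \<eta> / 2) * l^2 / 2 * comb_var u w n N)" by simp
        also have "\<dots> = (exp (- (l * u) * ?B * endpoint h)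
              * exp ((l * u) * ?B * endpoint h + (1 - \<eta> / 2) * (l * u)^2 / 2 * var_sum (2 * p - 1) n N))
            * (exp (- (l * w) * ?B' * endpoint h')
              * exp ((l * w) * ?B' * endpoint h' + (1 - \<eta> / 2) * (l * w)^2 / 2 * var_sum (2 * p' - 1) n N))"
          unfolding comb_var_def by (simp add: power_mult_distrib algebra_simps add_divide_distrib flip: exp_add)
        also have "\<dots> \<le> (exp (- (l * u) * ?B * endpoint h) * path_exp p (N - m) h (\<lambda>g. exp ((l * u) * endpoint g)))
            * (exp (- (l * w) * ?B' * endpoint h') * path_exp p' (N - m) h' (\<lambda>g'. exp ((l * w) * endpoint g')))"
        proof -
          have "K1 * m \<le> n" "K2 * m \<le> n" using K by (auto simp: n_def)
          moreover have "n1 \<le> n" "n2 \<le> n" using elim jm mn by linarith+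
          moreover have "\<bar>l * u\<bar> * drift_prod (2 * p - 1) k N \<le> l1" "\<bar>l * w\<bar> * drift_prod (2 * p' - 1) k N \<le> l2"
            if "n \<le> k" "k \<le> N" for k
            using elim that m1 mn unfolding l_def N_def[symmetric] by auto
          ultimately show ?thesis
            using low1[OF h(1), of n N "l * u"] low2[OF h(2), of n N "l * w"] nN
            unfolding h(3,4) m_def[symmetric] 
            by (intro mult_mono mult_left_mono mult_nonneg_nonneg path_exp_nonneg) (use p h in auto)
        qed
        also have "\<dots> = ?E (\<lambda>x. exp (l * D x))"
          unfolding D_def fst_conv snd_conv by (rule block_mgf_eq[symmetric])
        finally show ?thesis .
      qed
      have big: "4 * exp (- (\<delta>^2 - \<eta>) * l^2 / 2 * Q) \<le> 1"
      proof -
        have "M * (1 / 2) \<le> L * t j" using L elim by (intro mult_mono) auto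
        then have "(\<delta>^2 * \<beta>^2 / 2) * (M * (1 / 2)) \<le> (\<delta>^2 * \<beta>^2 / 2) * (L * t j)" by (intro mult_left_mono) auto
        moreover have "(\<delta>^2 * \<beta>^2 / 2) * (M * (1 / 2)) = ln 4" using d b by (simp add: M_def)
        moreover have "(\<delta>^2 - \<eta>) * l^2 / 2 * Q = (\<delta>^2 * \<beta>^2 / 2) * (L * t j)"
        proof -
          have "(\<delta>^2 - \<eta>) * l^2 / 2 * Q = (\<delta>^2 / 2) / 2 * (l^2 * Q)" unfolding eta(3) by simp
          then show ?thesis unfolding l2Q by simp
        qed
        ultimately have "ln 4 \<le> (\<delta>^2 - \<eta>) * l^2 / 2 * Q" by linarith
        moreover have "- (\<delta>^2 - \<eta>) * l^2 / 2 * Q = - ((\<delta>^2 - \<eta>) * l^2 / 2 * Q)" by (simp add: field_simps)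
        ultimately have "exp (- (\<delta>^2 - \<eta>) * l^2 / 2 * Q) \<le> exp (- ln 4)"
          unfolding exp_le_cancel_iff by linarith
        also have "exp (- ln 4) = (1 / 4 :: real)" by (simp add: exp_minus)
        finally show ?thesis by linarith
      qed
      have tail: "exp (- (1 / 2 + \<delta> + \<eta> / 2) * l^2 * Q) / 2 \<le> ?E (\<lambda>x. of_bool ((1 - \<delta>) * l * Q \<le> D x))"
        by (rule tilted_tail_bound[where E = ?E and D = D and Q = Q, OF _ _ up low d l big]) (fact lin, fact mono)
      have "1 / real (Suc j) \<le> exp (- \<kappa> * ln (real (Suc j) * ln (real (Suc j)))) / 2" using elim by simp
      also have "\<dots> \<le> exp (- \<kappa> * L) / 2"
        using ln_ln_fact_le[of j] elim k unfolding L_def N_def by simp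
      also have "\<dots> \<le> exp (- (1 / 2 + \<delta> + \<eta> / 2) * l^2 * Q) / 2"
      proof -
        have "(1 / 2 + \<delta> + \<eta> / 2) * l^2 * Q = (1 / 2 + \<delta> + \<eta> / 2) * (l^2 * Q)" by simp
        also have "\<dots> = \<gamma> * t j * L" unfolding l2Q \<gamma>_def by (simp add: field_simps)
        also have "\<dots> \<le> \<kappa> * L" using elim L by (intro mult_right_mono) auto
        finally have "- \<kappa> * L \<le> - (1 / 2 + \<delta> + \<eta> / 2) * l^2 * Q" unfolding mult_minus_left by linarith
        then show ?thesis by (intro divide_right_mono) (simp_all only: exp_le_cancel_iff zero_le_numeral)
      qed
      also note tail
      also have "?E (\<lambda>x. of_bool ((1 - \<delta>) * l * Q \<le> D x)) \<le> ?E (\<lambda>x. of_bool ((1 - \<epsilon>) * ?s * lil_scale N \<le> D x))"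
      proof (rule mono)
        have lQ: "l * Q = \<beta> * ?s * t j * lil_scale N"
        proof -
          have "l * Q = l * real N * ?s^2 * t j" by (simp add: Qt)
          also have "l * real N * ?s^2 = \<beta> * ?s * lil_scale N"
            unfolding l_def lam_def L_def[symmetric] lil_scale_def using s N0
            by (simp add: real_sqrt_mult real_sqrt_divide power2_eq_square) (simp add: field_simps real_div_sqrt)
          finally show ?thesis by simp
        qed
        have "0 \<le> ?s * lil_scale N" using s L unfolding L_def by (intro mult_nonneg_nonneg lil_scale_nonneg) auto
        then have "(1 - \<epsilon>) * (?s * lil_scale N) \<le> ((1 - \<delta>) * \<beta> * t j) * (?s * lil_scale N)"
          using elim by (intro mult_right_mono) auto
        also have "((1 - \<delta>) * \<beta> * t j) * (?s * lil_scale N) = (1 - \<delta>) * l * Q"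
          unfolding mult.assoc[of "1 - \<delta>" l Q] lQ by (simp add: mult_ac)
        finally have "(1 - \<epsilon>) * ?s * lil_scale N \<le> (1 - \<delta>) * l * Q" by (simp only: mult.assoc)
        then show "of_bool ((1 - \<delta>) * l * Q \<le> D x) \<le> (of_bool ((1 - \<epsilon>) * ?s * lil_scale N \<le> D x) :: real)" for x
          by auto
      qed
      also have "?E (\<lambda>x. of_bool ((1 - \<epsilon>) * ?s * lil_scale N \<le> D x)) = ?E (\<lambda>x. of_bool (block_event u w (1 - \<epsilon>) j x))"
      proof -
        let ?G = "\<lambda>k k' g g'. of_bool ((1 - \<epsilon>) * ?s * lil_scale N
           \<le> u * (endpoint g - ?B * endpoint k) + w * (endpoint g' - ?B' * endpoint k')) :: real"
        have tk: "take m h = h" "take m h' = h'" using h by (auto simp: m_def)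
        have "?E (\<lambda>x. of_bool (block_event u w (1 - \<epsilon>) j x))
          = path_exp p (N - m) h (\<lambda>g. path_exp p' (N - m) h' (\<lambda>g'. ?G (take m g) (take m g') g g'))"
          unfolding block_event_def fst_conv snd_conv m_def N_def ..
        also have "\<dots> = path_exp p (N - m) h (\<lambda>g. path_exp p' (N - m) h' (\<lambda>g'. ?G (take m g) h' g g'))"
        proof -
          have "path_exp p' (N - m) h' (\<lambda>g'. ?G k (take m g') g g') = path_exp p' (N - m) h' (\<lambda>g'. ?G k h' g g')" for k g
            using path_exp_take[of m h' p' "N - m" "\<lambda>k'. ?G k k' g"] h(4) tk by (simp add: m_def)
          then show ?thesis by (simp only:)
        qed
        also have "\<dots> = path_exp p (N - m) h (\<lambda>g. path_exp p' (N - m) h' (\<lambda>g'. ?G h h' g g'))"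
          using path_exp_take[of m h p "N - m" "\<lambda>k g. path_exp p' (N - m) h' (\<lambda>g'. ?G k h' g g')"] h(3) tk
          by (simp add: m_def)
        finally show ?thesis by (simp add: D_def)
      qed
      finally show "1 / real (Suc j) \<le> path_exp p (?N j - fact j) h
         (\<lambda>g. path_exp p' (?N j - fact j) h' (\<lambda>g'. of_bool (block_event u w (1 - \<epsilon>) j (g, g'))))"
        unfolding m_def N_def .
    qed
  qed
  then show thesis using that unfolding eventually_at_top_linorder by blast
qed

text \<open>The upper bound at the four unit vectors; the lower bound needs it to control what the
  past adds to a block.\<close>

lemma AE_eventually_abs_walk_le:
  shows "AE \<omega> in M. \<forall>\<^sub>F n in sequentially.
     \<bar>real_of_int (walk X n \<omega>)\<bar> \<le> (sigma 1 0 + 1) * lil_scale n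
   \<and> \<bar>real_of_int (walk Y n \<omega>)\<bar> \<le> (sigma 0 1 + 1) * lil_scale n"
proof -
  have s: "0 < sigma 1 0" "0 < sigma (-1) 0" "0 < sigma 0 1" "0 < sigma 0 (-1)"
    "sigma (-1) 0 = sigma 1 0" "sigma 0 (-1) = sigma 0 1"
    using p by (auto simp: sigma_def)
  show ?thesis
    using AE_comb_le[OF s(1) zero_less_one] AE_comb_le[OF s(2) zero_less_one]
      AE_comb_le[OF s(3) zero_less_one] AE_comb_le[OF s(4) zero_less_one]
  proof eventually_elim
    case (elim \<omega>)
    then show ?case by eventually_elim (auto simp: comb_def s(5,6))
  qed
qed

text \<open>A successful block bounds only the increment over the propagated past. The past itself
  is at most of order \<open>lil_scale (fact j)\<close> by the upper bound, and removing it costs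
  the second \<epsilon>.\<close>

lemma AE_comb_ge_infinitely_often:
  assumes s: "0 < sigma u w" and e: "0 < \<epsilon>" "\<epsilon> < 1"
  shows "AE \<omega> in M. \<exists>\<^sub>\<infinity>n. (1 - 2 * \<epsilon>) * sigma u w * lil_scale n \<le> comb u w n \<omega>"
proof -
  let ?N = "\<lambda>j. fact (Suc j) :: nat"
  let ?B = "\<lambda>j. drift_prod (2 * p - 1) (fact j) (?N j)" and ?B' = "\<lambda>j. drift_prod (2 * p' - 1) (fact j) (?N j)"
  obtain J0 where J0: "\<And>j h h'. J0 \<le> j \<Longrightarrow> pm_list h \<Longrightarrow> pm_list h' \<Longrightarrow> length h = fact j \<Longrightarrow> length h' = fact j \<Longrightarrow>
    1 / real (Suc j) \<le> path_exp p (?N j - fact j) h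
         (\<lambda>g. path_exp p' (?N j - fact j) h' (\<lambda>g'. of_bool (block_event u w (1 - \<epsilon>) j (g, g'))))"
  proof (rule block_prob_ge[OF s e], goal_cases)
    case (1 J0)
    show ?thesis by (rule that; fact 1)
  qed
  have io: "AE \<omega> in M. \<exists>\<^sub>\<infinity>j. block_event u w (1 - \<epsilon>) j (hist2 (?N j) \<omega>)"
    by (rule AE_infinitely_often_block[where N = "fact" and ?J0.0 = J0])
       (use J0 in \<open>auto intro: monoI fact_mono simp: Suc_le_eq simp del: fact_Suc\<close>)
  define C where "C = sigma 1 0 + sigma 0 1 + 1"
  have "(\<lambda>j. \<bar>u\<bar> * C * (?B j * lil_scale (fact j) / lil_scale (?N j)) + \<bar>w\<bar> * C * (?B' j * lil_scale (fact j) / lil_scale (?N j)))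
     \<longlonglongrightarrow> \<bar>u\<bar> * C * 0 + \<bar>w\<bar> * C * 0"
    by (intro tendsto_intros drift_prod_lil_scale_fact_tendsto) (use p in auto)
  then have small: "\<forall>\<^sub>F j in sequentially. \<bar>u\<bar> * C * (?B j * lil_scale (fact j) / lil_scale (?N j))
      + \<bar>w\<bar> * C * (?B' j * lil_scale (fact j) / lil_scale (?N j)) < \<epsilon> * sigma u w"
    by (rule order_tendstoD) (use s e in simp)
  have ftop: "filterlim (\<lambda>j. fact j :: nat) at_top sequentially"
    by (rule filterlim_at_top_mono[OF filterlim_ident]) (intro always_eventually allI fact_ge_self)
  have L: "\<forall>\<^sub>F j in sequentially. 1 \<le> ln (ln (real (?N j)))" "\<forall>\<^sub>F j in sequentially. 1 \<le> ln (ln (real (fact j :: nat)))"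
    by (rule eventually_compose_filterlim[OF eventually_lil_pos filterlim_fact])
       (rule eventually_compose_filterlim[OF eventually_lil_pos ftop])
  show ?thesis using io AE_eventually_abs_walk_le
  proof eventually_elim
    case (elim \<omega>)
    have "\<forall>\<^sub>F j in sequentially. \<bar>real_of_int (walk X (fact j) \<omega>)\<bar> \<le> (sigma 1 0 + 1) * lil_scale (fact j)
       \<and> \<bar>real_of_int (walk Y (fact j) \<omega>)\<bar> \<le> (sigma 0 1 + 1) * lil_scale (fact j)"
      by (rule eventually_compose_filterlim[OF elim(2) ftop])
    then have "\<forall>\<^sub>F j in sequentially. block_event u w (1 - \<epsilon>) j (hist2 (?N j) \<omega>) \<longrightarrow>
       (1 - 2 * \<epsilon>) * sigma u w * lil_scale (?N j) \<le> comb u w (?N j) \<omega>"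
      using small L
    proof eventually_elim
      case (elim j)
      define m where "m = (fact j :: nat)"
      define N where "N = ?N j"
      let ?x = "real_of_int (walk X m \<omega>)" and ?y = "real_of_int (walk Y m \<omega>)"
      let ?b = "drift_prod (2 * p - 1) m N" and ?b' = "drift_prod (2 * p' - 1) m N"
      have mN: "m \<le> N" unfolding m_def N_def by (rule fact_mono) simp
      have m1: "1 \<le> m" by (simp add: m_def Suc_le_eq)
      have b: "0 < ?b" "0 < ?b'" using p m1 by (auto intro!: drift_prod_pos)
      have N1: "1 \<le> ln (ln (real N))" and scm: "0 \<le> lil_scale m"
        using elim lil_scale_nonneg unfolding m_def N_def by blast+
      have scN: "0 < lil_scale N"
      proof -
        have "0 < ln (ln (real N))" using N1 by linarith
        then show ?thesis using m1 mN unfolding lil_scale_def by (auto simp del: ln_gt_zero_iff)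
      qed
      show ?case
      proof
        assume "block_event u w (1 - \<epsilon>) j (hist2 (?N j) \<omega>)"
        then have ev: "(1 - \<epsilon>) * sigma u w * lil_scale N \<le> comb u w N \<omega> - (u * (?b * ?x) + w * (?b' * ?y))"
          unfolding block_event_def hist2_def fst_conv snd_conv m_def[symmetric] N_def[symmetric]
          by (simp add: take_hist[OF mN] endpoint_hist comb_def algebra_simps)
        have "\<bar>?x\<bar> \<le> (sigma 1 0 + 1) * lil_scale m" "\<bar>?y\<bar> \<le> (sigma 0 1 + 1) * lil_scale m"
          using elim by (auto simp: m_def)
        moreover have "(sigma 1 0 + 1) * lil_scale m \<le> C * lil_scale m" "(sigma 0 1 + 1) * lil_scale m \<le> C * lil_scale m"
          using sigma_nonneg scm by (auto intro!: mult_right_mono simp: C_def)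
        ultimately have xy: "\<bar>?x\<bar> \<le> C * lil_scale m" "\<bar>?y\<bar> \<le> C * lil_scale m" by linarith+
        have "\<bar>u * (?b * ?x)\<bar> \<le> \<bar>u\<bar> * (?b * (C * lil_scale m))" "\<bar>w * (?b' * ?y)\<bar> \<le> \<bar>w\<bar> * (?b' * (C * lil_scale m))"
          unfolding abs_mult using xy b by (auto intro!: mult_left_mono)
        then have "- (u * (?b * ?x) + w * (?b' * ?y)) \<le> \<bar>u\<bar> * (?b * (C * lil_scale m)) + \<bar>w\<bar> * (?b' * (C * lil_scale m))"
          by linarith
        also have "\<dots> = (\<bar>u\<bar> * C * (?b * lil_scale m / lil_scale N) + \<bar>w\<bar> * C * (?b' * lil_scale m / lil_scale N)) * lil_scale N"
          using scN by (simp add: field_simps)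
        also have "\<dots> \<le> \<epsilon> * sigma u w * lil_scale N"
          using elim scN unfolding m_def[symmetric] N_def[symmetric] by (intro mult_right_mono) auto
        finally have "- (u * (?b * ?x) + w * (?b' * ?y)) \<le> \<epsilon> * sigma u w * lil_scale N" .
        moreover have "(1 - 2 * \<epsilon>) * sigma u w * lil_scale N
           = (1 - \<epsilon>) * sigma u w * lil_scale N - \<epsilon> * sigma u w * lil_scale N" by (simp add: algebra_simps)
        ultimately show "(1 - 2 * \<epsilon>) * sigma u w * lil_scale (?N j) \<le> comb u w (?N j) \<omega>"
          using ev unfolding N_def[symmetric] by linarith
      qed
    qed
    then obtain J where J: "\<And>j. J \<le> j \<Longrightarrow> block_event u w (1 - \<epsilon>) j (hist2 (?N j) \<omega>) \<Longrightarrow>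
       (1 - 2 * \<epsilon>) * sigma u w * lil_scale (?N j) \<le> comb u w (?N j) \<omega>"
      unfolding eventually_at_top_linorder by blast
    show ?case unfolding INFM_nat_le
    proof
      fix k
      obtain j where j: "j \<ge> J + k" "block_event u w (1 - \<epsilon>) j (hist2 (?N j) \<omega>)"
        using elim(1) unfolding INFM_nat_le by blast
      have "k \<le> ?N j" using fact_ge_self[of "Suc j"] j(1) by linarith
      moreover have "(1 - 2 * \<epsilon>) * sigma u w * lil_scale (?N j) \<le> comb u w (?N j) \<omega>"
        by (rule J[OF _ j(2)]) (use j(1) in simp)
      ultimately show "\<exists>n\<ge>k. (1 - 2 * \<epsilon>) * sigma u w * lil_scale n \<le> comb u w n \<omega>" by blast
    qed
  qed
qed

lemma AE_limsup_comb:
  assumes s: "0 < sigma u w"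
  shows "AE \<omega> in M. limsup (\<lambda>n. ereal (comb u w n \<omega> / lil_scale n)) = ereal (sigma u w)"
proof -
  let ?s = "sigma u w"
  have up: "AE \<omega> in M. \<forall>k. \<forall>\<^sub>F n in sequentially. comb u w n \<omega> \<le> (?s + 1 / real (Suc k)) * lil_scale n"
    unfolding AE_all_countable by (intro allI AE_comb_le s) simp
  \<comment> \<open>The shift is by 2, as the lower bound requires \<epsilon> < 1 for k = 0
    too.\<close>
  have lo: "AE \<omega> in M. \<forall>k. \<exists>\<^sub>\<infinity>n. (1 - 2 * (1 / real (k + 2))) * ?s * lil_scale n \<le> comb u w n \<omega>"
    unfolding AE_all_countable by (intro allI AE_comb_ge_infinitely_often s) (auto simp: field_simps)
  have pos: "\<forall>\<^sub>F n in sequentially. 0 < lil_scale n"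
    using eventually_lil_pos eventually_ge_at_top[of 1]
  proof eventually_elim
    case (elim n)
    then have "0 < ln (ln (real n))" by linarith
    then show ?case using elim(2) unfolding lil_scale_def by (auto simp del: ln_gt_zero_iff)
  qed
  show ?thesis using up lo
  proof eventually_elim
    case (elim \<omega>)
    let ?r = "\<lambda>n. comb u w n \<omega> / lil_scale n"
    show ?case
    proof (rule antisym)
      show "limsup (\<lambda>n. ereal (?r n)) \<le> ereal ?s"
      proof (rule LIMSEQ_le_const)
        show "(\<lambda>k. ereal (?s + 1 / real (Suc k))) \<longlonglongrightarrow> ereal ?s"
        proof (rule tendsto_ereal)
          have "(\<lambda>k. ?s + 1 / real (Suc k)) \<longlonglongrightarrow> ?s + 0" by (intro tendsto_intros) real_asymp
          then show "(\<lambda>k. ?s + 1 / real (Suc k)) \<longlonglongrightarrow> ?s" by simp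
        qed
        have "limsup (\<lambda>n. ereal (?r n)) \<le> ereal (?s + 1 / real (Suc k))" for k
        proof (rule Limsup_bounded)
          show "\<forall>\<^sub>F n in sequentially. ereal (?r n) \<le> ereal (?s + 1 / real (Suc k))"
            using elim(1)[rule_format, of k] pos by eventually_elim (simp add: pos_divide_le_eq)
        qed
        then show "\<exists>N. \<forall>k\<ge>N. limsup (\<lambda>n. ereal (?r n)) \<le> ereal (?s + 1 / real (Suc k))" by blast
      qed
      show "ereal ?s \<le> limsup (\<lambda>n. ereal (?r n))"
      proof (rule LIMSEQ_le_const2)
        show "(\<lambda>k. ereal ((1 - 2 * (1 / real (k + 2))) * ?s)) \<longlonglongrightarrow> ereal ?s"
        proof (rule tendsto_ereal)
          have "(\<lambda>k. 1 - 2 * (1 / real (k + 2))) \<longlonglongrightarrow> 1" by real_asymp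
          then have "(\<lambda>k. (1 - 2 * (1 / real (k + 2))) * ?s) \<longlonglongrightarrow> 1 * ?s" by (intro tendsto_mult tendsto_const)
          then show "(\<lambda>k. (1 - 2 * (1 / real (k + 2))) * ?s) \<longlonglongrightarrow> ?s" by simp
        qed
        have "ereal ((1 - 2 * (1 / real (k + 2))) * ?s) \<le> limsup (\<lambda>n. ereal (?r n))" for k
        proof (rule ccontr)
          assume "\<not> ereal ((1 - 2 * (1 / real (k + 2))) * ?s) \<le> limsup (\<lambda>n. ereal (?r n))"
          then have "\<forall>\<^sub>F n in sequentially. ereal (?r n) < ereal ((1 - 2 * (1 / real (k + 2))) * ?s)"
            by (intro Limsup_lessD) simp
          then have "\<forall>\<^sub>F n in sequentially. \<not> ((1 - 2 * (1 / real (k + 2))) * ?s * lil_scale n \<le> comb u w n \<omega>)"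
            using pos by eventually_elim (simp add: pos_divide_less_eq not_le)
          then show False
            using elim(2)[rule_format, of k] by (simp add: frequently_def cofinite_eq_sequentially)
        qed
        then show "\<exists>N. \<forall>k\<ge>N. ereal ((1 - 2 * (1 / real (k + 2))) * ?s) \<le> limsup (\<lambda>n. ereal (?r n))" by blast
      qed
    qed
  qed
qed

end

theorem theorem1p6:
  fixes M :: "'a measure" and p q p' q' :: real
    and X Y :: "nat \<Rightarrow> 'a \<Rightarrow> int"
  assumes "prob_space M"
    and "0 \<le> q" "q \<le> 1" "0 \<le> q'" "q' \<le> 1"
    and "0 < p" "p < 3/4" "0 < p'" "p' < 3/4"
    and "indep_erw_pair M p q p' q' X Y"
  shows "AE \<omega> in M.
           limsup (\<lambda>n. ereal ((real_of_int (walk X n \<omega> - walk Y n \<omega>))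
                      / sqrt (2 * real n * ln (ln (real n)))))
             = ereal (sqrt (1 / (3 - 4 * p) + 1 / (3 - 4 * p')))
         \<and> limsup (\<lambda>n. ereal (- (real_of_int (walk X n \<omega> - walk Y n \<omega>))
                      / sqrt (2 * real n * ln (ln (real n)))))
             = ereal (sqrt (1 / (3 - 4 * p) + 1 / (3 - 4 * p')))"
proof -
  interpret erw_pair M p q p' q' X Y
    using assms by (simp add: erw_pair_def erw_pair_axioms_def)
  \<comment> \<open>The two signs of the theorem are two instances of the same limsup, with equal
    limits because only the squares of the coefficients enter.\<close>
  have sigma: "sigma 1 (-1) = sqrt (1 / (3 - 4 * p) + 1 / (3 - 4 * p'))"
    "sigma (-1) 1 = sqrt (1 / (3 - 4 * p) + 1 / (3 - 4 * p'))"
    by (simp_all add: sigma_def)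
  have "0 < sqrt (1 / (3 - 4 * p) + 1 / (3 - 4 * p'))" using p by (simp add: add_pos_pos)
  then have "0 < sigma 1 (-1)" "0 < sigma (-1) 1" by (simp_all only: sigma)
  then have lim: "AE \<omega> in M. limsup (\<lambda>n. ereal (comb 1 (-1) n \<omega> / lil_scale n)) = ereal (sigma 1 (-1))"
    "AE \<omega> in M. limsup (\<lambda>n. ereal (comb (-1) 1 n \<omega> / lil_scale n)) = ereal (sigma (-1) 1)"
    by (intro AE_limsup_comb; simp)+
  have comb: "comb 1 (-1) n \<omega> = real_of_int (walk X n \<omega> - walk Y n \<omega>)"
    "comb (-1) 1 n \<omega> = - real_of_int (walk X n \<omega> - walk Y n \<omega>)" for n \<omega>
    by (simp_all add: comb_def)
  show ?thesis
    using lim unfolding sigma lil_scale_def comb by eventually_elim simp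
qed

end
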